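(* Let $R$ be an irreducible reduced root system with root lattice $Q$ and weight lattice $P$, let $L$ be a lattice such that $Q\subseteq L\subseteq P$, and let $q\in\mathbb{C}^*$. Let $\tilde H_L$ and $\tilde H_P$ be the affine Hecke algebras corresponding to $L$ and $P$, with $\tilde H_L$ viewed as a subalgebra of $\tilde H_P$. Then there is an action of a finite group $K$ on $\tilde H_P$ by algebra automorphisms such that $$\tilde H_L=(\tilde H_P)^K$$ is the subalgebra of fixed points under the action of $K$.
   Context: Let $W$ be the Weyl group of $R$, $R^\vee=\{\alpha^\vee=2\alpha/\langle\alpha,\alpha\rangle : \alpha\in R\}$ the coroot system, $\alpha_1,\ldots,\alpha_n$ the simple roots for a fixed positive system, $s_1,\ldots,s_n$ the simple reflections, and $\omega_1,\ldots,\omega_n$ the fundamental weights, $\langle\omega_i,\alpha_j^\vee\rangle=\delta_{ij}$. Set $P=\sum_i\mathbb{Z}\omega_i$ and $Q=\sum_i\mathbb{Z}\alpha_i$. The extended affine Weyl group is $\tilde W=W\ltimes P=\{wt_\lambda : w\in W,\lambda\in P\}$ with $wt_\lambda=t_{w\lambda}w$. Let $\phi^\vee$ be the highest root of $R^\vee$, let $\phi\in R$ be the corresponding root, and define $s_0\in\tilde W$ by $s_0s_{\phi^\vee}=t_\phi$, where $s_{\phi^\vee}$ is the reflection in $\phi^\vee$. The subgroup $W_{\mathrm{aff}}=W\ltimes Q$ is a Coxeter group with generators $s_0,s_1,\ldots,s_n$. Let $\Omega=\{1\}\cup\{g_i : \omega_i \text{ minuscule}\}$ with $g_iw_0w_{0,i}=t_{\omega_i}$,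 where $w_0$ is the longest element of $W$ and $w_{0,i}$ the longest element of $\langle s_j: j\neq i,\,1\le j\le n\rangle$; $\omega_i$ is minuscule if $\langle\omega_i,\alpha^\vee\rangle\in\{0,1\}$ for all positive roots $\alpha$. Then $\Omega$ is a subgroup isomorphic to $P/Q$, its elements permute $\{s_0,\ldots,s_n\}$ by conjugation, and $\tilde W=W_{\mathrm{aff}}\rtimes\Omega$. The length function of $W_{\mathrm{aff}}$ is extended to $\tilde W$ by $\ell(wg)=\ell(w)$ for $w\in W_{\mathrm{aff}}$, $g\in\Omega$. For a lattice $Q\subseteq L\subseteq P$ let $\tilde W_L=W\ltimes L\subseteq\tilde W$. The affine braid group $\tilde{\mathcal B}_L$ is generated by $T_w$, $w\in\tilde W_L$, with relations $T_wT_{w'}=T_{ww'}$ whenever $\ell(ww')=\ell(w)+\ell(w')$. With $T_i=T_{s_i}$, the affine Hecke algebra $\tilde H_L$ is the quotient of the group algebra $\mathbb{C}\tilde{\mathcal B}_L$ by the relations $(T_i-q)(T_i+q^{-1})=0$ for $0\le i\le n$. It has basis $\{T_w: w\in\tilde W_L\}$ and is identified with the span of $\{T_w:w\in\tilde W_L\}$ in $\tilde H_P$. *)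

theory Defs
  imports
    "HOL-Analysis.Euclidean_Space"
    "HOL-Algebra.Algebra"
    "HOL-Library.Poly_Mapping"
begin

section \<open>Root systems\<close>

definition coroot :: "'a::euclidean_space \<Rightarrow> 'a" where
  "coroot \<alpha> = (2 / inner \<alpha> \<alpha>) *\<^sub>R \<alpha>"

definition reflection :: "'a::euclidean_space \<Rightarrow> 'a \<Rightarrow> 'a" where
  "reflection \<alpha> x = x - inner x (coroot \<alpha>) *\<^sub>R \<alpha>"

definition root_system :: "'a::euclidean_space set \<Rightarrow> bool" where
  "root_system R \<longleftrightarrow>
     finite R \<and> span R = UNIV \<and> 0 \<notin> R \<and>
     (\<forall>\<alpha>\<in>R. reflection \<alpha> ` R = R) \<and>
     (\<forall>\<alpha>\<in>R. \<forall>\<beta>\<in>R. inner \<beta> (coroot \<alpha>) \<in> \<int>)"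

definition reduced_roots :: "'a::euclidean_space set \<Rightarrow> bool" where
  "reduced_roots R \<longleftrightarrow> (\<forall>\<alpha>\<in>R. \<forall>c. c *\<^sub>R \<alpha> \<in> R \<longrightarrow> c = 1 \<or> c = -1)"

definition irreducible_roots :: "'a::euclidean_space set \<Rightarrow> bool" where
  "irreducible_roots R \<longleftrightarrow>
     R \<noteq> {} \<and>
     \<not> (\<exists>A B. A \<noteq> {} \<and> B \<noteq> {} \<and> A \<inter> B = {} \<and> R = A \<union> B \<and>
              (\<forall>\<alpha>\<in>A. \<forall>\<beta>\<in>B. inner \<alpha> \<beta> = 0))"

text \<open>Positive systems are the sets of roots on the positive side of a hyperplane through the
  origin containing no root.\<close>

definition positive_system :: "'a::euclidean_space set \<Rightarrow> 'a set \<Rightarrow> bool" where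
  "positive_system R Pos \<longleftrightarrow>
     (\<exists>v. (\<forall>\<alpha>\<in>R. inner \<alpha> v \<noteq> 0) \<and> Pos = {\<alpha>\<in>R. inner \<alpha> v > 0})"

text \<open>A positive system determines everything that follows, so the rank need not be named: simple
  roots, and the objects \<open>\<omega>\<^sub>i\<close>, \<open>s\<^sub>i\<close>, \<open>g\<^sub>i\<close> attached to them, are indexed by the simple root itself
  instead of by a number \<open>i\<close>.\<close>

definition simple_roots :: "'a::euclidean_space set \<Rightarrow> 'a set" where
  "simple_roots Pos = {\<alpha>\<in>Pos. \<not> (\<exists>\<beta>\<in>Pos. \<exists>\<gamma>\<in>Pos. \<alpha> = \<beta> + \<gamma>)}"

definition fund_weight :: "'a::euclidean_space set \<Rightarrow> 'a \<Rightarrow> 'a" where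
  "fund_weight Pos \<alpha> =
     (THE \<omega>. \<forall>\<beta>\<in>simple_roots Pos. inner \<omega> (coroot \<beta>) = (if \<beta> = \<alpha> then 1 else 0))"

definition root_lattice :: "'a::euclidean_space set \<Rightarrow> 'a set" where
  "root_lattice Pos = {\<Sum>\<alpha>\<in>simple_roots Pos. real_of_int (c \<alpha>) *\<^sub>R \<alpha> | c. True}"

definition weight_lattice :: "'a::euclidean_space set \<Rightarrow> 'a set" where
  "weight_lattice Pos = {\<Sum>\<alpha>\<in>simple_roots Pos. real_of_int (c \<alpha>) *\<^sub>R fund_weight Pos \<alpha> | c. True}"

text \<open>An additive subgroup lying between the root lattice and the weight lattice is automatically
  discrete and of full rank.\<close>

definition add_subgroup :: "'a::euclidean_space set \<Rightarrow> bool" where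
  "add_subgroup L \<longleftrightarrow> 0 \<in> L \<and> (\<forall>x\<in>L. \<forall>y\<in>L. x - y \<in> L)"

text \<open>The highest root: its difference with any other root is a sum of positive roots.\<close>

definition highest_root :: "'a::euclidean_space set \<Rightarrow> 'a set \<Rightarrow> 'a" where
  "highest_root R Pos =
     (THE \<theta>. \<theta> \<in> R \<and> (\<forall>\<beta>\<in>R. \<exists>m. \<theta> - \<beta> = (\<Sum>\<gamma>\<in>Pos. real (m \<gamma>) *\<^sub>R \<gamma>)))"

text \<open>The root \<open>\<phi>\<close> whose coroot is the highest root of the coroot system.\<close>

definition affine_root :: "'a::euclidean_space set \<Rightarrow> 'a set \<Rightarrow> 'a" where
  "affine_root R Pos =
     (THE \<phi>. \<phi> \<in> R \<and> coroot \<phi> = highest_root (coroot ` R) (coroot ` Pos))"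

definition minuscule :: "'a::euclidean_space set \<Rightarrow> 'a \<Rightarrow> bool" where
  "minuscule Pos \<omega> \<longleftrightarrow> (\<forall>\<alpha>\<in>Pos. inner \<omega> (coroot \<alpha>) \<in> {0, 1})"


section \<open>Extended affine Weyl groups and their length function\<close>

definition weyl_group :: "'a::euclidean_space set \<Rightarrow> ('a \<Rightarrow> 'a) set" where
  "weyl_group R = generate (BijGroup UNIV) (reflection ` R)"

text \<open>The semidirect product of the Weyl group with a lattice; \<open>(\<lambda>, w)\<close> stands for \<open>t\<^sub>\<lambda> w\<close>.\<close>

definition ext_affine :: "'a::euclidean_space set \<Rightarrow> 'a set \<Rightarrow> ('a \<times> ('a \<Rightarrow> 'a)) monoid" where
  "ext_affine R L =
     \<lparr>carrier = L \<times> weyl_group R,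
      monoid.mult = (\<lambda>(\<kappa>, w) (\<mu>, v). (\<kappa> + w \<mu>, w \<circ> v)),
      one = (0, id)\<rparr>"

abbreviation ext_weyl :: "'a::euclidean_space set \<Rightarrow> 'a set \<Rightarrow> ('a \<times> ('a \<Rightarrow> 'a)) monoid" where
  "ext_weyl R Pos \<equiv> ext_affine R (weight_lattice Pos)"

abbreviation affine_weyl :: "'a::euclidean_space set \<Rightarrow> 'a set \<Rightarrow> ('a \<times> ('a \<Rightarrow> 'a)) monoid" where
  "affine_weyl R Pos \<equiv> ext_affine R (root_lattice Pos)"

abbreviation translation :: "'a::euclidean_space \<Rightarrow> 'a \<times> ('a \<Rightarrow> 'a)" where
  "translation \<mu> \<equiv> (\<mu>, id)"

abbreviation lin_reflection :: "'a::euclidean_space \<Rightarrow> 'a \<times> ('a \<Rightarrow> 'a)" where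
  "lin_reflection \<alpha> \<equiv> (0, reflection \<alpha>)"

text \<open>Words without inverses suffice: all generators below are involutions.\<close>

definition word_length :: "('g, 'm) monoid_scheme \<Rightarrow> 'g set \<Rightarrow> 'g \<Rightarrow> nat" where
  "word_length G S x =
     (LEAST k. \<exists>xs. set xs \<subseteq> S \<and> length xs = k \<and> foldr (monoid.mult G) xs \<one>\<^bsub>G\<^esub> = x)"

definition longest_element :: "('g, 'm) monoid_scheme \<Rightarrow> 'g set \<Rightarrow> 'g" where
  "longest_element G S =
     (THE w. w \<in> generate G S \<and> (\<forall>v\<in>generate G S. word_length G S v \<le> word_length G S w))"

text \<open>\<open>s\<^sub>0\<close>, from \<open>s\<^sub>0 s\<^sub>\<phi>\<^sub>\<or> = t\<^sub>\<phi>\<close>.\<close>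

definition refl0 :: "'a::euclidean_space set \<Rightarrow> 'a set \<Rightarrow> 'a \<times> ('a \<Rightarrow> 'a)" where
  "refl0 R Pos =
     translation (affine_root R Pos) \<otimes>\<^bsub>ext_weyl R Pos\<^esub>
     inv\<^bsub>ext_weyl R Pos\<^esub> lin_reflection (coroot (affine_root R Pos))"

definition affine_gens :: "'a::euclidean_space set \<Rightarrow> 'a set \<Rightarrow> ('a \<times> ('a \<Rightarrow> 'a)) set" where
  "affine_gens R Pos = insert (refl0 R Pos) (lin_reflection ` simple_roots Pos)"

text \<open>\<open>g\<^sub>i\<close>, from \<open>g\<^sub>i w\<^sub>0 w\<^bsub>0,i\<^esub> = t\<^bsub>\<omega>\<^sub>i\<^esub>\<close>.\<close>

definition omega_elt :: "'a::euclidean_space set \<Rightarrow> 'a set \<Rightarrow> 'a \<Rightarrow> 'a \<times> ('a \<Rightarrow> 'a)" where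
  "omega_elt R Pos \<alpha> =
     (let G = ext_weyl R Pos;
          w0 = longest_element G (lin_reflection ` simple_roots Pos);
          w0i = longest_element G (lin_reflection ` (simple_roots Pos - {\<alpha>}))
      in translation (fund_weight Pos \<alpha>) \<otimes>\<^bsub>G\<^esub> inv\<^bsub>G\<^esub> (w0 \<otimes>\<^bsub>G\<^esub> w0i))"

definition Omega :: "'a::euclidean_space set \<Rightarrow> 'a set \<Rightarrow> ('a \<times> ('a \<Rightarrow> 'a)) set" where
  "Omega R Pos =
     insert \<one>\<^bsub>ext_weyl R Pos\<^esub>
       (omega_elt R Pos ` {\<alpha> \<in> simple_roots Pos. minuscule Pos (fund_weight Pos \<alpha>)})"

text \<open>Length on the extended group: write \<open>x = w g\<close> with \<open>w\<close> in the affine Weyl group and \<open>g\<close> in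
  \<open>\<Omega>\<close>, and take the Coxeter length of \<open>w\<close>.\<close>

definition ext_length :: "'a::euclidean_space set \<Rightarrow> 'a set \<Rightarrow> 'a \<times> ('a \<Rightarrow> 'a) \<Rightarrow> nat" where
  "ext_length R Pos x =
     word_length (affine_weyl R Pos) (affine_gens R Pos)
       (THE w. w \<in> carrier (affine_weyl R Pos) \<and>
               (\<exists>g\<in>Omega R Pos. x = w \<otimes>\<^bsub>ext_weyl R Pos\<^esub> g))"


section \<open>Groups given by generators and relations\<close>

text \<open>A word is a list of letters \<open>(x, b)\<close>, which stand for \<open>x\<close> if \<open>b\<close> holds and for the inverse of
  \<open>x\<close> otherwise. A relation \<open>u = v\<close> is the pair \<open>(u, v)\<close>.\<close>

type_synonym 'g word = "('g \<times> bool) list"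

definition words :: "'g set \<Rightarrow> 'g word set" where
  "words Gen = lists (Gen \<times> UNIV)"

inductive word_cong :: "'g set \<Rightarrow> ('g word \<times> 'g word) set \<Rightarrow> 'g word \<Rightarrow> 'g word \<Rightarrow> bool"
  for Gen :: "'g set" and Rel :: "('g word \<times> 'g word) set" where
  refl: "u \<in> words Gen \<Longrightarrow> word_cong Gen Rel u u"
| sym: "word_cong Gen Rel u v \<Longrightarrow> word_cong Gen Rel v u"
| trans: "word_cong Gen Rel u v \<Longrightarrow> word_cong Gen Rel v w \<Longrightarrow> word_cong Gen Rel u w"
| append: "word_cong Gen Rel u u' \<Longrightarrow> word_cong Gen Rel v v' \<Longrightarrow> word_cong Gen Rel (u @ v) (u' @ v')"
| cancel: "x \<in> Gen \<Longrightarrow> word_cong Gen Rel [(x, b), (x, \<not> b)] []"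
| rel: "(u, v) \<in> Rel \<Longrightarrow> u \<in> words Gen \<Longrightarrow> v \<in> words Gen \<Longrightarrow> word_cong Gen Rel u v"

definition word_class :: "'g set \<Rightarrow> ('g word \<times> 'g word) set \<Rightarrow> 'g word \<Rightarrow> 'g word set" where
  "word_class Gen Rel u = {v. word_cong Gen Rel u v}"

definition presented_group ::
    "'g set \<Rightarrow> ('g word \<times> 'g word) set \<Rightarrow> 'g word set monoid" where
  "presented_group Gen Rel =
     \<lparr>carrier = word_class Gen Rel ` words Gen,
      monoid.mult = (\<lambda>A B. \<Union>u\<in>A. \<Union>v\<in>B. word_class Gen Rel (u @ v)),
      one = word_class Gen Rel []\<rparr>"


section \<open>Complex group algebras and quotient algebras\<close>

definition group_algebra :: "('g, 'm) monoid_scheme \<Rightarrow> (complex, 'g \<Rightarrow>\<^sub>0 complex) module" where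
  "group_algebra G =
     \<lparr>carrier = {f. Poly_Mapping.keys f \<subseteq> carrier G},
      monoid.mult = (\<lambda>f g. \<Sum>x\<in>Poly_Mapping.keys f. \<Sum>y\<in>Poly_Mapping.keys g.
                Poly_Mapping.single (x \<otimes>\<^bsub>G\<^esub> y)
                  (Poly_Mapping.lookup f x * Poly_Mapping.lookup g y)),
      one = Poly_Mapping.single \<one>\<^bsub>G\<^esub> 1,
      ring.zero = 0,
      ring.add = (+),
      smult = (\<lambda>c. Poly_Mapping.map ((*) c))\<rparr>"

text \<open>\<^const>\<open>FactRing\<close> forgets the scalar multiplication, which is put back here.\<close>

definition quot_algebra :: "('c, 'r) module \<Rightarrow> 'r set \<Rightarrow> ('c, 'r set) module" where
  "quot_algebra A I =
     \<lparr>carrier = carrier (A Quot I),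
      monoid.mult = monoid.mult (A Quot I),
      one = monoid.one (A Quot I),
      ring.zero = ring.zero (A Quot I),
      ring.add = ring.add (A Quot I),
      smult = (\<lambda>c C. \<Union>x\<in>C. I +>\<^bsub>A\<^esub> (c \<odot>\<^bsub>A\<^esub> x))\<rparr>"

definition algebra_hom :: "('c, 'r) module \<Rightarrow> ('c, 's) module \<Rightarrow> ('r \<Rightarrow> 's) set" where
  "algebra_hom A B =
     {h \<in> ring_hom A B. \<forall>c. \<forall>x\<in>carrier A. h (c \<odot>\<^bsub>A\<^esub> x) = c \<odot>\<^bsub>B\<^esub> h x}"


section \<open>Affine braid groups and affine Hecke algebras\<close>

definition braid_relations ::
    "'a::euclidean_space set \<Rightarrow> 'a set \<Rightarrow> 'a set \<Rightarrow>
     (('a \<times> ('a \<Rightarrow> 'a)) word \<times> ('a \<times> ('a \<Rightarrow> 'a)) word) set" where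
  "braid_relations R Pos L =
     {([(w, True), (w', True)], [(w \<otimes>\<^bsub>ext_affine R L\<^esub> w', True)]) | w w'.
        w \<in> carrier (ext_affine R L) \<and> w' \<in> carrier (ext_affine R L) \<and>
        ext_length R Pos (w \<otimes>\<^bsub>ext_affine R L\<^esub> w') = ext_length R Pos w + ext_length R Pos w'}"

definition braid_group ::
    "'a::euclidean_space set \<Rightarrow> 'a set \<Rightarrow> 'a set \<Rightarrow> ('a \<times> ('a \<Rightarrow> 'a)) word set monoid" where
  "braid_group R Pos L =
     presented_group (carrier (ext_affine R L)) (braid_relations R Pos L)"

definition braid_T ::
    "'a::euclidean_space set \<Rightarrow> 'a set \<Rightarrow> 'a set \<Rightarrow> 'a \<times> ('a \<Rightarrow> 'a) \<Rightarrow>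
     ('a \<times> ('a \<Rightarrow> 'a)) word set" where
  "braid_T R Pos L w =
     word_class (carrier (ext_affine R L)) (braid_relations R Pos L) [(w, True)]"

definition hecke_relators ::
    "complex \<Rightarrow> 'a::euclidean_space set \<Rightarrow> 'a set \<Rightarrow> 'a set \<Rightarrow>
     (('a \<times> ('a \<Rightarrow> 'a)) word set \<Rightarrow>\<^sub>0 complex) set" where
  "hecke_relators q R Pos L =
     (let B = braid_group R Pos L;
          T = (\<lambda>s. Poly_Mapping.single (braid_T R Pos L s) 1);
          scalar = Poly_Mapping.single \<one>\<^bsub>B\<^esub>
      in {(T s - scalar q) \<otimes>\<^bsub>group_algebra B\<^esub> (T s + scalar (inverse q)) | s.
            s \<in> affine_gens R Pos})"

definition hecke_ideal ::
    "complex \<Rightarrow> 'a::euclidean_space set \<Rightarrow> 'a set \<Rightarrow> 'a set \<Rightarrow>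
     (('a \<times> ('a \<Rightarrow> 'a)) word set \<Rightarrow>\<^sub>0 complex) set" where
  "hecke_ideal q R Pos L =
     Idl\<^bsub>group_algebra (braid_group R Pos L)\<^esub> (hecke_relators q R Pos L)"

definition hecke_algebra ::
    "complex \<Rightarrow> 'a::euclidean_space set \<Rightarrow> 'a set \<Rightarrow> 'a set \<Rightarrow>
     (complex, (('a \<times> ('a \<Rightarrow> 'a)) word set \<Rightarrow>\<^sub>0 complex) set) module" where
  "hecke_algebra q R Pos L =
     quot_algebra (group_algebra (braid_group R Pos L)) (hecke_ideal q R Pos L)"

definition hecke_T ::
    "complex \<Rightarrow> 'a::euclidean_space set \<Rightarrow> 'a set \<Rightarrow> 'a set \<Rightarrow> 'a \<times> ('a \<Rightarrow> 'a) \<Rightarrow>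
     (('a \<times> ('a \<Rightarrow> 'a)) word set \<Rightarrow>\<^sub>0 complex) set" where
  "hecke_T q R Pos L w =
     hecke_ideal q R Pos L +>\<^bsub>group_algebra (braid_group R Pos L)\<^esub>
       Poly_Mapping.single (braid_T R Pos L w) 1"

text \<open>The inclusion of the algebra of \<open>L\<close> into the algebra of \<open>P\<close> sending \<open>T\<^sub>w\<close> to \<open>T\<^sub>w\<close>; since the
  \<open>T\<^sub>w\<close> generate, it is unique on the carrier.\<close>

definition hecke_inclusion ::
    "complex \<Rightarrow> 'a::euclidean_space set \<Rightarrow> 'a set \<Rightarrow> 'a set \<Rightarrow> 'a set \<Rightarrow>
     ((('a \<times> ('a \<Rightarrow> 'a)) word set \<Rightarrow>\<^sub>0 complex) set \<Rightarrow>
      (('a \<times> ('a \<Rightarrow> 'a)) word set \<Rightarrow>\<^sub>0 complex) set) \<Rightarrow> bool" where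
  "hecke_inclusion q R Pos L P \<iota> \<longleftrightarrow>
     \<iota> \<in> algebra_hom (hecke_algebra q R Pos L) (hecke_algebra q R Pos P) \<and>
     inj_on \<iota> (carrier (hecke_algebra q R Pos L)) \<and>
     (\<forall>w\<in>carrier (ext_affine R L). \<iota> (hecke_T q R Pos L w) = hecke_T q R Pos P w)"

end

theory Submission
  imports Defs "HOL-Analysis.Complex_Transcendental"
begin

text \<open>Let \<open>K\<close> be the group of characters of \<open>P / L\<close>. It is finite and acts on the algebra of \<open>P\<close> by
  \<open>T\<^sub>x \<mapsto> \<chi>(\<lambda>) T\<^sub>x\<close> for \<open>x = t\<^sub>\<lambda> w\<close>: the Weyl group acts trivially on \<open>P / Q\<close>, so this
  scaling is multiplicative, and the generators \<open>s\<^sub>i\<close> have degree zero. As the characters separate the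
  points of \<open>P / L\<close>, averaging over \<open>K\<close> projects onto the span of the \<open>T\<^sub>x\<close> with \<open>x\<close> in the
  semidirect product \<open>W t\<^sub>L\<close>.

  This span is a copy of the algebra of \<open>L\<close> because \<open>P / L\<close> has representatives of length zero in
  \<open>\<Omega>\<close>: moving them to the right turns words in the \<open>T\<^sub>x\<close> with \<open>x \<in> W t\<^sub>P\<close> into words over
  \<open>W t\<^sub>L\<close>, compatibly with the braid relations since lengths do not change, and with the quadratic
  relations since \<open>\<Omega>\<close> permutes the \<open>s\<^sub>i\<close>. So no basis theorem is needed.

  The facts on \<open>\<Omega>\<close> follow from its description as the stabilizer of \<open>\<rho> / h\<close> in \<open>W t\<^sub>P\<close>, where \<open>h\<close>
  is one plus the height of the highest coroot. The generators \<open>s\<^sub>i\<close> are the reflections in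
  the affine roots of absolute value \<open>1 / h\<close> at this point. The stabilizer meets \<open>W t\<^sub>Q\<close> trivially, since
  a nonzero \<open>\<nu> \<in> Q\<close> satisfies \<open>\<langle>\<nu>, \<beta>\<^sup>\<or>\<rangle> \<ge> 2\<close> for some root \<open>\<beta>\<close>.\<close>

section \<open>Group algebras and their quotients\<close>

text \<open>The obstacle is injectivity of the map between the two quotients, since both algebras
  are known only through presentations. It is settled by a linear retraction \<open>E\<close> of
  group algebras that carries one Hecke ideal into the other. \<open>E\<close> is not multiplicative
  in general, so the ideal is tested on all two-sided monomial multiples of the relators. The
  rewriting behind \<open>E\<close> carries a coset representative as a state: if L is larger than
  Q, then \<Omega> meets W t_L in a nontrivial group, which need not have a complement in \<Omega>,
  so the representatives need not form a group. The constants fit as follows. Coroot heights are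
  nonzero integers between 1 - h and h - 1, so the values ht + k h never drop below 1 in absolute
  value. For the same reason p = rho / h pairs with every coroot to less than 1 in absolute value.
  If t_\<nu> w fixes p, then \<nu> = p - w p pairs with every coroot to less than 2, so the lower
  bound 2 for nonzero vectors of Q is just what is required. The characters of P / L are built from
  L by adjoining one generator at a time, which works because every element of the multiplicative
  group of complex numbers has roots of all orders.\<close>

definition pm_scale :: "complex \<Rightarrow> ('g \<Rightarrow>\<^sub>0 complex) \<Rightarrow> ('g \<Rightarrow>\<^sub>0 complex)" where
  "pm_scale c = Poly_Mapping.map ((*) c)"

definition lin_ext :: "('g \<Rightarrow> 'k \<Rightarrow>\<^sub>0 complex) \<Rightarrow> ('g \<Rightarrow>\<^sub>0 complex) \<Rightarrow> ('k \<Rightarrow>\<^sub>0 complex)" where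
  "lin_ext h f = (\<Sum>x\<in>Poly_Mapping.keys f. pm_scale (Poly_Mapping.lookup f x) (h x))"

lemma lookup_scale [simp]: "Poly_Mapping.lookup (pm_scale c f) k = c * Poly_Mapping.lookup f k"
  by (simp add: pm_scale_def Poly_Mapping.map.rep_eq when_def)

lemma scale_single [simp]: "pm_scale c (Poly_Mapping.single x d) = Poly_Mapping.single x (c * d)"
  by (rule poly_mapping_eqI) (simp add: lookup_single when_def)

lemma scale_add: "pm_scale c (f + g) = pm_scale c f + pm_scale c g"
  by (rule poly_mapping_eqI) (simp add: lookup_add algebra_simps)

lemma scale_add_left: "pm_scale (c + d) f = pm_scale c f + pm_scale d f"
  by (rule poly_mapping_eqI) (simp add: lookup_add algebra_simps)

lemma scale_scale [simp]: "pm_scale c (pm_scale d f) = pm_scale (c * d) f"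
  by (rule poly_mapping_eqI) simp

lemma scale_zero [simp]: "pm_scale 0 f = 0" "pm_scale c 0 = 0" "pm_scale 1 f = f"
  by (rule poly_mapping_eqI, simp)+

lemma scale_diff: "pm_scale c (f - g) = pm_scale c f - pm_scale c g"
  by (rule poly_mapping_eqI) (simp add: lookup_minus algebra_simps)

lemma scale_sum: "pm_scale c (\<Sum>i\<in>A. f i) = (\<Sum>i\<in>A. pm_scale c (f i))"
  by (induction A rule: infinite_finite_induct) (auto simp: scale_add)

lemma keys_scale: "Poly_Mapping.keys (pm_scale c f) \<subseteq> Poly_Mapping.keys f"
  by (auto simp: in_keys_iff)

lemma lin_ext_superset:
  assumes "finite A" "Poly_Mapping.keys f \<subseteq> A"
  shows "lin_ext h f = (\<Sum>x\<in>A. pm_scale (Poly_Mapping.lookup f x) (h x))"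
  unfolding lin_ext_def by (rule sum.mono_neutral_left) (use assms in \<open>auto simp: in_keys_iff\<close>)

lemma lin_ext_add: "lin_ext h (f + g) = lin_ext h f + lin_ext h g"
proof -
  let ?A = "Poly_Mapping.keys f \<union> Poly_Mapping.keys g"
  have "Poly_Mapping.keys (f + g) \<subseteq> ?A" by (rule keys_add)
  then show ?thesis
    by (simp add: lin_ext_superset[of ?A] lookup_add scale_add_left sum.distrib)
qed

lemma lin_ext_zero [simp]: "lin_ext h 0 = 0"
  by (simp add: lin_ext_def)

lemma lin_ext_scale: "lin_ext h (pm_scale c f) = pm_scale c (lin_ext h f)"
  by (subst lin_ext_superset[OF finite_keys keys_scale]) (simp add: lin_ext_def scale_sum)

lemma lin_ext_single [simp]: "lin_ext h (Poly_Mapping.single x c) = pm_scale c (h x)"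
  by (simp add: lin_ext_superset[of "{x}"])

lemma lin_ext_diff: "lin_ext h (f - g) = lin_ext h f - lin_ext h g"
  using lin_ext_add[of h "f - g" g] by (simp add: algebra_simps)

lemma lin_ext_add_fun: "lin_ext (\<lambda>x. h x + k x) f = lin_ext h f + lin_ext k f"
  by (simp add: lin_ext_def scale_add sum.distrib)

lemma lin_ext_scale_fun: "lin_ext (\<lambda>x. pm_scale c (h x)) f = pm_scale c (lin_ext h f)"
  by (simp add: lin_ext_def scale_sum mult.commute)

lemma keys_lin_ext:
  assumes "\<And>x. x \<in> Poly_Mapping.keys f \<Longrightarrow> Poly_Mapping.keys (h x) \<subseteq> B"
  shows "Poly_Mapping.keys (lin_ext h f) \<subseteq> B"
  unfolding lin_ext_def using keys_sum keys_scale assms by fastforce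

text \<open>The support bounds in \<open>add\<close> allow inductions on identities that hold only
  over a carrier, such as associativity or the unit laws.\<close>

lemma poly_mapping_span_induct [consumes 1, case_names zero single add]:
  assumes "Poly_Mapping.keys f \<subseteq> A" and "P 0"
    and "\<And>x c. x \<in> A \<Longrightarrow> P (Poly_Mapping.single x c)"
    and add: "\<And>f g. Poly_Mapping.keys f \<subseteq> A \<Longrightarrow> Poly_Mapping.keys g \<subseteq> A \<Longrightarrow> P f \<Longrightarrow> P g \<Longrightarrow> P (f + g)"
  shows "P (f :: 'g \<Rightarrow>\<^sub>0 complex)"
proof -
  have eq: "f = (\<Sum>x\<in>Poly_Mapping.keys f. Poly_Mapping.single x (Poly_Mapping.lookup f x))"
    by (rule poly_mapping_eqI) (simp add: lookup_sum lookup_single when_def in_keys_iff)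
  have "Poly_Mapping.keys (\<Sum>x\<in>B. Poly_Mapping.single x (Poly_Mapping.lookup f x)) \<subseteq> A
      \<and> P (\<Sum>x\<in>B. Poly_Mapping.single x (Poly_Mapping.lookup f x))"
    \<comment> \<open>The support bound is proved together with \<open>P\<close>, because
      \<open>add\<close> asks for it at each partial sum.\<close>
    if "finite B" "B \<subseteq> A" for B
    using that
  proof (induction B rule: finite_induct)
    case (insert x F)
    have "Poly_Mapping.keys (Poly_Mapping.single x (Poly_Mapping.lookup f x)) \<subseteq> A"
      using insert.prems by simp
    with insert show ?case
      using add[OF _ _ assms(3)[of x "Poly_Mapping.lookup f x"]]
        order.trans[OF keys_add[of "Poly_Mapping.single x (Poly_Mapping.lookup f x)"], of _ A]
      by (simp del: keys_single)
  qed (simp add: assms(2))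
  from this[OF finite_keys assms(1)] show ?thesis using eq by simp
qed

lemma lin_ext_cong:
  assumes "\<And>x. x \<in> Poly_Mapping.keys f \<Longrightarrow> h x = k x"
  shows "lin_ext h f = lin_ext k f"
  using assms by (simp add: lin_ext_def)

lemma lin_ext_id: "lin_ext (\<lambda>x. Poly_Mapping.single x 1) f = f"
  using subset_UNIV[of "Poly_Mapping.keys f"]
  by (induction f rule: poly_mapping_span_induct) (auto simp: lin_ext_add)

lemma lin_ext_lin_ext: "lin_ext h (lin_ext k f) = lin_ext (\<lambda>x. lin_ext h (k x)) f"
  using subset_UNIV[of "Poly_Mapping.keys f"]
  by (induction f rule: poly_mapping_span_induct)
    (auto simp: lin_ext_add lin_ext_scale)

lemma group_algebra_simps:
  "carrier (group_algebra G) = {f. Poly_Mapping.keys f \<subseteq> carrier G}"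
  "\<one>\<^bsub>group_algebra G\<^esub> = Poly_Mapping.single \<one>\<^bsub>G\<^esub> 1"
  "\<zero>\<^bsub>group_algebra G\<^esub> = 0"
  "f \<oplus>\<^bsub>group_algebra G\<^esub> g = f + g"
  "c \<odot>\<^bsub>group_algebra G\<^esub> f = pm_scale c f"
  by (simp_all add: group_algebra_def pm_scale_def)

text \<open>As a double linear extension the product inherits bilinearity from the lemmas on
  \<open>lin_ext\<close>, and everything reduces to monomials.\<close>

lemma group_algebra_mult:
  "f \<otimes>\<^bsub>group_algebra G\<^esub> g =
     lin_ext (\<lambda>x. lin_ext (\<lambda>y. Poly_Mapping.single (x \<otimes>\<^bsub>G\<^esub> y) 1) g) f"
  by (simp add: group_algebra_def lin_ext_def scale_sum)

lemma group_algebra_mult_add: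
  "(f + f') \<otimes>\<^bsub>group_algebra G\<^esub> g = f \<otimes>\<^bsub>group_algebra G\<^esub> g + f' \<otimes>\<^bsub>group_algebra G\<^esub> g"
  "f \<otimes>\<^bsub>group_algebra G\<^esub> (g + g') = f \<otimes>\<^bsub>group_algebra G\<^esub> g + f \<otimes>\<^bsub>group_algebra G\<^esub> g'"
  by (simp_all add: group_algebra_mult lin_ext_add lin_ext_add_fun)

lemma group_algebra_mult_scale:
  "pm_scale c f \<otimes>\<^bsub>group_algebra G\<^esub> g = pm_scale c (f \<otimes>\<^bsub>group_algebra G\<^esub> g)"
  "f \<otimes>\<^bsub>group_algebra G\<^esub> pm_scale c g = pm_scale c (f \<otimes>\<^bsub>group_algebra G\<^esub> g)"
  by (simp_all add: group_algebra_mult lin_ext_scale lin_ext_scale_fun)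

lemma group_algebra_mult_zero [simp]:
  "0 \<otimes>\<^bsub>group_algebra G\<^esub> g = 0" "f \<otimes>\<^bsub>group_algebra G\<^esub> 0 = 0"
  by (simp_all add: group_algebra_mult lin_ext_def)

lemma group_algebra_mult_single [simp]:
  "Poly_Mapping.single x a \<otimes>\<^bsub>group_algebra G\<^esub> Poly_Mapping.single y b =
     Poly_Mapping.single (x \<otimes>\<^bsub>G\<^esub> y) (a * b)"
  by (simp add: group_algebra_mult)

lemma group_algebra_mult_diff:
  "(f - f') \<otimes>\<^bsub>group_algebra G\<^esub> g = f \<otimes>\<^bsub>group_algebra G\<^esub> g - f' \<otimes>\<^bsub>group_algebra G\<^esub> g"
  "f \<otimes>\<^bsub>group_algebra G\<^esub> (g - g') = f \<otimes>\<^bsub>group_algebra G\<^esub> g - f \<otimes>\<^bsub>group_algebra G\<^esub> g'"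
  using group_algebra_mult_add(1)[where f = "f - f'" and f' = f' and G = G and g = g]
    group_algebra_mult_add(2)[where f = f and g = "g - g'" and g' = g' and G = G]
  by (simp_all add: algebra_simps)

lemma (in monoid) ring_group_algebra: "ring (group_algebra G)"
proof -
  let ?A = "group_algebra G"
  have cl: "f \<otimes>\<^bsub>?A\<^esub> g \<in> carrier ?A" if "f \<in> carrier ?A" "g \<in> carrier ?A" for f g
  proof -
    have "Poly_Mapping.keys (f \<otimes>\<^bsub>?A\<^esub> g) \<subseteq> carrier G"
      unfolding group_algebra_mult
      by (intro keys_lin_ext) (use that in \<open>auto simp: group_algebra_simps\<close>)
    then show ?thesis by (simp add: group_algebra_simps)
  qed
  \<comment> \<open>Both sides are additive in each factor, so three nested inductions lead to
    monomials and to associativity in the monoid.\<close>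
  have assoc: "f \<otimes>\<^bsub>?A\<^esub> g \<otimes>\<^bsub>?A\<^esub> k = f \<otimes>\<^bsub>?A\<^esub> (g \<otimes>\<^bsub>?A\<^esub> k)"
    if "f \<in> carrier ?A" "g \<in> carrier ?A" "k \<in> carrier ?A" for f g k
  proof -
    have "Poly_Mapping.keys f \<subseteq> carrier G" "Poly_Mapping.keys g \<subseteq> carrier G"
      "Poly_Mapping.keys k \<subseteq> carrier G" using that by (auto simp: group_algebra_simps)
    then show ?thesis
    proof (induction f rule: poly_mapping_span_induct)
      case x: (single x a)
      from x.prems show ?case
      proof (induction g rule: poly_mapping_span_induct)
        case y: (single y b)
        from y.prems show ?case
          by (induction k rule: poly_mapping_span_induct)
            (simp_all add: group_algebra_mult_add m_assoc x.hyps y.hyps mult.assoc)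
      qed (simp_all add: group_algebra_mult_add)
    qed (simp_all add: group_algebra_mult_add)
  qed
  have one: "\<one>\<^bsub>?A\<^esub> \<otimes>\<^bsub>?A\<^esub> f = f \<and> f \<otimes>\<^bsub>?A\<^esub> \<one>\<^bsub>?A\<^esub> = f" if "f \<in> carrier ?A" for f
  proof -
    have "Poly_Mapping.keys f \<subseteq> carrier G" using that by (auto simp: group_algebra_simps)
    then show ?thesis
      by (induction f rule: poly_mapping_span_induct)
        (simp_all add: group_algebra_mult_add group_algebra_simps)
  qed
  show ?thesis
  proof (rule ringI)
    show "abelian_group ?A"
    proof (rule abelian_groupI)
      fix f assume "f \<in> carrier ?A"
      then show "\<exists>y\<in>carrier ?A. y \<oplus>\<^bsub>?A\<^esub> f = \<zero>\<^bsub>?A\<^esub>"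
        by (intro bexI[of _ "-f"]) (auto simp: group_algebra_simps)
    qed (auto simp: group_algebra_simps algebra_simps dest: subsetD[OF keys_add])
    show "Group.monoid ?A"
      by (rule monoidI) (use cl assoc one in \<open>auto simp: group_algebra_simps\<close>)
  qed (auto simp: group_algebra_simps group_algebra_mult_add)
qed

section \<open>Words and groups given by presentations\<close>

lemma word_cong_in_words:
  "word_cong Gen Rel u v \<Longrightarrow> u \<in> words Gen \<and> v \<in> words Gen"
  by (induction rule: word_cong.induct) (auto simp: words_def)

lemma words_append [simp]: "u @ v \<in> words Gen \<longleftrightarrow> u \<in> words Gen \<and> v \<in> words Gen"
  by (auto simp: words_def)

lemma words_Nil [simp]: "[] \<in> words Gen"
  by (auto simp: words_def)

lemma words_Cons [simp]: "(x, b) # u \<in> words Gen \<longleftrightarrow> x \<in> Gen \<and> u \<in> words Gen"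
  by (auto simp: words_def)

lemma word_class_eq_iff:
  assumes "u \<in> words Gen" "v \<in> words Gen"
  shows "word_class Gen Rel u = word_class Gen Rel v \<longleftrightarrow> word_cong Gen Rel u v"
proof
  assume "word_class Gen Rel u = word_class Gen Rel v"
  with assms show "word_cong Gen Rel u v"
    unfolding word_class_def by (metis mem_Collect_eq word_cong.refl)
next
  assume "word_cong Gen Rel u v"
  then show "word_class Gen Rel u = word_class Gen Rel v"
    unfolding word_class_def by (blast intro: word_cong.trans word_cong.sym)
qed

lemma word_class_cong: "word_cong Gen Rel u v \<Longrightarrow> word_class Gen Rel u = word_class Gen Rel v"
  using word_cong_in_words word_class_eq_iff by blast

text \<open>The product of classes is a union over all representatives; since congruence respects
  concatenation, all members of this union coincide.\<close>

lemma presented_mult [simp]: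
  assumes "u \<in> words Gen" "v \<in> words Gen"
  shows "word_class Gen Rel u \<otimes>\<^bsub>presented_group Gen Rel\<^esub> word_class Gen Rel v
       = word_class Gen Rel (u @ v)"
proof -
  have "word_class Gen Rel (u' @ v') = word_class Gen Rel (u @ v)"
    if "u' \<in> word_class Gen Rel u" "v' \<in> word_class Gen Rel v" for u' v'
    using that unfolding word_class_def[of _ _ u] word_class_def[of _ _ v]
    by (intro word_class_cong) (auto intro: word_cong.append word_cong.sym)
  moreover have "u \<in> word_class Gen Rel u" "v \<in> word_class Gen Rel v"
    using assms by (auto simp: word_class_def intro: word_cong.refl)
  ultimately have "(\<Union>u'\<in>word_class Gen Rel u. \<Union>v'\<in>word_class Gen Rel v. word_class Gen Rel (u' @ v'))
      = word_class Gen Rel (u @ v)"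
    by blast
  then show ?thesis by (simp add: presented_group_def)
qed

lemma presented_carrier: "carrier (presented_group Gen Rel) = word_class Gen Rel ` words Gen"
  by (simp add: presented_group_def)

lemma presented_one: "\<one>\<^bsub>presented_group Gen Rel\<^esub> = word_class Gen Rel []"
  by (simp add: presented_group_def)

definition inv_word :: "'g word \<Rightarrow> 'g word" where
  "inv_word u = rev (map (\<lambda>(x, b). (x, \<not> b)) u)"

lemma inv_word_in_words: "u \<in> words Gen \<Longrightarrow> inv_word u \<in> words Gen"
  by (auto simp: words_def inv_word_def)

text \<open>The first letter of the word and the last letter of the inverse of the word are adjacent
  in the middle; they cancel, and what remains is the shorter case.\<close>

lemma inv_word_cancel: "u \<in> words Gen \<Longrightarrow> word_cong Gen Rel (inv_word u @ u) []"
proof (induction u)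
  case (Cons l u)
  obtain x b where l: "l = (x, b)" by (cases l)
  with Cons.prems have x: "x \<in> Gen" and u: "u \<in> words Gen" by auto
  have "word_cong Gen Rel [(x, \<not> b), (x, b)] []"
    using word_cong.cancel[OF x, of Rel "\<not> b"] by simp
  then have "word_cong Gen Rel (inv_word u @ ([(x, \<not> b), (x, b)] @ u)) (inv_word u @ ([] @ u))"
    by (intro word_cong.append word_cong.refl inv_word_in_words u)
  with Cons.IH[OF u] show ?case
    by (auto simp: inv_word_def l intro: word_cong.trans)
qed (simp add: inv_word_def word_cong.refl)

lemma group_presented: "group (presented_group Gen Rel)"
proof (rule groupI)
  fix b assume "b \<in> carrier (presented_group Gen Rel)"
  then obtain u where "b = word_class Gen Rel u" "u \<in> words Gen"
    by (auto simp: presented_carrier)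
  then show "\<exists>y\<in>carrier (presented_group Gen Rel). y \<otimes>\<^bsub>presented_group Gen Rel\<^esub> b
      = \<one>\<^bsub>presented_group Gen Rel\<^esub>"
    by (intro bexI[of _ "word_class Gen Rel (inv_word u)"])
      (auto simp: presented_carrier presented_one inv_word_in_words
        intro!: word_class_cong inv_word_cancel)
qed (auto simp: presented_carrier presented_one)

text \<open>Maps out of a presented group are defined on an arbitrary representative. They are well
  defined as soon as the map on words respects congruence.\<close>

definition rep_word :: "'g word set \<Rightarrow> 'g word" where
  "rep_word A = (SOME u. u \<in> A)"

lemma rep_word_cong:
  assumes "u \<in> words Gen"
  shows "word_cong Gen Rel (rep_word (word_class Gen Rel u)) u"
proof -
  have "u \<in> word_class Gen Rel u"
    using assms by (auto simp: word_class_def intro: word_cong.refl)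
  then have "rep_word (word_class Gen Rel u) \<in> word_class Gen Rel u"
    unfolding rep_word_def by (rule someI)
  then show ?thesis by (auto simp: word_class_def intro: word_cong.sym)
qed

text \<open>This covers two uses: the embedding of braid groups, with all coefficients
  \<open>1\<close>, and the twist by a character, with \<open>\<gamma>\<close> the identity.\<close>

lemma monomial_ring_hom:
  assumes "group G" "group G'" and \<gamma>: "\<gamma> \<in> hom G G'"
    and \<xi>: "\<And>x y. x \<in> carrier G \<Longrightarrow> y \<in> carrier G \<Longrightarrow> \<xi> (x \<otimes>\<^bsub>G\<^esub> y) = \<xi> x * \<xi> y" "\<xi> \<one>\<^bsub>G\<^esub> = 1"
  shows "lin_ext (\<lambda>x. Poly_Mapping.single (\<gamma> x) (\<xi> x)) \<in> ring_hom (group_algebra G) (group_algebra G')"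
    (is "?h \<in> _")
proof (rule ring_hom_memI)
  interpret G: group G by fact
  interpret G': group G' by fact
  have \<gamma>1: "\<gamma> \<one>\<^bsub>G\<^esub> = \<one>\<^bsub>G'\<^esub>" using hom_one[OF \<gamma>] assms by blast
  show "?h f \<in> carrier (group_algebra G')" if "f \<in> carrier (group_algebra G)" for f
    using that hom_in_carrier[OF \<gamma>] unfolding group_algebra_simps mem_Collect_eq
    by (intro keys_lin_ext) auto
  show "?h (f \<otimes>\<^bsub>group_algebra G\<^esub> g) = ?h f \<otimes>\<^bsub>group_algebra G'\<^esub> ?h g"
    if "f \<in> carrier (group_algebra G)" "g \<in> carrier (group_algebra G)" for f g
  proof -
    have "Poly_Mapping.keys f \<subseteq> carrier G" "Poly_Mapping.keys g \<subseteq> carrier G"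
      using that by (auto simp: group_algebra_simps)
    then show ?thesis
    proof (induction f rule: poly_mapping_span_induct)
      case x: (single x a)
      from x.prems show ?case
        by (induction g rule: poly_mapping_span_induct)
          (simp_all add: lin_ext_add group_algebra_mult_add x.hyps \<xi> hom_mult[OF \<gamma>] mult.assoc mult.left_commute)
    qed (simp_all add: group_algebra_mult_add lin_ext_add)
  qed
qed (simp_all add: group_algebra_simps lin_ext_add \<xi> hom_one[OF \<gamma> assms(1,2)])

section \<open>Ideals of group algebras and the quotient algebras\<close>

locale group_algebra_ideal = group G + ideal I "group_algebra G" for G (structure) and I
begin

abbreviation "A \<equiv> group_algebra G"

lemma I_subset: "f \<in> I \<Longrightarrow> f \<in> carrier A"
  using a_subset by blast

lemma I_zero: "0 \<in> I"
  using additive_subgroup.zero_closed[OF is_additive_subgroup] by (simp add: group_algebra_simps)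

lemma I_add: "f \<in> I \<Longrightarrow> g \<in> I \<Longrightarrow> f + g \<in> I"
  using additive_subgroup.a_closed[OF is_additive_subgroup] by (simp add: group_algebra_simps)

text \<open>Scaling by \<open>c\<close> is multiplication by \<open>c\<close> times the unit, so an
  ideal of the ring is also a linear subspace.\<close>

lemma I_scale: "f \<in> I \<Longrightarrow> pm_scale c f \<in> I"
proof -
  assume f: "f \<in> I"
  have "Poly_Mapping.single \<one> c \<in> carrier A" by (auto simp: group_algebra_simps)
  from I_l_closed[OF f this] have "pm_scale c (\<one>\<^bsub>A\<^esub> \<otimes>\<^bsub>A\<^esub> f) \<in> I"
    by (simp add: group_algebra_mult_scale(1)[symmetric] group_algebra_simps)
  then show ?thesis using l_one[OF I_subset[OF f]] by simp
qed

lemma I_uminus: "f \<in> I \<Longrightarrow> - f \<in> I"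
proof -
  have "pm_scale (-1) f = - f" by (rule poly_mapping_eqI) simp
  then show "f \<in> I \<Longrightarrow> - f \<in> I" using I_scale[of f "-1"] by simp
qed

lemma I_diff: "f \<in> I \<Longrightarrow> g \<in> I \<Longrightarrow> f - g \<in> I"
  using I_add[of f "- g"] I_uminus[of g] by simp

lemma I_sum: "(\<And>i. i \<in> M \<Longrightarrow> f i \<in> I) \<Longrightarrow> sum f M \<in> I"
  by (induction M rule: infinite_finite_induct) (auto simp: I_zero I_add)

lemma coset_eq: "I +>\<^bsub>A\<^esub> f = {i + f | i. i \<in> I}"
  by (auto simp: a_r_coset_def r_coset_def group_algebra_simps)

lemma coset_eq_iff: "I +>\<^bsub>A\<^esub> f = I +>\<^bsub>A\<^esub> g \<longleftrightarrow> f - g \<in> I"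
proof
  assume "I +>\<^bsub>A\<^esub> f = I +>\<^bsub>A\<^esub> g"
  then have "0 + f \<in> {i + g | i. i \<in> I}" unfolding coset_eq using I_zero by blast
  then show "f - g \<in> I" by auto
next
  assume fg: "f - g \<in> I"
  have "i + f = (i + (f - g)) + g" "i + g = (i - (f - g)) + f" for i by auto
  then show "I +>\<^bsub>A\<^esub> f = I +>\<^bsub>A\<^esub> g"
    unfolding coset_eq using I_add[OF _ fg] I_diff[OF _ fg] by blast
qed

abbreviation "AI \<equiv> quot_algebra A I"

lemma quot_carrier: "carrier AI = (\<lambda>f. I +>\<^bsub>A\<^esub> f) ` carrier A"
  by (auto simp: quot_algebra_def FactRing_def A_RCOSETS_def RCOSETS_def a_r_coset_def)

lemma quot_add:
  "f \<in> carrier A \<Longrightarrow> g \<in> carrier A \<Longrightarrow> (I +>\<^bsub>A\<^esub> f) \<oplus>\<^bsub>AI\<^esub> (I +>\<^bsub>A\<^esub> g) = I +>\<^bsub>A\<^esub> (f + g)"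
  using a_rcos_sum by (simp add: quot_algebra_def FactRing_def group_algebra_simps)

lemma quot_mult:
  "f \<in> carrier A \<Longrightarrow> g \<in> carrier A \<Longrightarrow> (I +>\<^bsub>A\<^esub> f) \<otimes>\<^bsub>AI\<^esub> (I +>\<^bsub>A\<^esub> g) = I +>\<^bsub>A\<^esub> (f \<otimes>\<^bsub>A\<^esub> g)"
  using rcoset_mult_add by (simp add: quot_algebra_def FactRing_def)

lemma quot_one: "\<one>\<^bsub>AI\<^esub> = I +>\<^bsub>A\<^esub> \<one>\<^bsub>A\<^esub>"
  by (simp add: quot_algebra_def FactRing_def)

text \<open>All members of a coset give the same scaled coset because the ideal is stable under
  scalars; the union in the definition is therefore a single coset.\<close>

lemma quot_smult: "c \<odot>\<^bsub>AI\<^esub> (I +>\<^bsub>A\<^esub> f) = I +>\<^bsub>A\<^esub> pm_scale c f"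
proof -
  have "I +>\<^bsub>A\<^esub> pm_scale c x = I +>\<^bsub>A\<^esub> pm_scale c f" if "x \<in> I +>\<^bsub>A\<^esub> f" for x
    using that I_scale[of "x - f" c] unfolding coset_eq_iff by (auto simp: coset_eq scale_diff)
  moreover have "f \<in> I +>\<^bsub>A\<^esub> f" using I_zero by (force simp: coset_eq)
  ultimately have "(\<Union>x\<in>I +>\<^bsub>A\<^esub> f. I +>\<^bsub>A\<^esub> pm_scale c x) = I +>\<^bsub>A\<^esub> pm_scale c f"
    by blast
  then show ?thesis by (simp add: quot_algebra_def group_algebra_simps)
qed

end

text \<open>If \<open>h\<close> carries the first ideal into \<open>J\<close>, all members of
  \<open>C\<close> lead to the same coset and the union is that coset. No representative has to be
  chosen.\<close>

definition quot_map ::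
    "(complex, 's \<Rightarrow>\<^sub>0 complex) module \<Rightarrow> ('s \<Rightarrow>\<^sub>0 complex) set \<Rightarrow> (('r \<Rightarrow>\<^sub>0 complex) \<Rightarrow> ('s \<Rightarrow>\<^sub>0 complex)) \<Rightarrow>
     ('r \<Rightarrow>\<^sub>0 complex) set \<Rightarrow> ('s \<Rightarrow>\<^sub>0 complex) set" where
  "quot_map B J h C = (\<Union>f\<in>C. J +>\<^bsub>B\<^esub> h f)"

locale quot_map_data =
  dom: group_algebra_ideal G I + cod: group_algebra_ideal G' J for G I G' J +
  fixes h
  assumes h_hom: "lin_ext h \<in> ring_hom (group_algebra G) (group_algebra G')"
    and h_ideal: "\<And>f. f \<in> I \<Longrightarrow> lin_ext h f \<in> J"
begin

abbreviation "hq \<equiv> quot_map (group_algebra G') J (lin_ext h)"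

lemma quot_map_coset: "hq (I +>\<^bsub>group_algebra G\<^esub> f) = J +>\<^bsub>group_algebra G'\<^esub> lin_ext h f"
proof -
  have "J +>\<^bsub>group_algebra G'\<^esub> lin_ext h x = J +>\<^bsub>group_algebra G'\<^esub> lin_ext h f"
    if "x \<in> I +>\<^bsub>group_algebra G\<^esub> f" for x
  proof -
    obtain i where "i \<in> I" "x = i + f" using \<open>x \<in> _\<close> unfolding dom.coset_eq by blast
    then show ?thesis using h_ideal unfolding cod.coset_eq_iff by (simp add: lin_ext_add)
  qed
  moreover have "f \<in> I +>\<^bsub>group_algebra G\<^esub> f"
    unfolding dom.coset_eq using dom.I_zero by (metis (mono_tags, lifting) CollectI add_0)
  ultimately show ?thesis unfolding quot_map_def by blast
qed

text \<open>The map \<open>k\<close> is prescribed only on cosets of carrier elements. This also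
  admits maps restricted to the carrier, as required for a group action.\<close>

lemma quot_homI:
  assumes k: "\<And>f. f \<in> carrier (group_algebra G) \<Longrightarrow>
    k (I +>\<^bsub>group_algebra G\<^esub> f) = J +>\<^bsub>group_algebra G'\<^esub> lin_ext h f"
  shows "k \<in> algebra_hom (quot_algebra (group_algebra G) I) (quot_algebra (group_algebra G') J)"
proof -
  note cl = ring_hom_closed[OF h_hom]
  have A: "ring (group_algebra G)" by (rule ideal.axioms(2)[OF dom.ideal_axioms])
  note clA = monoid.m_closed[OF ring.is_monoid[OF A]] monoid.one_closed[OF ring.is_monoid[OF A]]
  have add: "f + g \<in> carrier (group_algebra G)"
    if "f \<in> carrier (group_algebra G)" "g \<in> carrier (group_algebra G)" for f g
    using that keys_add[of f g] unfolding group_algebra_simps by blast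
  have "k \<in> ring_hom (quot_algebra (group_algebra G) I) (quot_algebra (group_algebra G') J)"
  proof (rule ring_hom_memI)
    fix x y assume "x \<in> carrier (quot_algebra (group_algebra G) I)"
      "y \<in> carrier (quot_algebra (group_algebra G) I)"
    then obtain f g where f: "f \<in> carrier (group_algebra G)" "x = I +>\<^bsub>group_algebra G\<^esub> f"
      and g: "g \<in> carrier (group_algebra G)" "y = I +>\<^bsub>group_algebra G\<^esub> g"
      unfolding dom.quot_carrier by blast
    show "k x \<in> carrier (quot_algebra (group_algebra G') J)"
      unfolding f k[OF f(1)] cod.quot_carrier using cl[OF f(1)] by blast
    show "k (x \<otimes>\<^bsub>quot_algebra (group_algebra G) I\<^esub> y)
        = k x \<otimes>\<^bsub>quot_algebra (group_algebra G') J\<^esub> k y"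
      unfolding f g dom.quot_mult[OF f(1) g(1)] k[OF f(1)] k[OF g(1)] k[OF clA(1)[OF f(1) g(1)]]
        cod.quot_mult[OF cl[OF f(1)] cl[OF g(1)]] ring_hom_mult[OF h_hom f(1) g(1)] ..
    show "k (x \<oplus>\<^bsub>quot_algebra (group_algebra G) I\<^esub> y)
        = k x \<oplus>\<^bsub>quot_algebra (group_algebra G') J\<^esub> k y"
      unfolding f g dom.quot_add[OF f(1) g(1)] k[OF f(1)] k[OF g(1)] k[OF add[OF f(1) g(1)]]
        cod.quot_add[OF cl[OF f(1)] cl[OF g(1)]] lin_ext_add ..
  next
    show "k \<one>\<^bsub>quot_algebra (group_algebra G) I\<^esub> = \<one>\<^bsub>quot_algebra (group_algebra G') J\<^esub>"
      unfolding dom.quot_one cod.quot_one k[OF clA(2)] ring_hom_one[OF h_hom] ..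
  qed
  moreover have "k (c \<odot>\<^bsub>quot_algebra (group_algebra G) I\<^esub> x) = c \<odot>\<^bsub>quot_algebra (group_algebra G') J\<^esub> k x"
    if x: "x \<in> carrier (quot_algebra (group_algebra G) I)" for c x
  proof -
    obtain f where f: "f \<in> carrier (group_algebra G)" "x = I +>\<^bsub>group_algebra G\<^esub> f"
      using x unfolding dom.quot_carrier by blast
    have "pm_scale c f \<in> carrier (group_algebra G)"
      using f(1) keys_scale[of c f] unfolding group_algebra_simps by blast
    then show ?thesis
      unfolding f dom.quot_smult k[OF f(1)] cod.quot_smult by (simp only: k lin_ext_scale)
  qed
  ultimately show ?thesis unfolding algebra_hom_def by blast
qed

lemma quot_map_hom: "hq \<in> algebra_hom (quot_algebra (group_algebra G) I) (quot_algebra (group_algebra G') J)"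
  by (rule quot_homI) (rule quot_map_coset)

lemma quot_map_inj:
  assumes "\<And>f. f \<in> carrier (group_algebra G) \<Longrightarrow> lin_ext h f \<in> J \<Longrightarrow> f \<in> I"
  shows "inj_on hq (carrier (quot_algebra (group_algebra G) I))"
proof (rule inj_onI)
  fix x y assume "x \<in> carrier (quot_algebra (group_algebra G) I)"
    "y \<in> carrier (quot_algebra (group_algebra G) I)" and eq: "hq x = hq y"
  then obtain f g where fg: "f \<in> carrier (group_algebra G)" "g \<in> carrier (group_algebra G)"
    "x = I +>\<^bsub>group_algebra G\<^esub> f" "y = I +>\<^bsub>group_algebra G\<^esub> g"
    unfolding dom.quot_carrier by blast
  have "lin_ext h (f - g) \<in> J"
    using eq unfolding fg quot_map_coset cod.coset_eq_iff lin_ext_diff .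
  moreover have "f - g \<in> carrier (group_algebra G)"
    using fg(1,2) keys_diff[of f g] unfolding group_algebra_simps by blast
  ultimately have "f - g \<in> I" by (rule assms[rotated])
  then show "x = y" unfolding fg dom.coset_eq_iff .
qed

end

section \<open>Algebras attached to a length function\<close>

text \<open>The algebras depend on the root system only through a group, a length function and a set
  of generators. In this form the algebra of a subgroup arises from the same data with a smaller
  carrier.\<close>

definition len_braid_relations ::
    "('g, 'm) monoid_scheme \<Rightarrow> ('g \<Rightarrow> nat) \<Rightarrow> ('g word \<times> 'g word) set" where
  "len_braid_relations G len =
     {([(w, True), (w', True)], [(w \<otimes>\<^bsub>G\<^esub> w', True)]) | w w'.
        w \<in> carrier G \<and> w' \<in> carrier G \<and> len (w \<otimes>\<^bsub>G\<^esub> w') = len w + len w'}"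

definition len_braid_group :: "('g, 'm) monoid_scheme \<Rightarrow> ('g \<Rightarrow> nat) \<Rightarrow> 'g word set monoid" where
  "len_braid_group G len = presented_group (carrier G) (len_braid_relations G len)"

definition len_class :: "('g, 'm) monoid_scheme \<Rightarrow> ('g \<Rightarrow> nat) \<Rightarrow> 'g word \<Rightarrow> 'g word set" where
  "len_class G len u = word_class (carrier G) (len_braid_relations G len) u"

abbreviation word_T :: "'g \<Rightarrow> 'g word" where
  "word_T w \<equiv> [(w, True)]"

definition len_relators ::
    "complex \<Rightarrow> ('g, 'm) monoid_scheme \<Rightarrow> ('g \<Rightarrow> nat) \<Rightarrow> 'g set \<Rightarrow> ('g word set \<Rightarrow>\<^sub>0 complex) set" where
  "len_relators q G len S =
     (let B = len_braid_group G len;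
          T = (\<lambda>s. Poly_Mapping.single (len_class G len (word_T s)) 1);
          scalar = Poly_Mapping.single \<one>\<^bsub>B\<^esub>
      in {(T s - scalar q) \<otimes>\<^bsub>group_algebra B\<^esub> (T s + scalar (inverse q)) | s. s \<in> S})"

definition len_ideal ::
    "complex \<Rightarrow> ('g, 'm) monoid_scheme \<Rightarrow> ('g \<Rightarrow> nat) \<Rightarrow> 'g set \<Rightarrow> ('g word set \<Rightarrow>\<^sub>0 complex) set" where
  "len_ideal q G len S = Idl\<^bsub>group_algebra (len_braid_group G len)\<^esub> (len_relators q G len S)"

definition len_hecke ::
    "complex \<Rightarrow> ('g, 'm) monoid_scheme \<Rightarrow> ('g \<Rightarrow> nat) \<Rightarrow> 'g set \<Rightarrow>
     (complex, ('g word set \<Rightarrow>\<^sub>0 complex) set) module" where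
  "len_hecke q G len S = quot_algebra (group_algebra (len_braid_group G len)) (len_ideal q G len S)"

definition len_hecke_T ::
    "complex \<Rightarrow> ('g, 'm) monoid_scheme \<Rightarrow> ('g \<Rightarrow> nat) \<Rightarrow> 'g set \<Rightarrow> 'g \<Rightarrow>
     ('g word set \<Rightarrow>\<^sub>0 complex) set" where
  "len_hecke_T q G len S w =
     len_ideal q G len S +>\<^bsub>group_algebra (len_braid_group G len)\<^esub>
       Poly_Mapping.single (len_class G len (word_T w)) 1"

lemma group_len_braid: "group (len_braid_group G len)"
  by (simp add: len_braid_group_def group_presented)

lemma len_class_mult [simp]:
  "u \<in> words (carrier G) \<Longrightarrow> v \<in> words (carrier G) \<Longrightarrow>
    len_class G len u \<otimes>\<^bsub>len_braid_group G len\<^esub> len_class G len v = len_class G len (u @ v)"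
  by (simp add: len_braid_group_def len_class_def)

lemma len_braid_carrier: "carrier (len_braid_group G len) = len_class G len ` words (carrier G)"
  by (auto simp: len_braid_group_def len_class_def presented_carrier)

lemma len_braid_one: "\<one>\<^bsub>len_braid_group G len\<^esub> = len_class G len []"
  by (simp add: len_braid_group_def len_class_def presented_one)

lemma len_relator_expand:
  assumes "s \<in> carrier G"
  shows "(Poly_Mapping.single (len_class G len (word_T s)) 1 - Poly_Mapping.single \<one>\<^bsub>len_braid_group G len\<^esub> q)
      \<otimes>\<^bsub>group_algebra (len_braid_group G len)\<^esub>
      (Poly_Mapping.single (len_class G len (word_T s)) 1
        + Poly_Mapping.single \<one>\<^bsub>len_braid_group G len\<^esub> (inverse q))
    = Poly_Mapping.single (len_class G len (word_T s @ word_T s)) 1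
      + Poly_Mapping.single (len_class G len (word_T s)) (inverse q - q)
      - Poly_Mapping.single (len_class G len []) (q * inverse q)"
  using assms
  by (simp add: group_algebra_mult_diff group_algebra_mult_add len_braid_one single_diff)

text \<open>This is \<open>(T_s - q) (T_s + 1/q)\<close> multiplied out, with the class of
  \<open>u\<close> on the left and that of \<open>v\<close> on the right. Relators in arbitrary
  position are what the rewriting of words meets.\<close>

definition len_relator ::
    "complex \<Rightarrow> ('g, 'm) monoid_scheme \<Rightarrow> ('g \<Rightarrow> nat) \<Rightarrow> 'g word \<Rightarrow> 'g \<Rightarrow> 'g word \<Rightarrow> 'g word set \<Rightarrow>\<^sub>0 complex" where
  "len_relator q G len u s v =
     Poly_Mapping.single (len_class G len (u @ word_T s @ word_T s @ v)) 1
     + Poly_Mapping.single (len_class G len (u @ word_T s @ v)) (inverse q - q)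
     - Poly_Mapping.single (len_class G len (u @ v)) (q * inverse q)"

lemma len_relators_eq:
  assumes "S \<subseteq> carrier G"
  shows "len_relators q G len S = (\<lambda>s. len_relator q G len [] s []) ` S"
proof -
  have "len_relators q G len S = (\<lambda>s. (Poly_Mapping.single (len_class G len (word_T s)) 1
        - Poly_Mapping.single \<one>\<^bsub>len_braid_group G len\<^esub> q)
      \<otimes>\<^bsub>group_algebra (len_braid_group G len)\<^esub>
      (Poly_Mapping.single (len_class G len (word_T s)) 1
        + Poly_Mapping.single \<one>\<^bsub>len_braid_group G len\<^esub> (inverse q))) ` S"
    by (auto simp: len_relators_def Let_def)
  also have "\<dots> = (\<lambda>s. len_relator q G len [] s []) ` S"
  proof (rule image_cong)
    fix s assume "s \<in> S"
    then have "s \<in> carrier G" using assms by blast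
    from len_relator_expand[OF this] show "(Poly_Mapping.single (len_class G len (word_T s)) 1
        - Poly_Mapping.single \<one>\<^bsub>len_braid_group G len\<^esub> q)
      \<otimes>\<^bsub>group_algebra (len_braid_group G len)\<^esub>
      (Poly_Mapping.single (len_class G len (word_T s)) 1
        + Poly_Mapping.single \<one>\<^bsub>len_braid_group G len\<^esub> (inverse q)) = len_relator q G len [] s []"
      unfolding len_relator_def by simp
  qed simp
  finally show ?thesis .
qed

lemma len_relator_mult:
  assumes "s \<in> carrier G" "u \<in> words (carrier G)" "v \<in> words (carrier G)"
  shows "Poly_Mapping.single (len_class G len u) 1 \<otimes>\<^bsub>group_algebra (len_braid_group G len)\<^esub>
     len_relator q G len [] s [] \<otimes>\<^bsub>group_algebra (len_braid_group G len)\<^esub>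
     Poly_Mapping.single (len_class G len v) 1 = len_relator q G len u s v"
  using assms by (simp add: len_relator_def group_algebra_mult_diff group_algebra_mult_add)

section \<open>Evaluation of words and relators in the ideal\<close>

fun (in group) ev :: "'a word \<Rightarrow> 'a" where
  "ev [] = \<one>"
| "ev ((x, b) # u) = (if b then x else inv x) \<otimes> ev u"

context group begin

lemma ev_closed [simp]: "u \<in> words (carrier G) \<Longrightarrow> ev u \<in> carrier G"
  by (induction u rule: ev.induct) auto

lemma ev_append: "u \<in> words (carrier G) \<Longrightarrow> v \<in> words (carrier G) \<Longrightarrow> ev (u @ v) = ev u \<otimes> ev v"
  by (induction u rule: ev.induct) (auto simp: m_assoc)

text \<open>Braid relations and cancellations are true equations in the group. Hence evaluation
  descends to the braid group and grades its group algebra by \<open>G\<close>.\<close>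

lemma ev_cong:
  "word_cong (carrier G) (len_braid_relations G len) u v \<Longrightarrow> ev u = ev v"
proof (induction rule: word_cong.induct)
  case (append u u' v v')
  then show ?case using word_cong_in_words by (metis ev_append)
next
  case (cancel x b)
  then show ?case by (cases b) auto
next
  case (rel u v)
  then show ?case by (auto simp: len_braid_relations_def m_assoc)
qed auto

lemma group_len_algebra: "group_algebra_ideal (len_braid_group G len) (len_ideal q G len S)"
  if S: "S \<subseteq> carrier G"
proof -
  interpret B: group "len_braid_group G len" by (rule group_len_braid)
  interpret A: ring "group_algebra (len_braid_group G len)" by (rule B.ring_group_algebra)
  have "len_relator q G len [] s [] \<in> carrier (group_algebra (len_braid_group G len))"
    if "s \<in> S" for s
  proof -
    have cl: "len_class G len u \<in> carrier (len_braid_group G len)" if "u \<in> words (carrier G)" for u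
      using that by (auto simp: len_braid_carrier)
    have 1: "Poly_Mapping.keys (Poly_Mapping.single (len_class G len u) c)
        \<subseteq> carrier (len_braid_group G len)" if "u \<in> words (carrier G)" for u c
      using that cl by auto
    have "s \<in> carrier G" using that S by auto
    then show ?thesis
      unfolding len_relator_def group_algebra_simps mem_Collect_eq
      by (intro order.trans[OF keys_diff] order.trans[OF keys_add] Un_least 1) auto
  qed
  then have "len_relators q G len S \<subseteq> carrier (group_algebra (len_braid_group G len))"
    using S by (auto simp: len_relators_eq)
  then show ?thesis
    unfolding group_algebra_ideal_def len_ideal_def
    using A.genideal_ideal B.is_group by blast
qed

text \<open>The relator in position \<open>u\<close>, \<open>v\<close> is the generating relator
  multiplied by monomials on both sides.\<close>

lemma len_relator_in_ideal:
  assumes S: "S \<subseteq> carrier G" and s: "s \<in> S"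
    and u: "u \<in> words (carrier G)" and v: "v \<in> words (carrier G)"
  shows "len_relator q G len u s v \<in> len_ideal q G len S"
proof -
  interpret I: group_algebra_ideal "len_braid_group G len" "len_ideal q G len S"
    by (rule group_len_algebra[OF S])
  have cl: "Poly_Mapping.single (len_class G len u) 1 \<in> carrier (group_algebra (len_braid_group G len))"
    if "u \<in> words (carrier G)" for u
    using that by (auto simp: group_algebra_simps len_braid_carrier)
  have "len_relators q G len S \<subseteq> len_ideal q G len S"
  proof -
    have "Idl\<^bsub>group_algebra (len_braid_group G len)\<^esub> (len_relators q G len S) \<supseteq> len_relators q G len S"
      by (auto simp: genideal_def)
    then show ?thesis by (simp add: len_ideal_def)
  qed
  then have "len_relator q G len [] s [] \<in> len_ideal q G len S"
    using s by (auto simp: len_relators_eq[OF S])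
  then have "Poly_Mapping.single (len_class G len u) 1 \<otimes>\<^bsub>group_algebra (len_braid_group G len)\<^esub>
     len_relator q G len [] s [] \<otimes>\<^bsub>group_algebra (len_braid_group G len)\<^esub>
     Poly_Mapping.single (len_class G len v) 1 \<in> len_ideal q G len S"
    by (intro I.I_l_closed I.I_r_closed cl u v)
  then show ?thesis using len_relator_mult[OF _ u v] S s by (metis subsetD)
qed

end

text \<open>The model: \<open>G\<close> is the extended group of the weight lattice,
  \<open>H\<close> that of \<open>L\<close>, \<open>\<Gamma>\<close> is \<open>Omega\<close> and
  \<open>S\<close> consists of the affine simple reflections. The groups \<open>H\<close> and
  \<open>\<Gamma>\<close> may intersect nontrivially.\<close>

locale hecke_pair = group G for G :: "('g, 'm) monoid_scheme" (structure) +
  fixes H \<Gamma> S :: "'g set" and len :: "'g \<Rightarrow> nat" and q :: complex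
  assumes subH: "subgroup H G" and subG: "subgroup \<Gamma> G" and fin: "finite \<Gamma>"
    and cover: "\<And>x. x \<in> carrier G \<Longrightarrow> \<exists>h\<in>H. \<exists>g\<in>\<Gamma>. x = h \<otimes> g"
    and SH: "S \<subseteq> H"
    and conjS: "\<And>g s. g \<in> \<Gamma> \<Longrightarrow> s \<in> S \<Longrightarrow> g \<otimes> s \<otimes> inv g \<in> S"
    and len_left: "\<And>g x. g \<in> \<Gamma> \<Longrightarrow> x \<in> carrier G \<Longrightarrow> len (g \<otimes> x) = len x"
    and len_right: "\<And>g x. g \<in> \<Gamma> \<Longrightarrow> x \<in> carrier G \<Longrightarrow> len (x \<otimes> g) = len x"
    and len_one: "len \<one> = 0"
begin

abbreviation "N \<equiv> G\<lparr>carrier := H\<rparr>"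

lemma groupN: "group N" using subH by (rule subgroup_imp_group)

lemma H_carrier: "h \<in> H \<Longrightarrow> h \<in> carrier G"
  using subH by (rule subgroup.mem_carrier)

lemma G_carrier: "h \<in> \<Gamma> \<Longrightarrow> h \<in> carrier G"
  using subG by (rule subgroup.mem_carrier)

lemmas H_simps = subgroup.m_closed[OF subH] subgroup.m_inv_closed[OF subH] subgroup.one_closed[OF subH]
lemmas G_simps = subgroup.m_closed[OF subG] subgroup.m_inv_closed[OF subG] subgroup.one_closed[OF subG]

lemma S_carrier: "S \<subseteq> carrier G" using SH H_carrier by blast

text \<open>The representative of the coset \<open>H x\<close> is taken from
  \<open>\<Gamma>\<close>, where lengths vanish. On \<open>H\<close> itself it is fixed to be the
  unit, so that rewriting leaves words over \<open>H\<close> unchanged.\<close>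

definition rep :: "'g \<Rightarrow> 'g" where
  "rep x = (if x \<in> H then \<one> else SOME c. c \<in> \<Gamma> \<and> c \<in> H #> x)"

lemma rep_props:
  assumes x: "x \<in> carrier G"
  shows "rep x \<in> \<Gamma>" "x \<otimes> inv (rep x) \<in> H"
proof -
  have "rep x \<in> \<Gamma> \<and> x \<otimes> inv (rep x) \<in> H"
  proof (cases "x \<in> H")
    case False
    obtain h g where hg: "h \<in> H" "g \<in> \<Gamma>" "x = h \<otimes> g" using cover[OF x] by blast
    then have "g = inv h \<otimes> x" using H_carrier G_carrier by (simp add: inv_solve_left)
    then have "g \<in> H #> x" using hg H_simps by (auto simp: r_coset_def)
    then have "rep x \<in> \<Gamma> \<and> rep x \<in> H #> x"
      unfolding rep_def using False hg by (simp) (rule someI_ex, blast)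
    then obtain k where k: "k \<in> H" "rep x = k \<otimes> x" "rep x \<in> \<Gamma>" by (auto simp: r_coset_def)
    then have "x \<otimes> inv (rep x) = inv k"
      using x H_carrier by (simp add: inv_mult_group m_assoc[symmetric])
    then show ?thesis using k H_simps by simp
  qed (use x G_simps in \<open>auto simp: rep_def\<close>)
  then show "rep x \<in> \<Gamma>" "x \<otimes> inv (rep x) \<in> H" by auto
qed

lemma rep_closed [simp]: "x \<in> carrier G \<Longrightarrow> rep x \<in> carrier G"
  using rep_props G_carrier by blast

text \<open>The choice is made from the coset and the membership test in \<open>H\<close>, and
  neither changes under left multiplication by \<open>H\<close>.\<close>

lemma rep_left:
  assumes "h \<in> H" "x \<in> carrier G"
  shows "rep (h \<otimes> x) = rep x"
proof -
  have "H #> (h \<otimes> x) = H #> x"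
    using assms H_carrier subH
    by (metis coset_mult_assoc coset_join2 subgroup.subset)
  moreover have "h \<otimes> x \<in> H \<longleftrightarrow> x \<in> H"
    using assms H_simps H_carrier by (metis inv_closed inv_inv m_assoc l_inv l_one)
  ultimately show ?thesis by (simp add: rep_def)
qed

lemma rep_cosetE:
  assumes "x \<in> carrier G"
  obtains h where "h \<in> H" "rep x = h \<otimes> x"
proof
  show "inv (x \<otimes> inv (rep x)) \<in> H" using rep_props[OF assms] H_simps by blast
  show "rep x = inv (x \<otimes> inv (rep x)) \<otimes> x"
    using assms by (simp add: inv_mult_group m_assoc)
qed

lemma rep_H: "h \<in> H \<Longrightarrow> rep h = \<one>" by (simp add: rep_def)

lemma rep_eq_one: "x \<in> carrier G \<Longrightarrow> rep x = \<one> \<longleftrightarrow> x \<in> H"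
  using rep_props(2)[of x] by (auto simp: rep_H)

text \<open>Right multiplication acts on the cosets of \<open>H\<close>, so \<open>x\<close> may be
  replaced by its representative before a further factor is applied. This is the transition law of
  the states.\<close>

lemma rep_mult: "x \<in> carrier G \<Longrightarrow> y \<in> carrier G \<Longrightarrow> rep (rep x \<otimes> y) = rep (x \<otimes> y)"
  by (metis rep_cosetE rep_left H_carrier m_assoc m_closed)

lemma rep_rep: "x \<in> carrier G \<Longrightarrow> rep (rep x) = rep x"
  using rep_mult[of x \<one>] by simp

definition states :: "'g set" where "states = rep ` carrier G"

lemma states: "c \<in> states \<Longrightarrow> c \<in> \<Gamma> \<and> c \<in> carrier G \<and> rep c = c"
  by (auto simp: states_def rep_rep rep_props)

lemma rep_states [simp]: "x \<in> carrier G \<Longrightarrow> rep x \<in> states"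
  by (auto simp: states_def)

lemma one_states: "\<one> \<in> states"
  using rep_states[of \<one>] by (simp add: rep_H H_simps)

text \<open>Reidemeister-Schreier rewriting: a letter \<open>x\<close> read in the state \<open>c\<close> is replaced by the
  \<open>x' \<in> H\<close> with \<open>c x = x' c'\<close>, where \<open>c'\<close> is the next state. Elements of \<open>\<Gamma>\<close> have length zero, so
  \<open>x'\<close> has the length of \<open>x\<close> and braid relations are preserved.\<close>

fun tr :: "'g \<Rightarrow> 'g word \<Rightarrow> 'g word" where
  "tr c [] = []"
| "tr c ((x, b) # u) =
     (let c' = rep (c \<otimes> (if b then x else inv x))
      in (if b then c \<otimes> x \<otimes> inv c' else c' \<otimes> x \<otimes> inv c, b) # tr c' u)"

lemma tr_letter_pos: 
  "c \<in> carrier G \<Longrightarrow> x \<in> carrier G \<Longrightarrow> c \<otimes> x \<otimes> inv (rep (c \<otimes> x)) \<in> H"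
  by (simp add: rep_props)

text \<open>For an inverse letter with next state \<open>c'\<close> the equation is
  \<open>c x^(-1) = (c' x c^(-1))^(-1) c'\<close>, so the new letter is again inverse and its base
  is the inverse of an element of \<open>H\<close>.\<close>

lemma tr_letter_neg:
  assumes "c \<in> carrier G" "x \<in> carrier G"
  shows "rep (c \<otimes> inv x) \<otimes> x \<otimes> inv c \<in> H"
proof -
  have "inv (c \<otimes> inv x \<otimes> inv (rep (c \<otimes> inv x))) \<in> H"
    using assms H_simps by (simp add: rep_props)
  then show ?thesis using assms by (simp add: inv_mult_group m_assoc)
qed

lemma tr_words: "c \<in> carrier G \<Longrightarrow> u \<in> words (carrier G) \<Longrightarrow> tr c u \<in> words H"
  by (induction c u rule: tr.induct) (auto simp: Let_def tr_letter_pos tr_letter_neg)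

text \<open>After \<open>u\<close> has been read, the state is the representative of
  \<open>c\<close> times the value of \<open>u\<close>; the reading of \<open>v\<close> starts
  there.\<close>

lemma tr_append:
  "c \<in> states \<Longrightarrow> u \<in> words (carrier G) \<Longrightarrow> v \<in> words (carrier G) \<Longrightarrow>
    tr c (u @ v) = tr c u @ tr (rep (c \<otimes> ev u)) v"
proof (induction c u rule: tr.induct)
  case (2 c x b u)
  let ?y = "if b then x else inv x"
  have y: "?y \<in> carrier G" "c \<in> carrier G" "u \<in> words (carrier G)"
    using 2 states by auto
  have "rep (rep (c \<otimes> ?y) \<otimes> ev u) = rep (c \<otimes> (?y \<otimes> ev u))"
    using y by (simp add: rep_mult m_assoc del: if_split)
  then show ?case using 2 y by (simp add: Let_def)
qed (use states in auto)

lemma tr_H: "u \<in> words H \<Longrightarrow> tr \<one> u = u"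
proof (induction "\<one>" u rule: tr.induct)
  case (2 x b u)
  then have "rep (\<one> \<otimes> (if b then x else inv x)) = \<one>"
    using H_simps H_carrier by (auto simp: rep_H)
  then show ?case using 2 H_carrier[of x] by (auto simp: Let_def)
qed auto

lemma len_conj: 
  assumes "c \<in> \<Gamma>" "d \<in> \<Gamma>" "x \<in> carrier G"
  shows "len (c \<otimes> x \<otimes> inv d) = len x"
  using assms G_simps G_carrier by (simp add: len_left len_right)

text \<open>The claim is proved for all starting states at once, since the second part of a
  concatenation is read from a state that depends on the first.\<close>

lemma tr_cong:
  "word_cong (carrier G) (len_braid_relations G len) u v \<Longrightarrow> c \<in> states \<Longrightarrow>
    word_cong H (len_braid_relations N len) (tr c u) (tr c v)"
proof (induction arbitrary: c rule: word_cong.induct)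
  case (refl u)
  then show ?case using states by (intro word_cong.refl tr_words) auto
next
  case (sym u v)
  then show ?case by (blast intro: word_cong.sym)
next
  case (trans u v w)
  then show ?case by (blast intro: word_cong.trans)
next
  case (append u u' v v')
  have w: "u \<in> words (carrier G)" "u' \<in> words (carrier G)" "v \<in> words (carrier G)" "v' \<in> words (carrier G)"
    using append.hyps word_cong_in_words by blast+
  have "ev u = ev u'" using append.hyps by (blast intro: ev_cong)
  moreover have "rep (c \<otimes> ev u') \<in> states" using w states append.prems by simp
  ultimately show ?case using append w by (auto simp: tr_append intro: word_cong.append)
next
  case (cancel x b)
  have c: "c \<in> carrier G" "rep c = c" using cancel states by auto
  let ?y = "if b then x else inv x" and ?y' = "if \<not> b then x else inv x"
  have y: "?y \<in> carrier G" "?y' \<in> carrier G" "?y \<otimes> ?y' = \<one>" using cancel by auto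
  \<comment> \<open>Reading a letter and its inverse leads back to the starting state, and both
    letters are rewritten with the same base, so they still cancel.\<close>
  have "rep (rep (c \<otimes> ?y) \<otimes> ?y') = c"
    using c y by (simp add: rep_mult m_assoc del: if_split)
  then have "tr c [(x, b), (x, \<not> b)] =
      [(if b then c \<otimes> x \<otimes> inv (rep (c \<otimes> x)) else rep (c \<otimes> inv x) \<otimes> x \<otimes> inv c, b),
       (if b then c \<otimes> x \<otimes> inv (rep (c \<otimes> x)) else rep (c \<otimes> inv x) \<otimes> x \<otimes> inv c, \<not> b)]"
    by (cases b) (auto simp: Let_def)
  then show ?case
    using tr_letter_pos[OF c(1) cancel(1)] tr_letter_neg[OF c(1) cancel(1)]
      word_cong.cancel[where Gen = H and Rel = "len_braid_relations N len" and b = b]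
    by (cases b) (simp_all only: if_True if_False tr.simps(1))
next
  case (rel u v)
  have c: "c \<in> carrier G" "c \<in> \<Gamma>" "rep c = c" using rel states by auto
  from rel(1) obtain w w' where uv: "u = [(w, True), (w', True)]" "v = [(w \<otimes> w', True)]"
    and w: "w \<in> carrier G" "w' \<in> carrier G" "len (w \<otimes> w') = len w + len w'"
    unfolding len_braid_relations_def by blast
  define c1 where "c1 = rep (c \<otimes> w)"
  define c2 where "c2 = rep (c1 \<otimes> w')"
  have c12: "c1 \<in> \<Gamma>" "c2 \<in> \<Gamma>" "c1 \<in> carrier G" "c2 \<in> carrier G"
    unfolding c1_def c2_def using c w by (auto simp: rep_props)
  have c2: "c2 = rep (c \<otimes> (w \<otimes> w'))"
    unfolding c1_def c2_def using c w by (simp add: rep_mult m_assoc)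
  have tru: "tr c u = [(c \<otimes> w \<otimes> inv c1, True), (c1 \<otimes> w' \<otimes> inv c2, True)]"
    by (simp add: uv c1_def c2_def Let_def)
  have trv: "tr c v = [(c \<otimes> (w \<otimes> w') \<otimes> inv c2, True)]"
    by (simp add: uv c2 Let_def)
  \<comment> \<open>The intermediate state \<open>c1\<close> drops out, so the rewritten letters
    multiply as the original ones do.\<close>
  have prod: "c \<otimes> w \<otimes> inv c1 \<otimes> (c1 \<otimes> w' \<otimes> inv c2) = c \<otimes> (w \<otimes> w') \<otimes> inv c2"
    using c c12 w by (simp add: m_assoc inv_solve_left')
  have mem: "c \<otimes> w \<otimes> inv c1 \<in> H" "c1 \<otimes> w' \<otimes> inv c2 \<in> H"
    unfolding c1_def c2_def using c w by (auto simp: rep_props)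
  have lens: "len (c \<otimes> w \<otimes> inv c1) = len w" "len (c1 \<otimes> w' \<otimes> inv c2) = len w'"
    "len (c \<otimes> (w \<otimes> w') \<otimes> inv c2) = len (w \<otimes> w')"
    using c c12 w by (auto simp: len_conj)
  have "(tr c u, tr c v) \<in> len_braid_relations N len"
    unfolding len_braid_relations_def tru trv mem_Collect_eq
    by (rule exI[of _ "c \<otimes> w \<otimes> inv c1"], rule exI[of _ "c1 \<otimes> w' \<otimes> inv c2"])
      (use prod mem lens w in simp)
  then show ?case
    by (rule word_cong.rel) (use tr_words[OF c(1)] rel in auto)
qed

lemma cong_H_G:
  "word_cong H (len_braid_relations N len) u v \<Longrightarrow>
    word_cong (carrier G) (len_braid_relations G len) u v"
proof (induction rule: word_cong.induct)
  case (rel u v)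
  have "words H \<subseteq> words (carrier G)" using H_carrier unfolding words_def by (intro lists_mono) auto
  moreover have "(u, v) \<in> len_braid_relations G len"
    using rel(1) H_carrier unfolding len_braid_relations_def by auto
  ultimately show ?case using rel by (intro word_cong.rel) auto
next
  case (refl u)
  have "words H \<subseteq> words (carrier G)" using H_carrier unfolding words_def by (intro lists_mono) auto
  with refl show ?case by (intro word_cong.refl) auto
next
  case (cancel x b)
  then show ?case using H_carrier by (intro word_cong.cancel)
qed (blast intro: word_cong.intros)+

abbreviation "BG \<equiv> len_braid_group G len"
abbreviation "BH \<equiv> len_braid_group N len"
abbreviation "clG \<equiv> len_class G len"
abbreviation "clH \<equiv> len_class N len"

lemma T_mult:
  "x \<in> carrier G \<Longrightarrow> y \<in> carrier G \<Longrightarrow> len (x \<otimes> y) = len x + len y \<Longrightarrow>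
    clG (word_T x) \<otimes>\<^bsub>BG\<^esub> clG (word_T y) = clG (word_T (x \<otimes> y))"
  by (simp, unfold len_class_def, intro word_class_cong word_cong.rel)
    (auto simp: len_braid_relations_def)

lemma clG_closed [simp]: "u \<in> words (carrier G) \<Longrightarrow> clG u \<in> carrier BG"
  by (auto simp: len_braid_carrier)

text \<open>The unit has length zero, so its class is idempotent, and an idempotent of a group is
  the unit.\<close>

lemma T_one: "clG (word_T \<one>) = \<one>\<^bsub>BG\<^esub>"
proof -
  interpret B: group BG by (rule group_len_braid)
  show ?thesis using T_mult[of \<one> \<one>] len_one B.l_cancel_one'[of "clG (word_T \<one>)" "clG (word_T \<one>)"] by auto
qed

lemma clG_Cons: "x \<in> carrier G \<Longrightarrow> u \<in> words (carrier G) \<Longrightarrow> clG ((x, b) # u) = clG [(x, b)] \<otimes>\<^bsub>BG\<^esub> clG u"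
  by simp

lemma clG_neg: "x \<in> carrier G \<Longrightarrow> clG [(x, False)] = inv\<^bsub>BG\<^esub> clG [(x, True)]"
proof -
  assume x: "x \<in> carrier G"
  interpret B: group BG by (rule group_len_braid)
  have "clG [(x, False)] \<otimes>\<^bsub>BG\<^esub> clG [(x, True)] = \<one>\<^bsub>BG\<^esub>"
    using x word_cong.cancel[OF x, of "len_braid_relations G len" False]
    by (simp add: len_braid_one) (simp add: len_class_def word_class_cong)
  then show ?thesis using x by (intro B.inv_equality[symmetric]) auto
qed

text \<open>A length zero element \<open>T_c\<close> can be moved through a word to the right; the
  letters change as prescribed by \<open>tr\<close> and the final state comes out. If both states
  are the unit, the word equals its rewriting in the braid group of \<open>G\<close>.\<close>

lemma tr_back:
  "c \<in> states \<Longrightarrow> u \<in> words (carrier G) \<Longrightarrow>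
    clG (word_T c) \<otimes>\<^bsub>BG\<^esub> clG u = clG (tr c u) \<otimes>\<^bsub>BG\<^esub> clG (word_T (rep (c \<otimes> ev u)))"
proof (induction c u rule: tr.induct)
  case (1 c)
  then show ?case using states[OF 1(1)] by simp
next
  case (2 c x b u)
  interpret B: group BG by (rule group_len_braid)
  define y where "y = (if b then x else inv x)"
  define c' where "c' = rep (c \<otimes> y)"
  define z where "z = (if b then c \<otimes> x \<otimes> inv c' else c' \<otimes> x \<otimes> inv c)"
  have c: "c \<in> carrier G" "c \<in> \<Gamma>" "rep c = c" using 2 states by auto
  have x: "x \<in> carrier G" and u: "u \<in> words (carrier G)" using 2 by auto
  have y: "y \<in> carrier G" using x by (auto simp: y_def)
  have c': "c' \<in> states" "c' \<in> carrier G" "c' \<in> \<Gamma>" unfolding c'_def using c y by (auto simp: rep_props)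
  have z: "z \<in> carrier G" unfolding z_def using c x c' by auto
  have len0: "len g = 0" if "g \<in> \<Gamma>" for g using len_left[OF that one_closed] that G_carrier len_one by simp
  have trw: "tr c' u \<in> words (carrier G)"
    using tr_words[OF c'(2) u] H_carrier unfolding words_def by auto
  have IH: "clG (word_T c') \<otimes>\<^bsub>BG\<^esub> clG u = clG (tr c' u) \<otimes>\<^bsub>BG\<^esub> clG (word_T (rep (c' \<otimes> ev u)))"
    using 2(1)[OF _ _ ] c' u unfolding c'_def y_def by blast
  \<comment> \<open>This is the case of one letter. Lengths add because states have length zero, so
    a braid relation applies on either side.\<close>
  have key: "clG (word_T c) \<otimes>\<^bsub>BG\<^esub> clG [(x, b)] = clG [(z, b)] \<otimes>\<^bsub>BG\<^esub> clG (word_T c')"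
  proof (cases b)
    case True
    have "c \<otimes> x = z \<otimes> c'" unfolding z_def using True c x c' by (simp add: m_assoc)
    moreover have "len (c \<otimes> x) = len c + len x" "len (z \<otimes> c') = len z + len c'"
      using c x c' z len0 by (auto simp: len_left len_right)
    ultimately show ?thesis using T_mult[of c x] T_mult[of z c'] True c x c' z by metis
  next
    case False
    \<comment> \<open>The defining relations contain only positive letters. The relation is
      therefore written for \<open>x\<close> itself, and inverses are taken afterwards in the
      group.\<close>
    have "z \<otimes> c = c' \<otimes> x" unfolding z_def using False c x c' by (simp add: m_assoc)
    moreover have "len (z \<otimes> c) = len z + len c" "len (c' \<otimes> x) = len c' + len x"
      using c x c' z len0 by (auto simp: len_left len_right)
    ultimately have *: "clG (word_T z) \<otimes>\<^bsub>BG\<^esub> clG (word_T c) = clG (word_T c') \<otimes>\<^bsub>BG\<^esub> clG (word_T x)"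
      using T_mult[of z c] T_mult[of c' x] c x c' z by metis
    have cl: "clG (word_T z) \<in> carrier BG" "clG (word_T c) \<in> carrier BG"
      "clG (word_T c') \<in> carrier BG" "clG (word_T x) \<in> carrier BG"
      using c x c' z by auto
    have "clG (word_T c) \<otimes>\<^bsub>BG\<^esub> inv\<^bsub>BG\<^esub> clG (word_T x) = inv\<^bsub>BG\<^esub> clG (word_T z) \<otimes>\<^bsub>BG\<^esub> clG (word_T c')"
      using * cl by (metis B.inv_closed B.inv_solve_left B.inv_solve_right B.m_assoc B.m_closed)
    then show ?thesis using False x z by (simp only: clG_neg)
  qed
  have st: "rep (c' \<otimes> ev u) = rep (c \<otimes> (y \<otimes> ev u))"
    unfolding c'_def using c y u by (simp add: rep_mult m_assoc)
  have cl: "clG (word_T c) \<in> carrier BG" "clG [(x, b)] \<in> carrier BG" "clG u \<in> carrier BG"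
    "clG [(z, b)] \<in> carrier BG" "clG (word_T c') \<in> carrier BG" "clG (tr c' u) \<in> carrier BG"
    "clG (word_T (rep (c' \<otimes> ev u))) \<in> carrier BG"
    using c x u z c' trw by auto
  have "clG (word_T c) \<otimes>\<^bsub>BG\<^esub> clG ((x, b) # u)
      = clG (word_T c) \<otimes>\<^bsub>BG\<^esub> clG [(x, b)] \<otimes>\<^bsub>BG\<^esub> clG u"
    unfolding clG_Cons[OF x u] using cl by (simp only: B.m_assoc)
  also have "\<dots> = clG [(z, b)] \<otimes>\<^bsub>BG\<^esub> clG (tr c' u) \<otimes>\<^bsub>BG\<^esub> clG (word_T (rep (c' \<otimes> ev u)))"
    unfolding key using cl IH by (simp only: B.m_assoc)
  also have "clG [(z, b)] \<otimes>\<^bsub>BG\<^esub> clG (tr c' u) = clG (tr c ((x, b) # u))"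
    unfolding clG_Cons[OF z trw, symmetric] by (simp add: Let_def z_def c'_def y_def)
  finally show ?case unfolding st by (simp add: y_def)
qed

end

section \<open>Inclusion and fixed points for a subgroup\<close>

text \<open>The theorem asks for a group whose elements are natural numbers; the structure of
  \<open>M\<close> is transported along a numbering of its carrier.\<close>

lemma finite_group_on_nat:
  assumes "group M" "finite (carrier M)"
  shows "\<exists>(K :: nat monoid) f. group K \<and> finite (carrier K) \<and> f \<in> hom K M \<and> f ` carrier K = carrier M"
proof -
  interpret M: group M by fact
  let ?n = "card (carrier M)"
  obtain f where f: "bij_betw f {..<?n} (carrier M)"
    using ex_bij_betw_nat_finite[OF assms(2)] by (auto simp: lessThan_atLeast0)
  define g where "g = inv_into {..<?n} f"
  have fg: "f (g x) = x" "g x \<in> {..<?n}" if "x \<in> carrier M" for x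
    using that f bij_betw_apply[OF bij_betw_inv_into[OF f] that] unfolding g_def
    by (auto simp: bij_betw_inv_into_right)
  have gf: "g (f a) = a" if "a \<in> {..<?n}" for a
    using that f unfolding g_def by (simp add: bij_betw_inv_into_left)
  have fc: "f a \<in> carrier M" if "a \<in> {..<?n}" for a
    using that f by (rule bij_betw_apply[rotated])
  define K where "K = \<lparr>carrier = {..<?n}, monoid.mult = (\<lambda>a b. g (f a \<otimes>\<^bsub>M\<^esub> f b)), one = g \<one>\<^bsub>M\<^esub>\<rparr>"
  have Kc: "carrier K = {..<?n}" "\<one>\<^bsub>K\<^esub> = g \<one>\<^bsub>M\<^esub>"
    and Km: "\<And>a b. a \<otimes>\<^bsub>K\<^esub> b = g (f a \<otimes>\<^bsub>M\<^esub> f b)"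
    by (simp_all add: K_def)
  have "group K"
  proof (rule groupI, unfold Kc Km)
    fix a assume a: "a \<in> {..<?n}"
    show "\<exists>y\<in>{..<?n}. g (f y \<otimes>\<^bsub>M\<^esub> f a) = g \<one>\<^bsub>M\<^esub>"
      by (rule bexI[of _ "g (inv\<^bsub>M\<^esub> f a)"]) (use fc[OF a] fg in auto)
    show "g (f (g \<one>\<^bsub>M\<^esub>) \<otimes>\<^bsub>M\<^esub> f a) = a"
      using fc[OF a] fg gf[OF a] by simp
  next
    show "g \<one>\<^bsub>M\<^esub> \<in> {..<?n}" by (simp add: fg del: lessThan_iff)
  next
    fix a b c assume abc: "a \<in> {..<?n}" "b \<in> {..<?n}" "c \<in> {..<?n}"
    show "g (f a \<otimes>\<^bsub>M\<^esub> f b) \<in> {..<?n}"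
      by (intro fg M.m_closed fc abc)
    show "g (f (g (f a \<otimes>\<^bsub>M\<^esub> f b)) \<otimes>\<^bsub>M\<^esub> f c) = g (f a \<otimes>\<^bsub>M\<^esub> f (g (f b \<otimes>\<^bsub>M\<^esub> f c)))"
      using fc abc fg by (simp add: M.m_assoc)
  qed
  moreover have "f \<in> hom K M"
    by (rule homI) (use fc fg in \<open>auto simp: Kc Km\<close>)
  moreover have "f ` carrier K = carrier M" using f by (simp add: Kc bij_betw_def)
  ultimately show ?thesis by (intro exI[of _ K] exI[of _ f]) (simp add: Kc)
qed

lemma genideal_le:
  assumes "ideal J A" "U \<subseteq> J" shows "Idl\<^bsub>A\<^esub> U \<subseteq> J"
  using assms by (auto simp: genideal_def)

text \<open>The preimage of \<open>J\<close> under a ring homomorphism is an ideal, so it suffices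
  that it contains the generators.\<close>

lemma preimage_ideal:
  assumes "ring A" "ring B" "h \<in> ring_hom A B" "ideal J B" "U \<subseteq> carrier A" "h ` U \<subseteq> J"
    "f \<in> Idl\<^bsub>A\<^esub> U"
  shows "h f \<in> J"
proof -
  interpret ring_hom_ring A B h using assms by (intro ring_hom_ringI2)
  have "Idl\<^bsub>A\<^esub> U \<subseteq> {r \<in> carrier A. h r \<in> J}"
    using assms ideal_vimage[OF assms(4)] by (intro genideal_le) auto
  then show ?thesis using assms(7) by auto
qed

section \<open>Embedding and retraction of braid groups\<close>

context hecke_pair
begin

sublocale B: group BG by (rule group_len_braid)
sublocale BN: group BH by (rule group_len_braid)

lemma words_H: "words H \<subseteq> words (carrier G)"
  using H_carrier unfolding words_def by (intro lists_mono) auto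

definition emb :: "'g word set \<Rightarrow> 'g word set" where
  "emb b = clG (rep_word b)"

text \<open>The rewriting starts in the unit state. On classes with value in \<open>H\<close> this
  inverts \<open>emb\<close>; on the whole braid group it is not multiplicative in general, because
  a second factor would have to start in another state.\<close>

definition ret :: "'g word set \<Rightarrow> 'g word set" where
  "ret b = clH (tr \<one> (rep_word b))"

definition bev :: "'g word set \<Rightarrow> 'g" where
  "bev b = ev (rep_word b)"

lemma rep_word_G: "u \<in> words (carrier G) \<Longrightarrow>
    word_cong (carrier G) (len_braid_relations G len) (rep_word (clG u)) u"
  unfolding len_class_def by (rule rep_word_cong)

lemma rep_word_H: "u \<in> words H \<Longrightarrow> word_cong H (len_braid_relations N len) (rep_word (clH u)) u"
  using rep_word_cong[of u H] unfolding len_class_def by simp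

lemma emb_class: "u \<in> words H \<Longrightarrow> emb (clH u) = clG u"
  unfolding emb_def using cong_H_G[OF rep_word_H] word_class_cong unfolding len_class_def by blast

lemma ret_class:
  assumes "u \<in> words (carrier G)"
  shows "ret (clG u) = clH (tr \<one> u)"
  unfolding ret_def using tr_cong[OF rep_word_G[OF assms] one_states] 
  unfolding len_class_def by (simp add: word_class_cong)

lemma bev_class: "u \<in> words (carrier G) \<Longrightarrow> bev (clG u) = ev u"
  unfolding bev_def by (rule ev_cong[OF rep_word_G])

lemma BG_cases: 
  assumes "b \<in> carrier BG" obtains u where "u \<in> words (carrier G)" "b = clG u"
  using assms by (auto simp: len_braid_carrier)

lemma BH_cases:
  assumes "b \<in> carrier BH" obtains u where "u \<in> words H" "b = clH u"
  using assms by (auto simp: len_braid_carrier)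

lemma clH_closed: "u \<in> words H \<Longrightarrow> clH u \<in> carrier BH"
  by (auto simp: len_braid_carrier)

lemma emb_hom: "emb \<in> hom BH BG"
proof (rule homI)
  fix b assume "b \<in> carrier BH"
  then show "emb b \<in> carrier BG" using words_H by (elim BH_cases) (auto simp: emb_class)
next
  fix b b' assume "b \<in> carrier BH" "b' \<in> carrier BH"
  then obtain u v where "u \<in> words H" "b = clH u" "v \<in> words H" "b' = clH v"
    by (elim BH_cases)
  moreover from this have "u \<in> words (carrier G)" "v \<in> words (carrier G)" using words_H by auto
  ultimately show "emb (b \<otimes>\<^bsub>BH\<^esub> b') = emb b \<otimes>\<^bsub>BG\<^esub> emb b'"
    by (simp add: emb_class)
qed

lemma bev_closed: "b \<in> carrier BG \<Longrightarrow> bev b \<in> carrier G"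
  by (elim BG_cases) (simp add: bev_class)

lemma bev_mult: "b \<in> carrier BG \<Longrightarrow> b' \<in> carrier BG \<Longrightarrow> bev (b \<otimes>\<^bsub>BG\<^esub> b') = bev b \<otimes> bev b'"
  by (elim BG_cases) (simp add: bev_class ev_append)

lemma bev_one: "bev \<one>\<^bsub>BG\<^esub> = \<one>"
  by (simp add: len_braid_one bev_class)

lemma ev_H: "u \<in> words H \<Longrightarrow> ev u \<in> H"
  by (induction u rule: ev.induct) (auto simp: H_simps)

lemma ret_emb: "b \<in> carrier BH \<Longrightarrow> ret (emb b) = b"
  using words_H by (elim BH_cases) (auto simp: emb_class ret_class tr_H)

lemma bev_emb: "b \<in> carrier BH \<Longrightarrow> bev (emb b) \<in> H"
  using words_H by (elim BH_cases) (auto simp: emb_class bev_class ev_H)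

lemma ret_closed: "b \<in> carrier BG \<Longrightarrow> ret b \<in> carrier BH"
  by (elim BG_cases) (auto simp: ret_class intro!: clH_closed tr_words)

text \<open>For a class with value in \<open>H\<close> the rewriting starts and ends in the unit
  state, and the two boundary factors in \<open>tr_back\<close> are trivial.\<close>

lemma emb_ret:
  assumes "b \<in> carrier BG" "bev b \<in> H"
  shows "emb (ret b) = b"
proof -
  obtain u where u: "u \<in> words (carrier G)" "b = clG u" using assms(1) by (rule BG_cases)
  have t: "tr \<one> u \<in> words H" using u by (simp add: tr_words)
  then have tG: "tr \<one> u \<in> words (carrier G)" using words_H by blast
  have "\<one> \<otimes> ev u \<in> H" using assms u by (simp add: bev_class)
  then have "rep (\<one> \<otimes> ev u) = \<one>" by (rule rep_H)
  then have "clG (word_T \<one>) \<otimes>\<^bsub>BG\<^esub> clG u = clG (tr \<one> u) \<otimes>\<^bsub>BG\<^esub> clG (word_T \<one>)"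
    using tr_back[OF one_states u(1)] by simp
  then have "clG (tr \<one> u) = clG u"
    unfolding T_one using clG_closed[OF u(1)] clG_closed[OF tG] by (simp del: len_class_mult)
  then show ?thesis using u t by (simp add: ret_class emb_class)
qed

abbreviation "AG \<equiv> group_algebra BG"
abbreviation "AH \<equiv> group_algebra BH"
abbreviation "IG \<equiv> len_ideal q G len S"
abbreviation "IH \<equiv> len_ideal q N len S"

sublocale IG: group_algebra_ideal BG IG by (rule group_len_algebra[OF S_carrier])
sublocale IH: group_algebra_ideal BH IH
  by (rule group.group_len_algebra[OF groupN]) (simp add: SH)

abbreviation "j \<equiv> lin_ext (\<lambda>b. Poly_Mapping.single (emb b) (1::complex))"

text \<open>Monomials with value outside \<open>H\<close> are dropped and the others rewritten. This
  is a linear left inverse of \<open>j\<close> and the substitute for a projection along a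
  basis.\<close>

definition E :: "('g word set \<Rightarrow>\<^sub>0 complex) \<Rightarrow> ('g word set \<Rightarrow>\<^sub>0 complex)" where
  "E = lin_ext (\<lambda>b. if bev b \<in> H then Poly_Mapping.single (ret b) 1 else 0)"

lemma j_hom: "j \<in> ring_hom AH AG"
  by (rule monomial_ring_hom[OF group_len_braid group_len_braid emb_hom]) auto

lemma E_j: "f \<in> carrier AH \<Longrightarrow> E (j f) = f"
proof -
  assume "f \<in> carrier AH"
  then have "Poly_Mapping.keys f \<subseteq> carrier BH" by (simp add: group_algebra_simps)
  then have "lin_ext (\<lambda>b. E (Poly_Mapping.single (emb b) 1)) f
      = lin_ext (\<lambda>b. Poly_Mapping.single b 1) f"
    by (intro lin_ext_cong) (auto simp: E_def bev_emb ret_emb)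
  then show ?thesis unfolding E_def lin_ext_lin_ext lin_ext_id by simp
qed

lemma E_closed: "f \<in> carrier AG \<Longrightarrow> E f \<in> carrier AH"
  unfolding group_algebra_simps E_def mem_Collect_eq
  by (intro keys_lin_ext) (auto simp: ret_closed)

text \<open>Since \<open>E\<close> is only linear, the elements that it sends into \<open>IH\<close>
  are not known to form an ideal. Asking the same of all products with monomials on both sides does
  define an ideal, and for it only relators in arbitrary position have to be checked.\<close>

lemma E_ideal:
  assumes "f \<in> IG" shows "E f \<in> IH"
proof -
  note R = B.ring_group_algebra
  note AG_m_closed = monoid.m_closed[OF ring.is_monoid[OF R]]
    and AG_m_assoc = monoid.m_assoc[OF ring.is_monoid[OF R]]
    and AG_one = monoid.l_one[OF ring.is_monoid[OF R]] monoid.r_one[OF ring.is_monoid[OF R]]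
    and AG_abelian = ring.is_abelian_group[OF R]
  let ?s = "\<lambda>b. Poly_Mapping.single b (1::complex)"
  define M where "M = {f \<in> carrier AG. \<forall>b\<in>carrier BG. \<forall>b'\<in>carrier BG. E (?s b \<otimes>\<^bsub>AG\<^esub> f \<otimes>\<^bsub>AG\<^esub> ?s b') \<in> IH}"
  have sc: "?s b \<in> carrier AG" if "b \<in> carrier BG" for b using that by (simp add: group_algebra_simps)
  have E_add: "E (f + g) = E f + E g" for f g by (simp add: E_def lin_ext_add)
  have E_scale: "E (pm_scale c f) = pm_scale c (E f)" for c f by (simp add: E_def lin_ext_scale)
  have Mz: "0 \<in> M" by (auto simp: M_def group_algebra_simps E_def IH.I_zero)
  have Ma: "f + g \<in> M" if "f \<in> M" "g \<in> M" for f g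
    using that keys_add[of f g] unfolding M_def
    by (auto simp: group_algebra_mult_add E_add IH.I_add group_algebra_simps)
  have Ms: "pm_scale c f \<in> M" if "f \<in> M" for f c
    using that keys_scale[of c f] unfolding M_def
    by (auto simp: group_algebra_mult_scale E_scale IH.I_scale group_algebra_simps)
  have Mneg: "- f \<in> M" if "f \<in> M" for f
  proof -
    have "pm_scale (-1) f = - f" by (rule poly_mapping_eqI) simp
    then show ?thesis using Ms[OF that, of "-1"] by simp
  qed
  have Ml: "?s b \<otimes>\<^bsub>AG\<^esub> f \<in> M" if "f \<in> M" "b \<in> carrier BG" for f b
  proof -
    have f: "f \<in> carrier AG" using that by (simp add: M_def)
    show ?thesis
      unfolding M_def mem_Collect_eq
    proof (intro conjI ballI)
      show "?s b \<otimes>\<^bsub>AG\<^esub> f \<in> carrier AG" by (intro AG_m_closed sc that f)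
      fix a a' assume a: "a \<in> carrier BG" "a' \<in> carrier BG"
      have "?s a \<otimes>\<^bsub>AG\<^esub> (?s b \<otimes>\<^bsub>AG\<^esub> f) = ?s (a \<otimes>\<^bsub>BG\<^esub> b) \<otimes>\<^bsub>AG\<^esub> f"
        using AG_m_assoc[OF sc[OF a(1)] sc[OF that(2)] f] by simp
      then show "E (?s a \<otimes>\<^bsub>AG\<^esub> (?s b \<otimes>\<^bsub>AG\<^esub> f) \<otimes>\<^bsub>AG\<^esub> ?s a') \<in> IH"
        using that(1) a B.m_closed[OF a(1) that(2)] unfolding M_def by simp
    qed
  qed
  have Mr: "f \<otimes>\<^bsub>AG\<^esub> ?s b \<in> M" if "f \<in> M" "b \<in> carrier BG" for f b
  proof -
    have f: "f \<in> carrier AG" using that by (simp add: M_def)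
    show ?thesis
      unfolding M_def mem_Collect_eq
    proof (intro conjI ballI)
      show "f \<otimes>\<^bsub>AG\<^esub> ?s b \<in> carrier AG" by (intro AG_m_closed sc that f)
      fix a a' assume a: "a \<in> carrier BG" "a' \<in> carrier BG"
      have "?s a \<otimes>\<^bsub>AG\<^esub> (f \<otimes>\<^bsub>AG\<^esub> ?s b) \<otimes>\<^bsub>AG\<^esub> ?s a' = ?s a \<otimes>\<^bsub>AG\<^esub> f \<otimes>\<^bsub>AG\<^esub> ?s (b \<otimes>\<^bsub>BG\<^esub> a')"
        using sc[OF a(1)] sc[OF a(2)] sc[OF that(2)] f
          sc[OF B.m_closed[OF that(2) a(2)]]
        by (simp only: AG_m_assoc AG_m_closed group_algebra_mult_single mult_1)
      then show "E (?s a \<otimes>\<^bsub>AG\<^esub> (f \<otimes>\<^bsub>AG\<^esub> ?s b) \<otimes>\<^bsub>AG\<^esub> ?s a') \<in> IH"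
        using that(1) a B.m_closed[OF that(2) a(2)] unfolding M_def by simp
    qed
  qed
  have "ideal M AG"
  proof (rule idealI)
    show "ring AG" by (rule R)
    show "subgroup M (add_monoid AG)"
    proof (rule group.subgroupI[OF abelian_group.a_group[OF AG_abelian]])
      show "M \<subseteq> carrier (add_monoid AG)" by (auto simp: M_def)
      show "M \<noteq> {}" using Mz by auto
      show "a \<otimes>\<^bsub>add_monoid AG\<^esub> b \<in> M" if "a \<in> M" "b \<in> M" for a b
        using Ma[OF that] by (simp add: group_algebra_simps)
      show "inv\<^bsub>add_monoid AG\<^esub> a \<in> M" if "a \<in> M" for a
      proof -
        have "a \<in> carrier AG" "- a \<in> carrier AG" using that Mneg[OF that] by (auto simp: M_def)
        then have "\<ominus>\<^bsub>AG\<^esub> a = - a"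
          by (intro abelian_group.minus_equality[OF AG_abelian]) (auto simp: group_algebra_simps)
        then show ?thesis using Mneg[OF that] by (simp add: a_inv_def)
      qed
    qed
    fix a x assume a: "a \<in> M" and x: "x \<in> carrier AG"
    have "Poly_Mapping.keys x \<subseteq> carrier BG" using x by (simp add: group_algebra_simps)
    then show "x \<otimes>\<^bsub>AG\<^esub> a \<in> M"
    proof (induction x rule: poly_mapping_span_induct)
      case (single b c)
      have "Poly_Mapping.single b c \<otimes>\<^bsub>AG\<^esub> a = pm_scale c (?s b \<otimes>\<^bsub>AG\<^esub> a)"
        by (simp add: group_algebra_mult_scale(1)[symmetric])
      then show ?case using Ms Ml[OF a single] by simp
    qed (auto simp: Mz Ma group_algebra_mult_add)
    have "Poly_Mapping.keys x \<subseteq> carrier BG" using x by (simp add: group_algebra_simps)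
    then show "a \<otimes>\<^bsub>AG\<^esub> x \<in> M"
    proof (induction x rule: poly_mapping_span_induct)
      case (single b c)
      have "a \<otimes>\<^bsub>AG\<^esub> Poly_Mapping.single b c = pm_scale c (a \<otimes>\<^bsub>AG\<^esub> ?s b)"
        by (simp add: group_algebra_mult_scale(2)[symmetric])
      then show ?case using Ms Mr[OF a single] by simp
    qed (auto simp: Mz Ma group_algebra_mult_add)
  qed
  moreover have "len_relators q G len S \<subseteq> M"
  proof -
    have "len_relator q G len [] s [] \<in> M" if s: "s \<in> S" for s
    proof -
      have sG: "s \<in> carrier G" using s S_carrier by auto
      have "E (?s b \<otimes>\<^bsub>AG\<^esub> len_relator q G len [] s [] \<otimes>\<^bsub>AG\<^esub> ?s b') \<in> IH"
        if b: "b \<in> carrier BG" "b' \<in> carrier BG" for b b'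
      proof -
        obtain u v where u: "u \<in> words (carrier G)" "b = clG u" and v: "v \<in> words (carrier G)" "b' = clG v"
          using b by (elim BG_cases)
        define c where "c = rep (ev u)"
        have c: "c \<in> states" "c \<in> \<Gamma>" "c \<in> carrier G" "rep c = c"
          unfolding c_def using u by (auto simp: rep_props rep_rep)
        \<comment> \<open>The state \<open>c\<close> reached after \<open>u\<close> lies in
          \<open>\<Gamma>\<close>, so conjugation by it permutes the generators; a relator for
          \<open>s\<close> becomes one for \<open>s'\<close>.\<close>
        define s' where "s' = c \<otimes> s \<otimes> inv c"
        have s': "s' \<in> S" unfolding s'_def using c s by (intro conjS)
        then have s'H: "s' \<in> H" using SH by auto
        \<comment> \<open>Moving \<open>c\<close> past \<open>s\<close> produces \<open>s'\<close>,
          an element of \<open>H\<close>; reading a generator therefore does not change the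
          state.\<close>
        have cs: "rep (c \<otimes> s) = c"
        proof -
          have "c \<otimes> s = s' \<otimes> c" unfolding s'_def using c sG by (simp add: m_assoc)
          then show ?thesis using rep_left[OF s'H c(3)] c by simp
        qed
        have trs: "tr c (word_T s @ w) = word_T s' @ tr c w" for w
          by (simp add: cs s'_def)
        have tru: "tr \<one> (u @ w) = tr \<one> u @ tr c w" if "w \<in> words (carrier G)" for w
          using tr_append[OF one_states u(1) that] u unfolding c_def by simp
        \<comment> \<open>The three monomials of a relator have values in the same coset of
          \<open>H\<close>, so \<open>E\<close> keeps all of them or none.\<close>
        have evH: "ev (u @ word_T s @ word_T s @ v) \<in> H \<longleftrightarrow> ev (u @ v) \<in> H"
          "ev (u @ word_T s @ v) \<in> H \<longleftrightarrow> ev (u @ v) \<in> H"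
        proof -
          have r: "rep (ev (u @ w)) = rep (c \<otimes> ev w)" if "w \<in> words (carrier G)" for w
            using u that by (simp add: ev_append c_def rep_mult)
          have r2: "rep (c \<otimes> (s \<otimes> x)) = rep (c \<otimes> x)" if "x \<in> carrier G" for x
            using rep_mult[of "c \<otimes> s" x] that c sG cs by (simp add: m_assoc)
          show "ev (u @ word_T s @ word_T s @ v) \<in> H \<longleftrightarrow> ev (u @ v) \<in> H"
            using u v sG r[of "word_T s @ word_T s @ v"] r[of v] r2
            by (simp add: rep_eq_one[symmetric])
          show "ev (u @ word_T s @ v) \<in> H \<longleftrightarrow> ev (u @ v) \<in> H"
            using u v sG r[of "word_T s @ v"] r[of v] r2
            by (simp add: rep_eq_one[symmetric])
        qed
        have Ew: "E (Poly_Mapping.single (clG w) d) =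
            (if ev w \<in> H then Poly_Mapping.single (clH (tr \<one> w)) d else 0)"
          if "w \<in> words (carrier G)" for w d
          using that by (simp add: E_def bev_class ret_class)
        have w: "u @ word_T s @ word_T s @ v \<in> words (carrier G)" "u @ word_T s @ v \<in> words (carrier G)"
          "u @ v \<in> words (carrier G)"
          using u v sG by auto
        have E_diff: "E (f - g) = E f - E g" for f g by (simp add: E_def lin_ext_diff)
        have "E (len_relator q G len u s v) =
           (if ev (u @ v) \<in> H then len_relator q N len (tr \<one> u) s' (tr c v) else 0)"
          unfolding len_relator_def E_add E_diff Ew[OF w(1)] Ew[OF w(2)] Ew[OF w(3)] evH
          using sG v by (simp add: tru trs del: append_Cons append_Nil tr.simps(2))
        also have "\<dots> \<in> IH"
          using group.len_relator_in_ideal[OF groupN, of S s' "tr \<one> u" "tr c v" q len]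
            SH s' tr_words[OF one_closed u(1)] tr_words[OF c(3) v(1)] IH.I_zero by auto
        finally show ?thesis using len_relator_mult[OF sG u(1) v(1), of len q] u v by simp
      qed
      moreover have "len_relator q G len [] s [] \<in> carrier AG"
        using len_relator_in_ideal[OF S_carrier s, of "[]" "[]" q len] IG.I_subset by simp
      ultimately show ?thesis by (simp add: M_def)
    qed
    then show ?thesis by (auto simp: len_relators_eq[OF S_carrier])
  qed
  ultimately have "IG \<subseteq> M"
    unfolding len_ideal_def by (rule genideal_le)
  then have "f \<in> M" using assms by auto
  \<comment> \<open>Membership in \<open>M\<close> is specialised to the unit on both sides.\<close>
  then have "E (?s \<one>\<^bsub>BG\<^esub> \<otimes>\<^bsub>AG\<^esub> f \<otimes>\<^bsub>AG\<^esub> ?s \<one>\<^bsub>BG\<^esub>) \<in> IH" "f \<in> carrier AG"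
    by (auto simp: M_def)
  then show ?thesis using AG_one[of f] by (simp add: group_algebra_simps(2))
qed

lemma len_relators_subset: "len_relators q G len S \<subseteq> carrier AG"
  using len_relator_in_ideal[OF S_carrier] IG.I_subset by (auto simp: len_relators_eq[OF S_carrier])

lemma len_relators_subset_H: "len_relators q N len S \<subseteq> carrier AH"
  using group.len_relator_in_ideal[OF groupN, of S] SH IH.I_subset by (auto simp: len_relators_eq)

text \<open>The embedding sends the relator of each \<open>s\<close> to the relator of the same
  \<open>s\<close>, as the generators lie in \<open>H\<close>.\<close>

lemma j_ideal: "f \<in> IH \<Longrightarrow> j f \<in> IG"
proof -
  assume f: "f \<in> IH"
  have "j ` len_relators q N len S \<subseteq> IG"
  proof -
    have "j (len_relator q N len [] s []) = len_relator q G len [] s []" if "s \<in> S" for s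
      using that SH by (auto simp: len_relator_def lin_ext_add lin_ext_diff emb_class subset_iff)
    then show ?thesis
      using SH len_relator_in_ideal[OF S_carrier] by (auto simp: len_relators_eq)
  qed
  then show ?thesis
    using f unfolding len_ideal_def[of q N]
    by (intro preimage_ideal[OF BN.ring_group_algebra B.ring_group_algebra j_hom IG.ideal_axioms
      len_relators_subset_H])
qed

sublocale jq: quot_map_data BH IH BG IG "\<lambda>b. Poly_Mapping.single (emb b) 1"
  by unfold_locales (use j_hom j_ideal in auto)

text \<open>If \<open>j f\<close> lies in \<open>IG\<close>, then \<open>f\<close>, which equals
  \<open>E (j f)\<close>, lies in \<open>IH\<close>.\<close>

lemma jq_inj: "inj_on jq.hq (carrier (len_hecke q N len S))"
  unfolding len_hecke_def
  by (rule jq.quot_map_inj) (use E_ideal E_j in force)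

lemma jq_T: "w \<in> H \<Longrightarrow> jq.hq (len_hecke_T q N len S w) = len_hecke_T q G len S w"
  unfolding len_hecke_T_def jq.quot_map_coset by (simp add: emb_class)

end

section \<open>Characters trivial on the subgroup and their action\<close>

locale hecke_pair_chars = hecke_pair G H \<Gamma> S len q
  for G :: "('g, 'm) monoid_scheme" (structure) and H \<Gamma> S :: "'g set" and len :: "'g \<Rightarrow> nat" and q +
  assumes separate: "\<And>x. x \<in> carrier G \<Longrightarrow> x \<notin> H \<Longrightarrow>
    \<exists>\<eta>. (\<forall>y\<in>carrier G. \<forall>z\<in>carrier G. \<eta> (y \<otimes> z) = \<eta> y * \<eta> z) \<and> (\<forall>h\<in>H. \<eta> h = (1::complex)) \<and> \<eta> x \<noteq> 1"
begin

text \<open>Values outside the carrier are fixed by extensionality; otherwise a character would not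
  be determined by its values on \<open>G\<close>, and the set could be infinite.\<close>

definition chars :: "('g \<Rightarrow> complex) set" where
  "chars = {\<eta> \<in> extensional (carrier G).
     (\<forall>y\<in>carrier G. \<forall>z\<in>carrier G. \<eta> (y \<otimes> z) = \<eta> y * \<eta> z) \<and> (\<forall>h\<in>H. \<eta> h = 1)}"

lemma char_mult: "\<eta> \<in> chars \<Longrightarrow> y \<in> carrier G \<Longrightarrow> z \<in> carrier G \<Longrightarrow> \<eta> (y \<otimes> z) = \<eta> y * \<eta> z"
  by (simp add: chars_def)

lemma char_H: "\<eta> \<in> chars \<Longrightarrow> h \<in> H \<Longrightarrow> \<eta> h = 1"
  by (simp add: chars_def)

lemma char_one: "\<eta> \<in> chars \<Longrightarrow> \<eta> \<one> = 1"
  using char_H H_simps by blast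

lemma char_inv: "\<eta> \<in> chars \<Longrightarrow> y \<in> carrier G \<Longrightarrow> \<eta> (inv y) * \<eta> y = 1"
  using char_mult[of \<eta> "inv y" y] char_one[of \<eta>] by simp

definition char_group :: "('g \<Rightarrow> complex) monoid" where
  "char_group = \<lparr>carrier = chars, monoid.mult = (\<lambda>\<eta> \<psi>. \<lambda>x\<in>carrier G. \<eta> x * \<psi> x), one = (\<lambda>x\<in>carrier G. 1)\<rparr>"

lemma char_group_simps [simp]:
  "carrier char_group = chars" "\<eta> \<otimes>\<^bsub>char_group\<^esub> \<psi> = (\<lambda>x\<in>carrier G. \<eta> x * \<psi> x)"
  "\<one>\<^bsub>char_group\<^esub> = (\<lambda>x\<in>carrier G. 1)"
  by (simp_all add: char_group_def)

lemma group_char: "group char_group"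
proof (rule groupI)
  fix \<eta> assume \<eta>: "\<eta> \<in> carrier char_group"
  define \<psi> where "\<psi> = (\<lambda>x\<in>carrier G. \<eta> (inv x))"
  have val: "\<psi> y = \<eta> (inv y)" if "y \<in> carrier G" for y using that by (simp add: \<psi>_def)
  moreover have "\<psi> \<in> extensional (carrier G)" by (simp add: \<psi>_def)
  ultimately have "\<psi> \<in> chars"
    unfolding chars_def mem_Collect_eq using \<eta>
    by (auto simp: inv_mult_group mult.commute char_mult char_H H_carrier H_simps)
  moreover have "\<psi> \<otimes>\<^bsub>char_group\<^esub> \<eta> = \<one>\<^bsub>char_group\<^esub>"
    using \<eta> char_inv by (auto simp: \<psi>_def fun_eq_iff restrict_def)
  ultimately show "\<exists>y\<in>carrier char_group. y \<otimes>\<^bsub>char_group\<^esub> \<eta> = \<one>\<^bsub>char_group\<^esub>"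
    by auto
  show "\<one>\<^bsub>char_group\<^esub> \<otimes>\<^bsub>char_group\<^esub> \<eta> = \<eta>"
    using \<eta> by (auto simp: chars_def fun_eq_iff restrict_def extensional_def)
qed (use H_carrier in \<open>auto simp: chars_def fun_eq_iff restrict_def mult_ac extensional_def\<close>)

text \<open>A character is determined by its restriction to \<open>\<Gamma>\<close>, since
  \<open>H\<close> and \<open>\<Gamma>\<close> together cover \<open>G\<close>. On the finite group
  \<open>\<Gamma>\<close> its values are roots of unity of a fixed order.\<close>

lemma finite_chars: "finite chars"
proof -
  let ?n = "card \<Gamma>" and ?r = "\<lambda>\<eta>::'g \<Rightarrow> complex. restrict \<eta> \<Gamma>"
  have n: "?n \<ge> 1" using fin G_simps(3) by (metis Suc_leI One_nat_def card_gt_0_iff empty_iff)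
  have "\<eta> g ^ ?n = 1" if "\<eta> \<in> chars" "g \<in> \<Gamma>" for \<eta> g
  proof -
    have gG: "g \<in> carrier G" using that G_carrier by auto
    have "\<eta> (g [^] k) = \<eta> g ^ k" for k :: nat
      by (induction k) (use that gG in \<open>auto simp: mult.commute char_one char_mult\<close>)
    moreover have "g [^] ?n = \<one>"
      using group.pow_order_eq_1[OF subgroup_imp_group[OF subG], of g] that(2)
      by (simp add: order_def nat_pow_consistent[symmetric])
    ultimately show ?thesis using char_one[OF that(1)] by metis
  qed
  then have "?r ` chars \<subseteq> \<Gamma> \<rightarrow>\<^sub>E {z. z ^ ?n = 1}" by auto
  moreover have "finite (\<Gamma> \<rightarrow>\<^sub>E {z::complex. z ^ ?n = 1})"
    by (intro finite_PiE fin finite_roots_unity n)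
  ultimately have "finite (?r ` chars)" by (rule finite_subset)
  moreover have "inj_on ?r chars"
  proof (rule inj_onI)
    fix \<eta> \<psi> assume c: "\<eta> \<in> chars" "\<psi> \<in> chars" and eq: "?r \<eta> = ?r \<psi>"
    show "\<eta> = \<psi>"
    proof (rule extensionalityI)
      show "\<eta> \<in> extensional (carrier G)" "\<psi> \<in> extensional (carrier G)" using c by (auto simp: chars_def)
      fix x assume "x \<in> carrier G"
      then obtain h g where hg: "h \<in> H" "g \<in> \<Gamma>" "x = h \<otimes> g" using cover by blast
      moreover have "\<eta> g = \<psi> g" using fun_cong[OF eq, of g] hg by simp
      ultimately show "\<eta> x = \<psi> x" using c by (simp add: char_mult char_H H_carrier G_carrier)
    qed
  qed
  ultimately show ?thesis by (rule finite_imageD)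
qed

abbreviation F :: "('g \<Rightarrow> complex) \<Rightarrow> ('g word set \<Rightarrow>\<^sub>0 complex) \<Rightarrow> ('g word set \<Rightarrow>\<^sub>0 complex)" where
  "F \<eta> \<equiv> lin_ext (\<lambda>b. Poly_Mapping.single b (\<eta> (bev b)))"

lemma F_hom: "\<eta> \<in> chars \<Longrightarrow> F \<eta> \<in> ring_hom AG AG"
  by (rule monomial_ring_hom[OF group_len_braid group_len_braid, of "\<lambda>b. b"])
    (auto simp: hom_def bev_mult bev_one char_mult char_one bev_closed)

text \<open>In the grading by values in \<open>G\<close> all monomials of a generating relator have
  degree in \<open>H\<close>, where characters are trivial; so the twist fixes the relators.\<close>

lemma F_ideal:
  assumes \<eta>: "\<eta> \<in> chars" and f: "f \<in> IG" shows "F \<eta> f \<in> IG"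
proof -
  have "F \<eta> (len_relator q G len [] s []) = len_relator q G len [] s []" if "s \<in> S" for s
  proof -
    have "s \<in> H" "s \<in> carrier G" using that SH S_carrier by auto
    then show ?thesis
      by (simp add: len_relator_def lin_ext_add lin_ext_diff bev_class char_H[OF \<eta>] H_simps)
  qed
  then have "F \<eta> ` len_relators q G len S \<subseteq> IG"
    using len_relator_in_ideal[OF S_carrier] by (auto simp: len_relators_eq[OF S_carrier])
  then show ?thesis
    using f len_relators_subset unfolding len_ideal_def[of q G]
    by (intro preimage_ideal[OF B.ring_group_algebra B.ring_group_algebra F_hom[OF \<eta>]])
      (use IG.ideal_axioms in \<open>auto simp: len_ideal_def\<close>)
qed

lemma F_comp:
  assumes "f \<in> carrier AG"
  shows "F \<eta> (F \<psi> f) = F (\<lambda>x\<in>carrier G. \<eta> x * \<psi> x) f"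
  unfolding lin_ext_lin_ext using assms
  by (intro lin_ext_cong) (auto simp: group_algebra_simps bev_closed subset_iff mult.commute)

lemma F_one: 
  assumes "f \<in> carrier AG" shows "F (\<lambda>x\<in>carrier G. 1) f = f"
proof -
  have "F (\<lambda>x\<in>carrier G. 1) f = lin_ext (\<lambda>b. Poly_Mapping.single b 1) f"
    using assms by (intro lin_ext_cong) (auto simp: group_algebra_simps bev_closed subset_iff)
  then show ?thesis by (simp add: lin_ext_id)
qed

lemma F_data: "\<eta> \<in> chars \<Longrightarrow> quot_map_data BG IG BG IG (\<lambda>b. Poly_Mapping.single b (\<eta> (bev b)))"
  by unfold_locales (use F_hom F_ideal in auto)

abbreviation "HG \<equiv> quot_algebra AG IG"

text \<open>The restriction makes the map extensional, as membership in \<open>Bij\<close>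
  requires.\<close>

definition act :: "('g \<Rightarrow> complex) \<Rightarrow> ('g word set \<Rightarrow>\<^sub>0 complex) set \<Rightarrow> ('g word set \<Rightarrow>\<^sub>0 complex) set" where
  "act \<eta> = restrict (quot_map AG IG (F \<eta>)) (carrier HG)"

lemma act_coset: "\<eta> \<in> chars \<Longrightarrow> f \<in> carrier AG \<Longrightarrow> act \<eta> (IG +>\<^bsub>AG\<^esub> f) = IG +>\<^bsub>AG\<^esub> F \<eta> f"
  unfolding act_def IG.quot_carrier using quot_map_data.quot_map_coset[OF F_data, of \<eta> f] by simp

lemma act_algebra_hom: "\<eta> \<in> chars \<Longrightarrow> act \<eta> \<in> algebra_hom HG HG"
  by (rule quot_map_data.quot_homI[OF F_data]) (auto simp only: act_coset)

lemma F_closed: "\<eta> \<in> chars \<Longrightarrow> f \<in> carrier AG \<Longrightarrow> F \<eta> f \<in> carrier AG"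
  using ring_hom_closed[OF F_hom] .

lemma HG_cases:
  assumes "x \<in> carrier HG" obtains f where "f \<in> carrier AG" "x = IG +>\<^bsub>AG\<^esub> f"
  using assms unfolding IG.quot_carrier by blast

lemma act_closed: "\<eta> \<in> chars \<Longrightarrow> x \<in> carrier HG \<Longrightarrow> act \<eta> x \<in> carrier HG"
  using F_closed act_coset unfolding IG.quot_carrier by auto

lemma act_mult: "\<eta> \<in> chars \<Longrightarrow> \<psi> \<in> chars \<Longrightarrow> x \<in> carrier HG \<Longrightarrow>
    act (\<eta> \<otimes>\<^bsub>char_group\<^esub> \<psi>) x = act \<eta> (act \<psi> x)"
  using monoid.m_closed[OF group.is_monoid[OF group_char], of \<eta> \<psi>]
  by (elim HG_cases) (simp add: act_coset F_closed F_comp del: restrict_apply)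

lemma act_one: "x \<in> carrier HG \<Longrightarrow> act \<one>\<^bsub>char_group\<^esub> x = x"
  using monoid.one_closed[OF group.is_monoid[OF group_char]]
  by (elim HG_cases) (simp add: act_coset F_one del: restrict_apply)

lemma act_Bij:
  assumes "\<eta> \<in> chars" shows "act \<eta> \<in> Bij (carrier HG)"
proof -
  interpret C: group char_group by (rule group_char)
  let ?\<psi> = "inv\<^bsub>char_group\<^esub> \<eta>"
  have \<psi>: "?\<psi> \<in> chars" using C.inv_closed[of \<eta>] assms by simp
  have "?\<psi> \<otimes>\<^bsub>char_group\<^esub> \<eta> = \<one>\<^bsub>char_group\<^esub>" "\<eta> \<otimes>\<^bsub>char_group\<^esub> ?\<psi> = \<one>\<^bsub>char_group\<^esub>"
    using C.l_inv[of \<eta>] C.r_inv[of \<eta>] assms by (simp_all del: char_group_simps(2,3))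
  then have "bij_betw (act \<eta>) (carrier HG) (carrier HG)"
    using act_mult[OF \<psi> assms] act_mult[OF assms \<psi>] act_one act_closed[OF assms] act_closed[OF \<psi>]
    by (intro bij_betw_byWitness[where f' = "act ?\<psi>"]) (auto simp del: char_group_simps(2,3))
  then show ?thesis by (simp add: Bij_def act_def)
qed

lemma act_hom: "act \<in> hom char_group (BijGroup (carrier HG))"
proof (rule homI)
  fix \<eta> \<psi> assume c: "\<eta> \<in> carrier char_group" "\<psi> \<in> carrier char_group"
  have "act (\<eta> \<otimes>\<^bsub>char_group\<^esub> \<psi>) = compose (carrier HG) (act \<eta>) (act \<psi>)"
    using c act_mult by (auto simp: compose_def act_def fun_eq_iff restrict_def)
  then show "act (\<eta> \<otimes>\<^bsub>char_group\<^esub> \<psi>) = act \<eta> \<otimes>\<^bsub>BijGroup (carrier HG)\<^esub> act \<psi>"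
    using c act_Bij by (simp add: BijGroup_def)
qed (simp add: BijGroup_def act_Bij)

text \<open>Orthogonality of characters: multiplication by a character \<open>\<psi>\<close>
  permutes the summands and multiplies the sum by \<open>\<psi> x\<close>, so the sum vanishes
  whenever some \<open>\<psi> x\<close> differs from 1.\<close>

lemma char_sum:
  assumes x: "x \<in> carrier G"
  shows "(\<Sum>\<eta>\<in>chars. \<eta> x) = (if x \<in> H then of_nat (card chars) else 0)"
proof (cases "x \<in> H")
  case False
  interpret C: group char_group by (rule group_char)
  obtain \<psi>0 where \<psi>0: "\<forall>y\<in>carrier G. \<forall>z\<in>carrier G. \<psi>0 (y \<otimes> z) = \<psi>0 y * \<psi>0 z"
    "\<forall>h\<in>H. \<psi>0 h = (1::complex)" "\<psi>0 x \<noteq> 1"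
    using separate[OF x False] by blast
  define \<psi> where "\<psi> = restrict \<psi>0 (carrier G)"
  have \<psi>: "\<psi> \<in> chars" "\<psi> x \<noteq> 1" using \<psi>0 x H_carrier by (auto simp: chars_def \<psi>_def)
  have "bij_betw (\<lambda>\<eta>. \<psi> \<otimes>\<^bsub>char_group\<^esub> \<eta>) chars chars"
    using C.inj_on_cmult[of \<psi>] C.surj_const_mult[of \<psi>] \<psi> unfolding bij_betw_def
    by (simp del: char_group_simps(2,3))
  then have "(\<Sum>\<eta>\<in>chars. \<eta> x) = (\<Sum>\<eta>\<in>chars. (\<psi> \<otimes>\<^bsub>char_group\<^esub> \<eta>) x)"
    by (rule sum.reindex_bij_betw[symmetric])
  also have "\<dots> = \<psi> x * (\<Sum>\<eta>\<in>chars. \<eta> x)" using x by (simp add: sum_distrib_left)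
  finally show ?thesis using \<psi> False by simp
qed (simp add: char_H)

text \<open>The character sum removes the monomials with value outside \<open>H\<close>, and for the
  others \<open>emb_ret\<close> recovers the monomial from its rewriting.\<close>

lemma sum_F: 
  assumes "f \<in> carrier AG"
  shows "(\<Sum>\<eta>\<in>chars. F \<eta> f) = pm_scale (of_nat (card chars)) (j (E f))"
proof -
  have "Poly_Mapping.keys f \<subseteq> carrier BG" using assms by (simp add: group_algebra_simps)
  then show ?thesis
  proof (induction f rule: poly_mapping_span_induct)
    case (single b c)
    have s: "(\<Sum>\<eta>\<in>chars. Poly_Mapping.single b (c * \<eta> (bev b)))
        = Poly_Mapping.single b (c * (\<Sum>\<eta>\<in>chars. \<eta> (bev b)))"
      unfolding sum_distrib_left by (rule poly_mapping_eqI) (simp add: lookup_sum lookup_single when_def)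
    show ?case
      using s single by (simp add: char_sum bev_closed E_def emb_ret mult.commute)
  qed (simp_all add: E_def lin_ext_add sum.distrib scale_add)
qed

text \<open>Embedded elements have degrees in \<open>H\<close> only, hence are fixed. Conversely, if
  \<open>f\<close> agrees with all its twists modulo \<open>IG\<close>, summation shows that a
  multiple of \<open>f\<close> agrees with the same multiple of \<open>j (E f)\<close>.\<close>

lemma fixed_points:
  "jq.hq ` carrier (quot_algebra AH IH) = {x \<in> carrier HG. \<forall>\<eta>\<in>chars. act \<eta> x = x}"
proof (intro equalityI subsetI)
  fix x assume "x \<in> jq.hq ` carrier (quot_algebra AH IH)"
  then obtain f where f: "f \<in> carrier AH" "x = IG +>\<^bsub>AG\<^esub> j f"
    unfolding IH.quot_carrier image_image jq.quot_map_coset by blast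
  have jf: "j f \<in> carrier AG" using ring_hom_closed[OF j_hom f(1)] .
  have "F \<eta> (j f) = j f" if "\<eta> \<in> chars" for \<eta>
    unfolding lin_ext_lin_ext using f that
    by (intro lin_ext_cong) (auto simp: group_algebra_simps subset_iff char_H bev_emb)
  then show "x \<in> {x \<in> carrier HG. \<forall>\<eta>\<in>chars. act \<eta> x = x}"
    using jf act_coset[OF _ jf] unfolding f(2) IG.quot_carrier by auto
next
  fix x assume "x \<in> {x \<in> carrier HG. \<forall>\<eta>\<in>chars. act \<eta> x = x}"
  then obtain f where f: "f \<in> carrier AG" "x = IG +>\<^bsub>AG\<^esub> f"
    and fx: "\<And>\<eta>. \<eta> \<in> chars \<Longrightarrow> act \<eta> x = x"
    by (auto elim: HG_cases)
  let ?n = "of_nat (card chars) :: complex"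
  have "f - F \<eta> f \<in> IG" if "\<eta> \<in> chars" for \<eta>
    using fx[OF that] act_coset[OF that f(1)] f(2) IG.coset_eq_iff[of f "F \<eta> f"] by simp
  then have "(\<Sum>\<eta>\<in>chars. f - F \<eta> f) \<in> IG" by (rule IG.I_sum)
  moreover have "(\<Sum>\<eta>\<in>chars. f - F \<eta> f) = pm_scale ?n (f - j (E f))"
  proof -
    have "(\<Sum>\<eta>\<in>chars. f) = pm_scale ?n f"
      by (rule poly_mapping_eqI) (simp add: lookup_sum)
    then show ?thesis by (simp add: sum_subtractf sum_F[OF f(1)] scale_diff)
  qed
  ultimately have "pm_scale ?n (f - j (E f)) \<in> IG" by simp
  \<comment> \<open>Division by the number of characters is a scalar multiplication, under which the
    ideal is stable.\<close>
  from IG.I_scale[OF this, of "inverse ?n"]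
  have "pm_scale (inverse ?n * ?n) (f - j (E f)) \<in> IG" by simp
  moreover have "?n \<noteq> 0"
    using finite_chars monoid.one_closed[OF group.is_monoid[OF group_char]] by auto
  ultimately have "f - j (E f) \<in> IG" by simp
  then have "x = jq.hq (IH +>\<^bsub>AH\<^esub> E f)"
    unfolding f(2) jq.quot_map_coset IG.coset_eq_iff .
  then show "x \<in> jq.hq ` carrier (quot_algebra AH IH)"
    unfolding IH.quot_carrier using E_closed[OF f(1)] by blast
qed

theorem hecke_fixed_points:
  "\<exists>\<iota>. \<iota> \<in> algebra_hom (len_hecke q N len S) (len_hecke q G len S) \<and>
     inj_on \<iota> (carrier (len_hecke q N len S)) \<and>
     (\<forall>w\<in>H. \<iota> (len_hecke_T q N len S w) = len_hecke_T q G len S w) \<and>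
     (\<exists>(K :: nat monoid) act.
        group K \<and> finite (carrier K) \<and> group_action K (carrier (len_hecke q G len S)) act \<and>
        (\<forall>k\<in>carrier K. act k \<in> algebra_hom (len_hecke q G len S) (len_hecke q G len S)) \<and>
        \<iota> ` carrier (len_hecke q N len S) =
          {x \<in> carrier (len_hecke q G len S). \<forall>k\<in>carrier K. act k x = x})"
proof -
  obtain K :: "nat monoid" and f where K: "group K" "finite (carrier K)"
    and f: "f \<in> hom K char_group" "f ` carrier K = chars"
    using finite_group_on_nat[OF group_char] finite_chars by auto
  have "(\<lambda>k. act (f k)) \<in> hom K (BijGroup (carrier HG))"
    using f(1) act_hom by (fastforce simp: hom_def simp del: char_group_simps(2))
  then have action: "group_action K (carrier HG) (\<lambda>k. act (f k))"
    unfolding group_action_def group_hom_def group_hom_axioms_def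
    using K group_BijGroup by blast
  have fk: "f k \<in> chars" if "k \<in> carrier K" for k using f(2) that by blast
  have fixed: "jq.hq ` carrier (quot_algebra AH IH) = {x \<in> carrier HG. \<forall>k\<in>carrier K. act (f k) x = x}"
    unfolding fixed_points f(2)[symmetric] by blast
  show ?thesis
    using jq.quot_map_hom jq_inj jq_T K action fk act_algebra_hom fixed
    unfolding len_hecke_def
    by (intro exI[of _ jq.hq] exI[of _ K] exI[of _ "\<lambda>k. act (f k)"] conjI) blast+
qed

end

section \<open>Root systems\<close>

lemma inner_coroot: "inner x (coroot \<alpha>) = 2 * inner x \<alpha> / inner \<alpha> \<alpha>"
  by (simp add: coroot_def)

lemma coroot_coroot [simp]: "\<alpha> \<noteq> 0 \<Longrightarrow> coroot (coroot \<alpha>) = \<alpha>"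
  by (simp add: coroot_def)

lemma coroot_eq_0_iff [simp]: "coroot \<alpha> = 0 \<longleftrightarrow> \<alpha> = 0"
  by (simp add: coroot_def)

lemma inner_coroot_self [simp]: "\<alpha> \<noteq> 0 \<Longrightarrow> inner \<alpha> (coroot \<alpha>) = 2"
  by (simp add: inner_coroot)

lemma coroot_minus [simp]: "coroot (- \<alpha>) = - coroot \<alpha>"
  by (simp add: coroot_def)

lemma reflection_coroot: "reflection (coroot \<alpha>) = reflection \<alpha>"
  by (rule ext, cases "\<alpha> = 0") (simp_all add: reflection_def, simp add: coroot_def)

lemma reflection_minus: "reflection (- \<alpha>) = reflection \<alpha>"
  by (rule ext) (simp add: reflection_def)

lemma linear_reflection: "linear (reflection \<alpha>)"
  by (rule linearI) (simp_all add: reflection_def inner_left_distrib algebra_simps)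

lemma reflection_reflection [simp]: "reflection \<alpha> (reflection \<alpha> x) = x"
  by (cases "\<alpha> = 0") (simp_all add: reflection_def inner_diff_left)

lemma reflection_comp [simp]: "reflection \<alpha> \<circ> reflection \<alpha> = id"
  by (rule ext) simp

lemma inner_reflection_left: "inner (reflection \<alpha> x) y = inner x (reflection \<alpha> y)"
  by (simp add: reflection_def inner_diff_left inner_diff_right inner_coroot inner_commute)

lemma inner_reflection [simp]: "inner (reflection \<alpha> x) (reflection \<alpha> y) = inner x y"
  by (simp add: inner_reflection_left)

lemma reflection_self [simp]: "reflection \<alpha> \<alpha> = - \<alpha>"
  by (cases "\<alpha> = 0") (simp_all add: reflection_def scaleR_2)

lemma inner_span_zero:
  assumes "x \<in> span A" "\<And>\<beta>. \<beta> \<in> A \<Longrightarrow> inner z \<beta> = 0"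
  shows "inner z x = 0"
  using assms(1)
  by (induction rule: span_induct_alt) (auto simp: inner_add_right assms(2))

lemma dual_basis_ex1:
  fixes D :: "'a::euclidean_space set"
  assumes D: "independent D" "span D = UNIV"
  shows "\<exists>!\<omega>. \<forall>\<beta>\<in>D. inner \<omega> \<beta> = (if \<beta> = \<alpha> then 1 else 0)"
proof (rule ex_ex1I)
  obtain f :: "'a \<Rightarrow> real" where f: "linear f" "\<forall>\<beta>\<in>D. f \<beta> = (if \<beta> = \<alpha> then 1 else 0)"
    using linear_independent_extend[OF D(1), of "\<lambda>\<beta>. if \<beta> = \<alpha> then 1 else 0"] by blast
  \<comment> \<open>The vector that represents the functional \<open>f\<close> through the inner
    product is its adjoint applied to 1.\<close>
  have "inner (adjoint f 1) x = f x" for x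
    using adjoint_works[OF f(1), of x 1] by (simp add: inner_commute)
  with f(2) show "\<exists>\<omega>. \<forall>\<beta>\<in>D. inner \<omega> \<beta> = (if \<beta> = \<alpha> then 1 else 0)"
    by (intro exI[of _ "adjoint f 1"]) simp
next
  fix x y assume xy: "\<forall>\<beta>\<in>D. inner x \<beta> = (if \<beta> = \<alpha> then 1 else 0)"
    "\<forall>\<beta>\<in>D. inner y \<beta> = (if \<beta> = \<alpha> then 1 else 0)"
  have "inner (x - y) (x - y) = 0"
    by (rule inner_span_zero[of _ D])
      (use xy D in \<open>auto simp: inner_diff_left\<close>)
  then show "x = y" by simp
qed

section \<open>Positive systems, simple roots and fundamental weights\<close>

locale root_data =
  fixes R Pos :: "'a::euclidean_space set"
  assumes rs: "root_system R" and red: "reduced_roots R" and posR: "positive_system R Pos"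
begin

abbreviation "D \<equiv> simple_roots Pos"
abbreviation "\<omega> \<equiv> fund_weight Pos"

lemma finite_R: "finite R" and span_R: "span R = UNIV" and nonzero: "\<alpha> \<in> R \<Longrightarrow> \<alpha> \<noteq> 0"
  and refl_image: "\<alpha> \<in> R \<Longrightarrow> reflection \<alpha> ` R = R"
  and integral: "\<alpha> \<in> R \<Longrightarrow> \<beta> \<in> R \<Longrightarrow> inner \<beta> (coroot \<alpha>) \<in> \<int>"
  using rs by (auto simp: root_system_def)

lemma refl_root: "\<alpha> \<in> R \<Longrightarrow> \<beta> \<in> R \<Longrightarrow> reflection \<alpha> \<beta> \<in> R"
  using refl_image by blast

lemma neg_root: "\<alpha> \<in> R \<Longrightarrow> - \<alpha> \<in> R"
  using refl_root[of \<alpha> \<alpha>] by simp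

lemma neg_root_iff [simp]: "- \<alpha> \<in> R \<longleftrightarrow> \<alpha> \<in> R"
  using neg_root[of "- \<alpha>"] neg_root[of \<alpha>] by auto

lemma reduced: "\<alpha> \<in> R \<Longrightarrow> c *\<^sub>R \<alpha> \<in> R \<Longrightarrow> c = 1 \<or> c = -1"
  using red by (auto simp: reduced_roots_def)

text \<open>One vector that cuts out \<open>Pos\<close> is fixed. Pairing with it orders the roots,
  and the inductions below count roots on one side of a given value.\<close>

definition v :: 'a where
  "v = (SOME v. (\<forall>\<alpha>\<in>R. inner \<alpha> v \<noteq> 0) \<and> Pos = {\<alpha>\<in>R. inner \<alpha> v > 0})"

lemma v_props: "(\<forall>\<alpha>\<in>R. inner \<alpha> v \<noteq> 0) \<and> Pos = {\<alpha>\<in>R. inner \<alpha> v > 0}"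
  unfolding v_def by (rule someI_ex) (use posR in \<open>simp add: positive_system_def\<close>)

lemma pos_iff: "\<alpha> \<in> R \<Longrightarrow> \<alpha> \<in> Pos \<longleftrightarrow> inner \<alpha> v > 0"
  using v_props by auto

lemma pos_root: "\<alpha> \<in> Pos \<Longrightarrow> \<alpha> \<in> R" and pos_v: "\<alpha> \<in> Pos \<Longrightarrow> inner \<alpha> v > 0"
  using v_props by auto

lemma simple_pos: "\<alpha> \<in> D \<Longrightarrow> \<alpha> \<in> Pos"
  by (simp add: simple_roots_def)

lemma simple_root: "\<alpha> \<in> D \<Longrightarrow> \<alpha> \<in> R"
  by (simp add: simple_pos pos_root)

lemma finite_Pos: "finite Pos" and finite_D: "finite D"
  using finite_R pos_root simple_root by (auto intro: finite_subset)

lemma neg_pos_iff: "\<alpha> \<in> R \<Longrightarrow> - \<alpha> \<in> Pos \<longleftrightarrow> \<alpha> \<notin> Pos"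
  using pos_iff[of \<alpha>] pos_iff[of "- \<alpha>"] v_props by force

lemma pos_not_neg: "\<alpha> \<in> Pos \<Longrightarrow> - \<alpha> \<notin> Pos"
  using neg_pos_iff pos_root by blast

text \<open>By the Cauchy-Schwarz inequality the product of the two integers
  \<open>\<langle>\<alpha>, \<beta>\<close>-coroot\<open>\<rangle>\<close> and
  \<open>\<langle>\<beta>, \<alpha>\<close>-coroot\<open>\<rangle>\<close> is at most 4. If one of
  them is 1, a reflection yields the difference up to sign; otherwise equality holds, the roots are
  proportional and, the system being reduced, equal.\<close>

lemma root_diff:
  assumes \<alpha>: "\<alpha> \<in> R" and \<beta>: "\<beta> \<in> R" and pos: "inner \<alpha> \<beta> > 0" and ne: "\<alpha> \<noteq> \<beta>"
  shows "\<alpha> - \<beta> \<in> R"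
proof -
  have nz: "\<alpha> \<noteq> 0" "\<beta> \<noteq> 0" using assms nonzero by auto
  then have ip: "inner \<alpha> \<alpha> > 0" "inner \<beta> \<beta> > 0" by auto
  obtain a b :: int where a: "inner \<alpha> (coroot \<beta>) = a" and b: "inner \<beta> (coroot \<alpha>) = b"
    using integral[OF \<beta> \<alpha>] integral[OF \<alpha> \<beta>] by (auto elim!: Ints_cases)
  have "real_of_int a > 0" "real_of_int b > 0"
    unfolding a[symmetric] b[symmetric] using ip pos by (simp_all add: inner_coroot inner_commute)
  then have ab0: "a \<ge> 1" "b \<ge> 1" by auto
  show ?thesis
  proof (cases "a = 1 \<or> b = 1")
    case True
    then show ?thesis
    proof
      assume "a = 1"
      then have "reflection \<beta> \<alpha> = \<alpha> - \<beta>" using a by (simp add: reflection_def)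
      then show ?thesis using refl_root[OF \<beta> \<alpha>] by simp
    next
      assume "b = 1"
      then have "reflection \<alpha> \<beta> = - (\<alpha> - \<beta>)" using b by (simp add: reflection_def)
      then show ?thesis using refl_root[OF \<alpha> \<beta>] by (metis neg_root_iff)
    qed
  next
    case False
    with ab0 have "a \<ge> 2" "b \<ge> 2" by auto
    then have "2 * 2 \<le> real_of_int a * real_of_int b" by (intro mult_mono) auto
    also have "real_of_int a * real_of_int b = 4 * (inner \<alpha> \<beta>)\<^sup>2 / (inner \<alpha> \<alpha> * inner \<beta> \<beta>)"
      unfolding a[symmetric] b[symmetric]
      by (simp add: inner_coroot inner_commute power2_eq_square)
    finally have "inner \<alpha> \<alpha> * inner \<beta> \<beta> \<le> (inner \<alpha> \<beta>)\<^sup>2"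
      using ip by (simp add: field_simps)
    then have "norm \<alpha> * norm \<beta> \<le> \<bar>inner \<alpha> \<beta>\<bar>"
      using power2_le_imp_le[of "norm \<alpha> * norm \<beta>" "\<bar>inner \<alpha> \<beta>\<bar>"]
      by (simp only: power_mult_distrib power2_norm_eq_inner power2_abs abs_ge_zero)
    then have "inner \<alpha> \<beta> = norm \<alpha> * norm \<beta>"
      using pos norm_cauchy_schwarz[of \<alpha> \<beta>] by linarith
    then have "norm \<alpha> *\<^sub>R \<beta> = norm \<beta> *\<^sub>R \<alpha>" by (simp add: norm_cauchy_schwarz_eq)
    then have "(1 / norm \<alpha>) *\<^sub>R norm \<alpha> *\<^sub>R \<beta> = (1 / norm \<alpha>) *\<^sub>R norm \<beta> *\<^sub>R \<alpha>" by simp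
    then have \<beta>\<alpha>: "\<beta> = (norm \<beta> / norm \<alpha>) *\<^sub>R \<alpha>" using nz by simp
    with reduced[OF \<alpha>, of "norm \<beta> / norm \<alpha>"] \<beta> have "norm \<beta> / norm \<alpha> = 1 \<or> norm \<beta> / norm \<alpha> = -1" by simp
    moreover have "norm \<beta> / norm \<alpha> \<ge> 0" by simp
    ultimately have "norm \<beta> / norm \<alpha> = 1" by linarith
    with \<beta>\<alpha> have "\<beta> = 1 *\<^sub>R \<alpha>" by metis
    then show ?thesis using ne by simp
  qed
qed

text \<open>A positive root that is not simple splits into two positive roots with smaller pairing
  with \<open>v\<close>, so fewer positive roots lie below each of them.\<close>

lemma pos_comb:
  assumes "\<alpha> \<in> Pos"
  shows "\<exists>n :: 'a \<Rightarrow> nat. \<alpha> = (\<Sum>\<beta>\<in>D. real (n \<beta>) *\<^sub>R \<beta>)"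
  using assms
proof (induction "card {\<beta>\<in>Pos. inner \<beta> v < inner \<alpha> v}" arbitrary: \<alpha> rule: less_induct)
  case (less \<alpha>)
  show ?case
  proof (cases "\<alpha> \<in> D")
    case True
    have "(\<Sum>\<beta>\<in>D. real (if \<beta> = \<alpha> then 1 else 0) *\<^sub>R \<beta>) = (\<Sum>\<beta>\<in>D. if \<beta> = \<alpha> then \<beta> else 0)"
      by (intro sum.cong) auto
    also have "\<dots> = \<alpha>" using True finite_D by simp
    finally show ?thesis by (intro exI[of _ "\<lambda>\<beta>. if \<beta> = \<alpha> then 1 else 0"]) simp
  next
    case False
    then obtain \<beta> \<gamma> where bg: "\<beta> \<in> Pos" "\<gamma> \<in> Pos" "\<alpha> = \<beta> + \<gamma>"
      using less.prems by (auto simp: simple_roots_def)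
    have lt: "inner \<beta> v < inner \<alpha> v" "inner \<gamma> v < inner \<alpha> v"
      using bg pos_v[of \<beta>] pos_v[of \<gamma>] by (auto simp: inner_add_left)
    have "card {\<delta>\<in>Pos. inner \<delta> v < inner \<beta> v} < card {\<delta>\<in>Pos. inner \<delta> v < inner \<alpha> v}"
      using lt bg finite_Pos by (intro psubset_card_mono) auto
    moreover have "card {\<delta>\<in>Pos. inner \<delta> v < inner \<gamma> v} < card {\<delta>\<in>Pos. inner \<delta> v < inner \<alpha> v}"
      using lt bg finite_Pos by (intro psubset_card_mono) auto
    ultimately obtain m n :: "'a \<Rightarrow> nat" where "\<beta> = (\<Sum>\<delta>\<in>D. real (m \<delta>) *\<^sub>R \<delta>)"
      "\<gamma> = (\<Sum>\<delta>\<in>D. real (n \<delta>) *\<^sub>R \<delta>)"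
      using less.hyps[of \<beta>] less.hyps[of \<gamma>] bg by blast
    then have "\<alpha> = (\<Sum>\<delta>\<in>D. real (m \<delta> + n \<delta>) *\<^sub>R \<delta>)"
      unfolding bg(3) by (simp add: sum.distrib scaleR_left_distrib)
    then show ?thesis by (rule exI[where x = "\<lambda>\<delta>. m \<delta> + n \<delta>"])
  qed
qed

text \<open>Otherwise the difference would be a root, and one of the two simple roots would split
  into positive roots.\<close>

lemma simple_nonpos:
  assumes "\<alpha> \<in> D" "\<beta> \<in> D" "\<alpha> \<noteq> \<beta>"
  shows "inner \<alpha> \<beta> \<le> 0"
proof (rule ccontr)
  assume "\<not> ?thesis"
  then have d: "\<alpha> - \<beta> \<in> R" using root_diff[of \<alpha> \<beta>] assms simple_root by auto
  have "\<alpha> = \<beta> + (\<alpha> - \<beta>)" "\<beta> = \<alpha> + (\<beta> - \<alpha>)" by auto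
  moreover have "\<alpha> - \<beta> \<in> Pos \<or> \<beta> - \<alpha> \<in> Pos" using neg_pos_iff[OF d] by auto
  ultimately show False using assms unfolding simple_roots_def by blast
qed

text \<open>Moving negative terms to the other side gives one vector with two nonnegative
  expressions over disjoint sets of simple roots. Since these meet at obtuse or right angles, its
  norm is zero, and pairing with \<open>v\<close> shows that both expressions are empty.\<close>

lemma D_comb_zero:
  assumes z: "(\<Sum>\<alpha>\<in>D. c \<alpha> *\<^sub>R \<alpha>) = 0" and \<alpha>: "\<alpha> \<in> D"
  shows "c \<alpha> = 0"
proof -
  define A where "A = {\<alpha>\<in>D. c \<alpha> > 0}"
  define B where "B = {\<alpha>\<in>D. c \<alpha> < 0}"
  have fin: "finite A" "finite B" using finite_D by (auto simp: A_def B_def)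
  define u where "u = (\<Sum>\<alpha>\<in>A. c \<alpha> *\<^sub>R \<alpha>)"
  have "(\<Sum>\<alpha>\<in>D. c \<alpha> *\<^sub>R \<alpha>) = (\<Sum>\<alpha>\<in>A \<union> B. c \<alpha> *\<^sub>R \<alpha>)"
    by (rule sum.mono_neutral_right) (use finite_D in \<open>auto simp: A_def B_def\<close>)
  also have "\<dots> = u + (\<Sum>\<alpha>\<in>B. c \<alpha> *\<^sub>R \<alpha>)"
  proof -
    have "A \<inter> B = {}" unfolding A_def B_def by fastforce
    then show ?thesis unfolding u_def using sum.union_disjoint[OF fin] by blast
  qed
  finally have "u + (\<Sum>\<alpha>\<in>B. c \<alpha> *\<^sub>R \<alpha>) = 0" using z by metis
  then have u2: "u = (\<Sum>\<alpha>\<in>B. (- c \<alpha>) *\<^sub>R \<alpha>)"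
    unfolding scaleR_minus_left sum_negf by (rule eq_neg_iff_add_eq_0[THEN iffD2])
  have au: "inner \<alpha> u \<le> 0" if "\<alpha> \<in> A" for \<alpha>
  proof -
    have "inner \<alpha> u = (\<Sum>\<beta>\<in>B. (- c \<beta>) * inner \<alpha> \<beta>)"
      by (subst u2) (simp only: inner_sum_right inner_scaleR_right)
    also have "\<dots> \<le> 0"
      using that by (intro sum_nonpos mult_nonneg_nonpos simple_nonpos) (auto simp: A_def B_def)
    finally show ?thesis .
  qed
  have "inner (\<Sum>\<alpha>\<in>A. c \<alpha> *\<^sub>R \<alpha>) u = (\<Sum>\<alpha>\<in>A. c \<alpha> * inner \<alpha> u)"
    by (simp only: inner_sum_left inner_scaleR_left)
  then have "inner u u = (\<Sum>\<alpha>\<in>A. c \<alpha> * inner \<alpha> u)" unfolding u_def .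
  also have "\<dots> \<le> 0"
    using au by (intro sum_nonpos mult_nonneg_nonpos) (auto simp: A_def)
  finally have u0: "u = 0" by (metis inner_gt_zero_iff not_less)
  have "A = {}"
  proof (rule ccontr)
    assume "A \<noteq> {}"
    then have "(\<Sum>\<alpha>\<in>A. c \<alpha> * inner \<alpha> v) > 0"
      using fin by (intro sum_pos mult_pos_pos) (auto simp: A_def simple_pos pos_v)
    then have "inner u v > 0" by (simp add: u_def inner_sum_left)
    then show False using u0 by simp
  qed
  moreover have "B = {}"
  proof (rule ccontr)
    assume "B \<noteq> {}"
    then have "(\<Sum>\<alpha>\<in>B. (- c \<alpha>) * inner \<alpha> v) > 0"
      using fin by (intro sum_pos mult_pos_pos) (auto simp: B_def simple_pos pos_v)
    then have "inner u v > 0" by (subst u2) (simp add: inner_sum_left)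
    then show False using u0 by simp
  qed
  ultimately show ?thesis using \<alpha> unfolding A_def B_def by (metis (mono_tags, lifting) empty_iff linorder_neqE_linordered_idom mem_Collect_eq)
qed

lemma independent_D: "independent D"
  using D_comb_zero unfolding dependent_finite[OF finite_D] by blast

lemma span_D: "span D = UNIV"
proof -
  have "\<alpha> \<in> span D" if "\<alpha> \<in> R" for \<alpha>
  proof -
    have p: "\<beta> \<in> span D" if "\<beta> \<in> Pos" for \<beta>
      using pos_comb[OF that] by (metis (no_types, lifting) span_base span_scale span_sum)
    show ?thesis using p[of \<alpha>] p[of "- \<alpha>"] neg_pos_iff[OF that] span_neg[of "- \<alpha>"] by auto
  qed
  then have "span R \<subseteq> span D" by (metis span_minimal subsetI subspace_span)
  then show ?thesis using span_R by auto
qed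

lemma coroot_inj: "inj_on coroot R"
  by (rule inj_onI) (metis coroot_coroot nonzero)

lemma coroot_inj_D: "inj_on coroot D"
  using coroot_inj by (rule inj_on_subset) (auto simp: simple_root)

lemma independent_coroot_D: "independent (coroot ` D)"
proof -
  have "u (coroot \<alpha>) = 0" if z: "(\<Sum>x\<in>coroot ` D. u x *\<^sub>R x) = 0" and \<alpha>: "\<alpha> \<in> D" for u \<alpha>
  proof -
    have "(\<Sum>\<beta>\<in>D. (u (coroot \<beta>) * (2 / inner \<beta> \<beta>)) *\<^sub>R \<beta>) = 0"
      using z by (simp add: sum.reindex[OF coroot_inj_D]) (simp add: coroot_def)
    then have "u (coroot \<alpha>) * (2 / inner \<alpha> \<alpha>) = 0"
      using \<alpha> by (rule D_comb_zero)
    then show ?thesis using nonzero[OF simple_root[OF \<alpha>]] by simp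
  qed
  then show ?thesis using dependent_finite[of "coroot ` D"] finite_D by auto
qed

lemma span_coroot_D: "span (coroot ` D) = UNIV"
proof -
  have "\<beta> \<in> span (coroot ` D)" if "\<beta> \<in> D" for \<beta>
  proof -
    have "\<beta> = (inner \<beta> \<beta> / 2) *\<^sub>R coroot \<beta>"
      using nonzero[OF simple_root[OF that]] by (simp add: coroot_def)
    moreover have "(inner \<beta> \<beta> / 2) *\<^sub>R coroot \<beta> \<in> span (coroot ` D)"
      using that by (intro span_scale span_base) auto
    ultimately show ?thesis by simp
  qed
  then have "span D \<subseteq> span (coroot ` D)" by (metis span_minimal subsetI subspace_span)
  then show ?thesis using span_D by auto
qed

lemma fund_weight:
  assumes "\<alpha> \<in> D" "\<beta> \<in> D"
  shows "inner (\<omega> \<alpha>) (coroot \<beta>) = (if \<beta> = \<alpha> then 1 else 0)"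
proof -
  have "\<exists>!w. \<forall>\<beta>\<in>D. inner w (coroot \<beta>) = (if \<beta> = \<alpha> then 1 else 0)"
    using dual_basis_ex1[OF independent_coroot_D span_coroot_D, of "coroot \<alpha>"]
      inj_on_eq_iff[OF coroot_inj_D _ assms(1)] by simp
  from theI'[OF this] show ?thesis using assms(2) unfolding fund_weight_def by blast
qed

lemma eq_by_coroots:
  assumes "\<And>\<beta>. \<beta> \<in> D \<Longrightarrow> inner x (coroot \<beta>) = inner y (coroot \<beta>)"
  shows "x = y"
proof -
  have "inner (x - y) (x - y) = 0"
    by (rule inner_span_zero[of _ "coroot ` D"])
      (use assms span_coroot_D in \<open>auto simp: inner_diff_left\<close>)
  then show "x = y" by simp
qed

lemma weight_expansion: "x = (\<Sum>\<beta>\<in>D. inner x (coroot \<beta>) *\<^sub>R \<omega> \<beta>)"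
proof (rule eq_by_coroots)
  fix \<gamma> assume \<gamma>: "\<gamma> \<in> D"
  have "inner (\<Sum>\<beta>\<in>D. inner x (coroot \<beta>) *\<^sub>R \<omega> \<beta>) (coroot \<gamma>)
      = (\<Sum>\<beta>\<in>D. if \<beta> = \<gamma> then inner x (coroot \<beta>) else 0)"
    unfolding inner_sum_left by (rule sum.cong) (auto simp: fund_weight \<gamma>)
  then show "inner x (coroot \<gamma>) = inner (\<Sum>\<beta>\<in>D. inner x (coroot \<beta>) *\<^sub>R \<omega> \<beta>) (coroot \<gamma>)"
    using finite_D \<gamma> by simp
qed

lemma inner_expansion: "inner x y = (\<Sum>\<beta>\<in>D. inner x (coroot \<beta>) * inner (\<omega> \<beta>) y)"
  by (subst weight_expansion[of x]) (simp add: inner_sum_left)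

text \<open>Fundamental weights and simple coroots are dual bases, so pairing with a weight reads
  off a coordinate along a coroot. Signs of roots are read from these coordinates below.\<close>

lemma coroot_expansion: "x = (\<Sum>\<beta>\<in>D. inner (\<omega> \<beta>) x *\<^sub>R coroot \<beta>)"
proof (rule vector_eq_ldot[THEN iffD1], rule allI)
  fix z
  show "inner z x = inner z (\<Sum>\<beta>\<in>D. inner (\<omega> \<beta>) x *\<^sub>R coroot \<beta>)"
    using inner_expansion[of z x] by (simp add: inner_sum_right mult.commute)
qed

lemma inner_weight_comb:
  assumes "\<alpha> \<in> D" "finite D"
  shows "inner (\<omega> \<alpha>) (\<Sum>\<beta>\<in>D. c \<beta> *\<^sub>R coroot \<beta>) = c \<alpha>"
proof -
  have "inner (\<omega> \<alpha>) (\<Sum>\<beta>\<in>D. c \<beta> *\<^sub>R coroot \<beta>) = (\<Sum>\<beta>\<in>D. if \<beta> = \<alpha> then c \<beta> else 0)"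
    unfolding inner_sum_right by (rule sum.cong) (auto simp: fund_weight assms)
  then show ?thesis using assms by simp
qed

text \<open>Passing from simple roots to simple coroots only rescales the coefficients by positive
  factors.\<close>

lemma weight_nonneg:
  assumes "\<alpha> \<in> Pos" "\<beta> \<in> D"
  shows "inner (\<omega> \<beta>) \<alpha> \<ge> 0"
proof -
  obtain n :: "'a \<Rightarrow> nat" where n: "\<alpha> = (\<Sum>\<beta>\<in>D. real (n \<beta>) *\<^sub>R \<beta>)" using pos_comb assms by blast
  have "\<alpha> = (\<Sum>\<beta>\<in>D. (real (n \<beta>) * inner \<beta> \<beta> / 2) *\<^sub>R coroot \<beta>)"
    by (subst n, rule sum.cong) (auto simp: coroot_def nonzero simple_root)
  then have "inner (\<omega> \<beta>) \<alpha> = real (n \<beta>) * inner \<beta> \<beta> / 2"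
    using inner_weight_comb[OF assms(2) finite_D] by metis
  moreover have "real (n \<beta>) * inner \<beta> \<beta> / 2 \<ge> 0"
    by (intro divide_nonneg_nonneg mult_nonneg_nonneg) auto
  ultimately show ?thesis by linarith
qed

lemma coroot_pos_scale: "\<alpha> \<in> R \<Longrightarrow> \<exists>c>0. coroot \<alpha> = c *\<^sub>R \<alpha>"
  using nonzero by (intro exI[of _ "2 / inner \<alpha> \<alpha>"]) (simp add: coroot_def)

lemma weight_coroot_nonneg:
  assumes "\<alpha> \<in> Pos" "\<beta> \<in> D" shows "inner (\<omega> \<beta>) (coroot \<alpha>) \<ge> 0"
  using weight_nonneg[OF assms] coroot_pos_scale[OF pos_root[OF assms(1)]] by auto

text \<open>Forming coroots commutes with reflections and rescales by positive factors, so the same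
  vector \<open>v\<close> defines the dual positive system. Statements on coroots are obtained
  through this interpretation.\<close>

lemma dual: "root_data (coroot ` R) (coroot ` Pos)"
proof
  have refl: "coroot (reflection \<alpha> \<beta>) = reflection \<alpha> (coroot \<beta>)" for \<alpha> \<beta>
    by (simp add: coroot_def linear_scale[OF linear_reflection])
  show "root_system (coroot ` R)"
    unfolding root_system_def
  proof (intro conjI ballI)
    show "span (coroot ` R) = UNIV"
      using span_mono[of "coroot ` D" "coroot ` R"] span_coroot_D simple_root by auto
    show "reflection \<alpha> ` coroot ` R = coroot ` R" if \<alpha>: "\<alpha> \<in> coroot ` R" for \<alpha>
    proof -
      obtain \<beta> where \<beta>: "\<beta> \<in> R" "\<alpha> = coroot \<beta>" using \<alpha> by auto
      have "reflection \<beta> ` coroot ` R = coroot ` (reflection \<beta> ` R)"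
        by (auto simp: image_image refl)
      then show ?thesis using \<beta> by (simp add: reflection_coroot refl_image)
    qed
    show "inner \<beta> (coroot \<alpha>) \<in> \<int>" if "\<alpha> \<in> coroot ` R" "\<beta> \<in> coroot ` R" for \<alpha> \<beta>
      using that integral nonzero by (auto simp: inner_commute)
  qed (use finite_R nonzero in auto)
  show "reduced_roots (coroot ` R)"
    unfolding reduced_roots_def
  proof (intro ballI allI impI)
    fix \<alpha> c assume "\<alpha> \<in> coroot ` R" "c *\<^sub>R \<alpha> \<in> coroot ` R"
    then obtain \<beta> \<gamma> where b: "\<beta> \<in> R" "\<alpha> = coroot \<beta>" and g: "\<gamma> \<in> R" "c *\<^sub>R \<alpha> = coroot \<gamma>" by auto
    have c: "c \<noteq> 0" using g nonzero by auto
    have "\<gamma> = coroot (c *\<^sub>R coroot \<beta>)" using b g nonzero by (metis coroot_coroot)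
    also have "\<dots> = (1 / c) *\<^sub>R \<beta>"
      using c nonzero[OF b(1)] by (simp add: coroot_def field_simps)
    finally have "1 / c = 1 \<or> 1 / c = -1" using reduced[OF b(1), of "1 / c"] g(1) by metis
    then show "c = 1 \<or> c = -1" using c by (auto simp: field_simps)
  qed
  show "positive_system (coroot ` R) (coroot ` Pos)"
    unfolding positive_system_def
  proof (intro exI[of _ v] conjI)
    have s: "inner (coroot \<alpha>) v > 0 \<longleftrightarrow> inner \<alpha> v > 0" "inner (coroot \<alpha>) v \<noteq> 0 \<longleftrightarrow> inner \<alpha> v \<noteq> 0"
      if "\<alpha> \<in> R" for \<alpha>
      using coroot_pos_scale[OF that] by (auto simp: zero_less_mult_iff)
    show "\<forall>\<alpha>\<in>coroot ` R. inner \<alpha> v \<noteq> 0" using s v_props by auto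
    show "coroot ` Pos = {\<alpha> \<in> coroot ` R. inner \<alpha> v > 0}" using s v_props by auto
  qed
qed

text \<open>If a simple coroot is a sum of two positive coroots, their other coordinates are
  nonnegative with sum zero. Both are then multiples of it, hence equal to it, since the dual system
  is reduced.\<close>

lemma simple_coroots: "simple_roots (coroot ` Pos) = coroot ` D"
proof -
  interpret dual: root_data "coroot ` R" "coroot ` Pos" by (rule dual)
  have sub: "coroot ` D \<subseteq> simple_roots (coroot ` Pos)"
  proof
    fix x assume "x \<in> coroot ` D"
    then obtain \<alpha> where \<alpha>: "\<alpha> \<in> D" "x = coroot \<alpha>" by auto
    have False if bg: "\<beta> \<in> Pos" "\<gamma> \<in> Pos" "coroot \<alpha> = coroot \<beta> + coroot \<gamma>" for \<beta> \<gamma>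
    proof -
      have same: "\<beta>' = \<alpha>" if b': "\<beta>' \<in> Pos" and g': "\<gamma>' \<in> Pos" and eq: "coroot \<alpha> = coroot \<beta>' + coroot \<gamma>'" for \<beta>' \<gamma>'
      proof -
        have "inner (\<omega> \<delta>) (coroot \<beta>') = 0" if "\<delta> \<in> D - {\<alpha>}" for \<delta>
        proof -
          have "inner (\<omega> \<delta>) (coroot \<beta>') + inner (\<omega> \<delta>) (coroot \<gamma>') = 0"
            using that \<alpha> fund_weight[of \<delta> \<alpha>] unfolding inner_add_right[symmetric] eq[symmetric] by auto
          then show ?thesis
            using weight_coroot_nonneg[OF b', of \<delta>] weight_coroot_nonneg[OF g', of \<delta>] that
            by auto
        qed
        then have "(\<Sum>\<delta>\<in>D. inner (\<omega> \<delta>) (coroot \<beta>') *\<^sub>R coroot \<delta>)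
            = (\<Sum>\<delta>\<in>{\<alpha>}. inner (\<omega> \<delta>) (coroot \<beta>') *\<^sub>R coroot \<delta>)"
          using \<alpha> finite_D by (intro sum.mono_neutral_right) auto
        then have sc: "coroot \<beta>' = inner (\<omega> \<alpha>) (coroot \<beta>') *\<^sub>R coroot \<alpha>"
          using coroot_expansion[of "coroot \<beta>'"] by simp
        moreover have "coroot \<beta>' \<in> coroot ` R" "coroot \<alpha> \<in> coroot ` R"
          using \<alpha> b' pos_root simple_root by auto
        ultimately have "inner (\<omega> \<alpha>) (coroot \<beta>') = 1 \<or> inner (\<omega> \<alpha>) (coroot \<beta>') = -1"
          using dual.reduced by metis
        then have "coroot \<beta>' = coroot \<alpha>"
          using weight_coroot_nonneg[OF b' \<alpha>(1)] sc by auto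
        then show ?thesis using coroot_inj b' \<alpha> pos_root simple_root by (auto dest: inj_onD)
      qed
      have "\<beta> = \<alpha>" using same[OF bg] .
      moreover have "\<gamma> = \<alpha>" using same[of \<gamma> \<beta>] bg by (simp add: add.commute)
      ultimately show False using bg nonzero[OF simple_root[OF \<alpha>(1)]] by simp
    qed
    then show "x \<in> simple_roots (coroot ` Pos)"
      using \<alpha> simple_pos by (auto simp: simple_roots_def[of "coroot ` Pos"])
  qed
  show ?thesis
  \<comment> \<open>The simple coroots already span, so the independent set of simple roots of the
    dual system cannot be larger.\<close>
  proof (rule antisym[OF _ sub], rule subsetI, rule ccontr)
    fix x assume x: "x \<in> simple_roots (coroot ` Pos)" "x \<notin> coroot ` D"
    then have "coroot ` D \<subseteq> simple_roots (coroot ` Pos) - {x}" using sub by auto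
    then have "x \<in> span (simple_roots (coroot ` Pos) - {x})"
      using span_mono span_coroot_D by blast
    then show False using dual.independent_D x(1) by (auto simp: dependent_def)
  qed
qed

lemma coroot_comb:
  assumes "\<alpha> \<in> Pos"
  shows "\<exists>n :: 'a \<Rightarrow> nat. coroot \<alpha> = (\<Sum>\<beta>\<in>D. real (n \<beta>) *\<^sub>R coroot \<beta>)"
proof -
  interpret dual: root_data "coroot ` R" "coroot ` Pos" by (rule dual)
  obtain n :: "'a \<Rightarrow> nat" where "coroot \<alpha> = (\<Sum>\<beta>\<in>coroot ` D. real (n \<beta>) *\<^sub>R \<beta>)"
    using dual.pos_comb[of "coroot \<alpha>"] assms by (auto simp: simple_coroots)
  then show ?thesis
    by (intro exI[of _ "n \<circ> coroot"]) (simp add: sum.reindex[OF coroot_inj_D])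
qed

lemma weight_coroot_nat:
  assumes "\<alpha> \<in> Pos" "\<beta> \<in> D"
  shows "inner (\<omega> \<beta>) (coroot \<alpha>) \<in> \<nat>"
  using coroot_comb[OF assms(1)] inner_weight_comb[OF assms(2) finite_D] by auto

lemma weight_coroot_int:
  assumes "\<alpha> \<in> R" "\<beta> \<in> D"
  shows "inner (\<omega> \<beta>) (coroot \<alpha>) \<in> \<int>"
proof (cases "\<alpha> \<in> Pos")
  case False
  then have "inner (\<omega> \<beta>) (coroot (- \<alpha>)) \<in> \<nat>" using assms weight_coroot_nat neg_pos_iff by blast
  then show ?thesis using Nats_subset_Ints by (auto simp: minus_in_Ints_iff)
qed (use assms weight_coroot_nat Nats_subset_Ints in blast)

end

section \<open>Lengths in the Weyl group\<close>

definition rprod :: "'a::euclidean_space list \<Rightarrow> 'a \<Rightarrow> 'a" where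
  "rprod xs = foldr (\<lambda>\<alpha> w. reflection \<alpha> \<circ> w) xs id"

lemma rprod_simps [simp]: "rprod [] = id" "rprod (\<alpha> # xs) = reflection \<alpha> \<circ> rprod xs"
  by (simp_all add: rprod_def)

lemma rprod_append: "rprod (xs @ ys) = rprod xs \<circ> rprod ys"
  by (induction xs) (auto simp: comp_assoc)

lemma rprod_rev: "rprod (rev xs) \<circ> rprod xs = id" "rprod xs \<circ> rprod (rev xs) = id"
proof -
  have *: "rprod (rev xs) \<circ> rprod xs = id" for xs :: "'a list"
  proof (induction xs)
    case (Cons \<alpha> xs)
    then show ?case
      by (simp add: rprod_append fun_eq_iff)
  qed simp
  from *[of xs] *[of "rev xs"] show "rprod (rev xs) \<circ> rprod xs = id" "rprod xs \<circ> rprod (rev xs) = id"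
    by simp_all
qed

lemma bij_rprod: "bij (rprod xs)"
  using rprod_rev by (rule o_bij)

lemma linear_rprod: "linear (rprod xs)"
proof (induction xs)
  case (Cons \<alpha> xs)
  then show ?case using linear_compose[OF Cons linear_reflection] by (simp add: o_def)
qed (simp add: linear_ident id_def)

lemma inner_rprod [simp]: "inner (rprod xs x) (rprod xs y) = inner x y"
  by (induction xs) auto

lemma BijGroup_UNIV:
  "carrier (BijGroup UNIV) = {f. bij f}" "\<one>\<^bsub>BijGroup UNIV\<^esub> = id"
  "bij f \<Longrightarrow> bij g \<Longrightarrow> f \<otimes>\<^bsub>BijGroup UNIV\<^esub> g = f \<circ> g"
  by (auto simp: BijGroup_def Bij_def compose_def fun_eq_iff)

lemma bij_reflection: "bij (reflection \<alpha>)"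
  using bij_rprod[of "[\<alpha>]"] by simp

lemma inv_reflection: "inv\<^bsub>BijGroup UNIV\<^esub> (reflection \<alpha>) = reflection \<alpha>"
  by (rule group.inv_equality[OF group_BijGroup])
    (simp_all add: BijGroup_UNIV bij_reflection)

text \<open>Reflections are involutions, so inverse letters can be absorbed and the generated group
  consists of plain products.\<close>

lemma weyl_group_eq: "weyl_group R = rprod ` lists R"
proof
  show "weyl_group R \<subseteq> rprod ` lists R"
  proof
    fix w assume "w \<in> weyl_group R"
    then show "w \<in> rprod ` lists R"
      unfolding weyl_group_def
    proof (induction rule: generate.induct)
      case one
      show ?case by (rule image_eqI[of _ _ "[]"]) (auto simp: BijGroup_UNIV)
    next
      case (incl h)
      then obtain \<alpha> where "\<alpha> \<in> R" "h = reflection \<alpha>" by auto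
      then show ?case by (intro image_eqI[of _ _ "[\<alpha>]"]) auto
    next
      case (inv h)
      then obtain \<alpha> where "\<alpha> \<in> R" "h = reflection \<alpha>" by auto
      then show ?case by (intro image_eqI[of _ _ "[\<alpha>]"]) (auto simp: inv_reflection)
    next
      case (eng h1 h2)
      then obtain xs ys where "xs \<in> lists R" "ys \<in> lists R" "h1 = rprod xs" "h2 = rprod ys" by blast
      then show ?case
        by (intro image_eqI[of _ _ "xs @ ys"]) (auto simp: rprod_append BijGroup_UNIV bij_rprod)
    qed
  qed
  show "rprod ` lists R \<subseteq> weyl_group R"
  proof (rule image_subsetI)
    fix xs assume "xs \<in> lists R"
    then show "rprod xs \<in> weyl_group R"
    proof (induction xs)
      case Nil
      have "\<one>\<^bsub>BijGroup UNIV\<^esub> \<in> generate (BijGroup UNIV) (reflection ` R)" by (rule generate.one)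
      then show ?case by (simp add: weyl_group_def BijGroup_UNIV id_def)
    next
      case (Cons \<alpha> xs)
      have "reflection \<alpha> \<otimes>\<^bsub>BijGroup UNIV\<^esub> rprod xs \<in> generate (BijGroup UNIV) (reflection ` R)"
        using Cons by (intro generate.eng[OF generate.incl]) (auto simp: weyl_group_def)
      then show ?case by (simp add: weyl_group_def BijGroup_UNIV bij_rprod bij_reflection o_def)
    qed
  qed
qed

lemma conj_reflection:
  assumes "linear w" "\<And>x y. inner (w x) (w y) = inner x y"
  shows "reflection (w \<alpha>) (w x) = w (reflection \<alpha> x)"
  using assms by (simp add: reflection_def linear_diff linear_scale inner_coroot)

lemma coroot_isometry:
  assumes "linear w" "\<And>x y. inner (w x) (w y) = inner x y"
  shows "coroot (w \<alpha>) = w (coroot \<alpha>)"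
  using assms by (simp add: coroot_def linear_scale)

section \<open>The Weyl group, inversions and reduced words\<close>

context root_data
begin

abbreviation "W \<equiv> weyl_group R"

lemma weyl_rprod: "xs \<in> lists R \<Longrightarrow> rprod xs \<in> W"
  by (auto simp: weyl_group_eq)

lemma weyl_linear: "w \<in> W \<Longrightarrow> linear w"
  by (auto simp: weyl_group_eq linear_rprod)

lemma weyl_inner: "w \<in> W \<Longrightarrow> inner (w x) (w y) = inner x y"
  by (auto simp: weyl_group_eq)

lemma weyl_id: "id \<in> W" using weyl_rprod[of "[]"] by simp

lemma weyl_refl: "\<alpha> \<in> R \<Longrightarrow> reflection \<alpha> \<in> W"
  using weyl_rprod[of "[\<alpha>]"] by simp

lemma weyl_comp: "w \<in> W \<Longrightarrow> w' \<in> W \<Longrightarrow> w \<circ> w' \<in> W"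
  unfolding weyl_group_eq by (auto simp: rprod_append[symmetric] simp del: rprod_simps intro!: imageI)

lemma weyl_root: "w \<in> W \<Longrightarrow> \<alpha> \<in> R \<Longrightarrow> w \<alpha> \<in> R"
proof -
  have "rprod xs \<alpha> \<in> R" if "xs \<in> lists R" "\<alpha> \<in> R" for xs
    using that by (induction xs) (auto simp: refl_root)
  then show "w \<in> W \<Longrightarrow> \<alpha> \<in> R \<Longrightarrow> w \<alpha> \<in> R" by (auto simp: weyl_group_eq)
qed

lemma weyl_inverse:
  assumes "w \<in> W"
  obtains w' where "w' \<in> W" "w \<circ> w' = id" "w' \<circ> w = id"
proof -
  obtain xs where xs: "xs \<in> lists R" "w = rprod xs" using assms by (auto simp: weyl_group_eq)
  then have "rprod (rev xs) \<in> W" by (intro weyl_rprod) auto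
  then show ?thesis using that rprod_rev xs by blast
qed

lemma weyl_coroot: "w \<in> W \<Longrightarrow> coroot (w \<alpha>) = w (coroot \<alpha>)"
  by (rule coroot_isometry[OF weyl_linear weyl_inner])

lemma weyl_neg: "w \<in> W \<Longrightarrow> w (- x) = - w x"
  by (rule linear_neg[OF weyl_linear])

lemma pos_if_weight: "\<alpha> \<in> R \<Longrightarrow> \<delta> \<in> D \<Longrightarrow> inner (\<omega> \<delta>) \<alpha> > 0 \<Longrightarrow> \<alpha> \<in> Pos"
  using weight_nonneg[of "- \<alpha>" \<delta>] neg_pos_iff[of \<alpha>] by auto

lemma weight_simple: "\<alpha> \<in> D \<Longrightarrow> \<delta> \<in> D \<Longrightarrow> \<alpha> \<noteq> \<delta> \<Longrightarrow> inner (\<omega> \<delta>) \<alpha> = 0"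
  using fund_weight[of \<delta> \<alpha>] nonzero[OF simple_root, of \<alpha>] by (auto simp: inner_coroot)

lemma weight_refl: "\<alpha> \<in> D \<Longrightarrow> \<delta> \<in> D \<Longrightarrow> \<alpha> \<noteq> \<delta> \<Longrightarrow> inner (\<omega> \<delta>) (reflection \<alpha> x) = inner (\<omega> \<delta>) x"
  by (simp add: reflection_def inner_diff_right weight_simple)

text \<open>A root with a single nonzero coordinate is a multiple of a simple root; since the system
  is reduced and the root positive, the multiple is 1.\<close>

lemma simple_if_weights:
  assumes \<alpha>: "\<alpha> \<in> D" and \<beta>: "\<beta> \<in> Pos" and z: "\<And>\<delta>. \<delta> \<in> D \<Longrightarrow> \<delta> \<noteq> \<alpha> \<Longrightarrow> inner (\<omega> \<delta>) \<beta> = 0"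
  shows "\<beta> = \<alpha>"
proof -
  have "(\<Sum>\<delta>\<in>D. inner (\<omega> \<delta>) \<beta> *\<^sub>R coroot \<delta>) = (\<Sum>\<delta>\<in>{\<alpha>}. inner (\<omega> \<delta>) \<beta> *\<^sub>R coroot \<delta>)"
    using \<alpha> finite_D z by (intro sum.mono_neutral_right) auto
  then have eq: "\<beta> = (inner (\<omega> \<alpha>) \<beta> * (2 / inner \<alpha> \<alpha>)) *\<^sub>R \<alpha>"
    using coroot_expansion[of \<beta>] by (simp add: coroot_def)
  then have "inner (\<omega> \<alpha>) \<beta> * (2 / inner \<alpha> \<alpha>) = 1 \<or> inner (\<omega> \<alpha>) \<beta> * (2 / inner \<alpha> \<alpha>) = -1"
    using reduced[OF simple_root[OF \<alpha>]] pos_root[OF \<beta>] by metis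
  then show ?thesis
  proof
    assume "inner (\<omega> \<alpha>) \<beta> * (2 / inner \<alpha> \<alpha>) = -1"
    then have "\<beta> = - \<alpha>" using eq by simp
    then show ?thesis using pos_not_neg \<beta> simple_pos[OF \<alpha>] by auto
  next
    assume "inner (\<omega> \<alpha>) \<beta> * (2 / inner \<alpha> \<alpha>) = 1"
    then have "\<beta> = 1 *\<^sub>R \<alpha>" using eq by metis
    then show ?thesis by simp
  qed
qed

text \<open>Some coordinate other than that of \<open>\<alpha>\<close> is positive. The reflection
  leaves it unchanged, and one positive coordinate makes a root positive.\<close>

lemma simple_perm:
  assumes \<alpha>: "\<alpha> \<in> D" and \<beta>: "\<beta> \<in> Pos" "\<beta> \<noteq> \<alpha>"
  shows "reflection \<alpha> \<beta> \<in> Pos"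
proof -
  obtain \<delta> where \<delta>: "\<delta> \<in> D" "\<delta> \<noteq> \<alpha>" "inner (\<omega> \<delta>) \<beta> \<noteq> 0"
    using simple_if_weights[OF \<alpha> \<beta>(1)] \<beta>(2) by blast
  then have "inner (\<omega> \<delta>) (reflection \<alpha> \<beta>) > 0"
    using weight_refl[of \<alpha> \<delta>] weight_nonneg[OF \<beta>(1) \<delta>(1)] \<alpha> by auto
  then show ?thesis
    using pos_if_weight[OF _ \<delta>(1)] refl_root[OF simple_root[OF \<alpha>] pos_root[OF \<beta>(1)]] by blast
qed

definition inversions :: "('a \<Rightarrow> 'a) \<Rightarrow> nat" where
  "inversions w = card {\<alpha>\<in>Pos. w \<alpha> \<notin> Pos}"

text \<open>The reflection carries the inversions of \<open>w\<close> bijectively onto those of the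
  product other than \<open>\<alpha>\<close>, and \<open>\<alpha>\<close> itself becomes an
  inversion.\<close>

lemma inversions_step:
  assumes w: "w \<in> W" and \<alpha>: "\<alpha> \<in> D" and pos: "w \<alpha> \<in> Pos"
  shows "inversions (w \<circ> reflection \<alpha>) = Suc (inversions w)"
proof -
  have \<alpha>0: "reflection \<alpha> \<alpha> = - \<alpha>" by simp
  have \<alpha>P: "\<alpha> \<in> Pos" "- \<alpha> \<notin> Pos" using simple_pos[OF \<alpha>] pos_not_neg by auto
  have "{\<beta>\<in>Pos. w (reflection \<alpha> \<beta>) \<notin> Pos} = insert \<alpha> (reflection \<alpha> ` {\<beta>\<in>Pos. w \<beta> \<notin> Pos})"
  proof (intro equalityI subsetI)
    fix \<beta> assume \<beta>: "\<beta> \<in> {\<beta>\<in>Pos. w (reflection \<alpha> \<beta>) \<notin> Pos}"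
    show "\<beta> \<in> insert \<alpha> (reflection \<alpha> ` {\<beta>\<in>Pos. w \<beta> \<notin> Pos})"
    proof (cases "\<beta> = \<alpha>")
      case False
      then have "reflection \<alpha> \<beta> \<in> {\<beta>\<in>Pos. w \<beta> \<notin> Pos}" using simple_perm[OF \<alpha>] \<beta> by auto
      then have "reflection \<alpha> (reflection \<alpha> \<beta>) \<in> reflection \<alpha> ` {\<beta>\<in>Pos. w \<beta> \<notin> Pos}" by (rule imageI)
      then show ?thesis by simp
    qed simp
  next
    fix \<beta> assume \<beta>: "\<beta> \<in> insert \<alpha> (reflection \<alpha> ` {\<beta>\<in>Pos. w \<beta> \<notin> Pos})"
    show "\<beta> \<in> {\<beta>\<in>Pos. w (reflection \<alpha> \<beta>) \<notin> Pos}"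
    proof (cases "\<beta> = \<alpha>")
      case True
      have "w (- \<alpha>) \<notin> Pos" using pos pos_not_neg weyl_neg[OF w] by auto
      then show ?thesis using True \<alpha>P \<alpha>0 by simp
    next
      case False
      then obtain \<gamma> where \<gamma>: "\<gamma> \<in> Pos" "w \<gamma> \<notin> Pos" "\<beta> = reflection \<alpha> \<gamma>" using \<beta> by auto
      then have "\<gamma> \<noteq> \<alpha>" using pos by auto
      then show ?thesis using \<gamma> simple_perm[OF \<alpha> \<gamma>(1)] by simp
    qed
  qed
  moreover have "\<alpha> \<notin> reflection \<alpha> ` {\<beta>\<in>Pos. w \<beta> \<notin> Pos}"
  proof
    assume "\<alpha> \<in> reflection \<alpha> ` {\<beta>\<in>Pos. w \<beta> \<notin> Pos}"
    then obtain \<beta> where "\<beta> \<in> Pos" "\<alpha> = reflection \<alpha> \<beta>" by auto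
    then have "\<beta> = - \<alpha>" using reflection_reflection[of \<alpha> \<beta>] \<alpha>0 by metis
    then show False using \<open>\<beta> \<in> Pos\<close> \<alpha>P by simp
  qed
  moreover have "card (reflection \<alpha> ` {\<beta>\<in>Pos. w \<beta> \<notin> Pos}) = card {\<beta>\<in>Pos. w \<beta> \<notin> Pos}"
    by (intro card_image inj_on_inverseI[of _ "reflection \<alpha>"]) simp
  moreover have "finite (reflection \<alpha> ` {\<beta>\<in>Pos. w \<beta> \<notin> Pos})" using finite_Pos by simp
  ultimately show ?thesis by (simp add: inversions_def)
qed

lemma inversions_step':
  assumes w: "w \<in> W" and \<alpha>: "\<alpha> \<in> D" and neg: "w \<alpha> \<notin> Pos"
  shows "inversions w = Suc (inversions (w \<circ> reflection \<alpha>))"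
proof -
  have "w \<circ> reflection \<alpha> \<in> W" using w weyl_refl[OF simple_root[OF \<alpha>]] by (rule weyl_comp)
  moreover have "(w \<circ> reflection \<alpha>) \<alpha> \<in> Pos"
    using neg_pos_iff[OF weyl_root[OF w simple_root[OF \<alpha>]]] neg by (simp add: weyl_neg[OF w])
  ultimately have "inversions (w \<circ> reflection \<alpha> \<circ> reflection \<alpha>) = Suc (inversions (w \<circ> reflection \<alpha>))"
    by (rule inversions_step[OF _ \<alpha>])
  then show ?thesis by (simp add: comp_assoc)
qed

text \<open>When \<open>\<alpha>\<close> is transported through the word from the right, it turns
  negative at some letter, and there it equals the root of this letter. Deleting that letter has the
  effect of multiplying by the reflection in \<open>\<alpha>\<close>.\<close>

lemma exchange:
  assumes "set xs \<subseteq> D" "\<alpha> \<in> D" "rprod xs \<alpha> \<notin> Pos"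
  shows "\<exists>ys. set ys \<subseteq> set xs \<and> Suc (length ys) = length xs \<and> rprod ys = rprod xs \<circ> reflection \<alpha>"
  using assms
proof (induction xs)
  case Nil
  then show ?case using simple_pos by simp
next
  case (Cons \<beta> xs)
  let ?u = "rprod xs"
  have u: "?u \<in> W" using Cons simple_root by (intro weyl_rprod) auto
  show ?case
  proof (cases "?u \<alpha> \<in> Pos")
    case False
    have "set xs \<subseteq> D" using Cons.prems by simp
    from Cons.IH[OF this Cons.prems(2) False] obtain ys
      where "set ys \<subseteq> set xs" "Suc (length ys) = length xs" "rprod ys = ?u \<circ> reflection \<alpha>"
      by blast
    then show ?thesis by (intro exI[of _ "\<beta> # ys"]) (auto simp: o_def)
  next
    case True
    then have "?u \<alpha> = \<beta>" using simple_perm[of \<beta> "?u \<alpha>"] Cons.prems by auto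
    then have "reflection \<beta> \<circ> ?u = ?u \<circ> reflection \<alpha>"
      using conj_reflection[OF linear_rprod inner_rprod, of xs \<alpha>] by (auto simp: fun_eq_iff)
    then have "rprod (\<beta> # xs) \<circ> reflection \<alpha> = ?u" by (simp add: fun_eq_iff)
    then show ?thesis by (intro exI[of _ xs]) (auto simp del: rprod_simps)
  qed
qed

lemma inversions_le: "set xs \<subseteq> D \<Longrightarrow> inversions (rprod xs) \<le> length xs"
proof (induction xs rule: rev_induct)
  case Nil
  have "{\<alpha> \<in> Pos. id \<alpha> \<notin> Pos} = {}" by auto
  then show ?case by (simp add: inversions_def)
next
  case (snoc \<alpha> xs)
  have u: "rprod xs \<in> W" using snoc simple_root by (intro weyl_rprod) auto
  have \<alpha>: "\<alpha> \<in> D" using snoc by simp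
  show ?case
    using snoc inversions_step[OF u \<alpha>] inversions_step'[OF u \<alpha>]
    by (cases "rprod xs \<alpha> \<in> Pos") (auto simp: rprod_append o_def)
qed

text \<open>The exchange step only deletes letters, so the shortened word stays in \<open>J\<close>.
  Hence \<open>inversions\<close> computes the length in the parabolic subgroup of \<open>J\<close>
  as well as in \<open>W\<close>.\<close>

lemma reduced_word:
  assumes "J \<subseteq> D" "set xs \<subseteq> J"
  shows "\<exists>ys. set ys \<subseteq> J \<and> rprod ys = rprod xs \<and> length ys = inversions (rprod xs)"
  using assms(2)
proof (induction xs rule: rev_induct)
  case Nil
  have "inversions (rprod []) = 0" using inversions_le[of "[]"] by simp
  then show ?case by (intro exI[of _ "[]"]) (simp only: list.size list.set empty_subsetI)
next
  case (snoc \<alpha> xs)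
  have u: "rprod xs \<in> W" using snoc simple_root assms by (intro weyl_rprod) auto
  have \<alpha>: "\<alpha> \<in> D" using snoc assms by auto
  obtain ys where ys: "set ys \<subseteq> J" "rprod ys = rprod xs" "length ys = inversions (rprod xs)"
    using snoc by auto
  show ?case
  proof (cases "rprod xs \<alpha> \<in> Pos")
    case True
    then show ?thesis
      using ys snoc.prems inversions_step[OF u \<alpha>]
      by (intro exI[of _ "ys @ [\<alpha>]"]) (auto simp: rprod_append o_def)
  next
    case False
    then obtain zs where zs: "set zs \<subseteq> set ys" "Suc (length zs) = length ys" "rprod zs = rprod ys \<circ> reflection \<alpha>"
      using exchange[of ys \<alpha>] ys assms(1) \<alpha> by auto
    then show ?thesis
      using ys inversions_step'[OF u \<alpha> False] by (intro exI[of _ zs]) (auto simp: rprod_append o_def)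
  qed
qed

lemma least_length:
  assumes J: "J \<subseteq> D" and xs: "set xs \<subseteq> J"
  shows "(LEAST k. \<exists>ys. set ys \<subseteq> J \<and> length ys = k \<and> rprod ys = rprod xs) = inversions (rprod xs)"
proof (rule Least_equality)
  show "\<exists>ys. set ys \<subseteq> J \<and> length ys = inversions (rprod xs) \<and> rprod ys = rprod xs"
    using reduced_word[OF J xs] by blast
  fix k assume "\<exists>ys. set ys \<subseteq> J \<and> length ys = k \<and> rprod ys = rprod xs"
  then show "inversions (rprod xs) \<le> k" using inversions_le J by (metis order.trans)
qed

text \<open>As \<open>\<beta>\<close> is a nonnegative combination of simple roots and has positive
  norm, it pairs positively with some simple root. Reflecting in that root lowers its pairing with
  \<open>v\<close>.\<close>

lemma pos_conj_simple:
  assumes "\<beta> \<in> Pos"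
  shows "\<exists>xs \<alpha>. set xs \<subseteq> D \<and> \<alpha> \<in> D \<and> \<beta> = rprod xs \<alpha>"
  using assms
proof (induction "card {\<gamma>\<in>Pos. inner \<gamma> v < inner \<beta> v}" arbitrary: \<beta> rule: less_induct)
  case (less \<beta>)
  show ?case
  proof (cases "\<beta> \<in> D")
    case True
    then show ?thesis by (intro exI[of _ "[]"] exI[of _ \<beta>]) simp
  next
    case False
    obtain n :: "'a \<Rightarrow> nat" where n: "\<beta> = (\<Sum>\<delta>\<in>D. real (n \<delta>) *\<^sub>R \<delta>)" using pos_comb less by blast
    have "\<exists>\<alpha>\<in>D. inner \<beta> \<alpha> > 0"
    proof (rule ccontr)
      assume "\<not> ?thesis"
      then have "(\<Sum>\<delta>\<in>D. real (n \<delta>) * inner \<beta> \<delta>) \<le> 0"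
        by (intro sum_nonpos mult_nonneg_nonpos) (auto simp: not_less)
      moreover have "inner \<beta> \<beta> = (\<Sum>\<delta>\<in>D. real (n \<delta>) * inner \<beta> \<delta>)"
        using arg_cong[OF n, of "inner \<beta>"] by (simp add: inner_sum_right)
      ultimately show False using nonzero[OF pos_root[OF less.prems]] by (metis inner_gt_zero_iff not_less)
    qed
    then obtain \<alpha> where \<alpha>: "\<alpha> \<in> D" "inner \<beta> \<alpha> > 0" by blast
    define \<gamma> where "\<gamma> = reflection \<alpha> \<beta>"
    have \<gamma>: "\<gamma> \<in> Pos" unfolding \<gamma>_def using simple_perm \<alpha> less.prems False by auto
    have "inner \<beta> (coroot \<alpha>) > 0"
      using \<alpha> nonzero[OF simple_root[OF \<alpha>(1)]] by (simp add: inner_coroot)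
    then have "inner \<gamma> v < inner \<beta> v"
      using pos_v[OF simple_pos[OF \<alpha>(1)]] by (simp add: \<gamma>_def reflection_def inner_diff_left)
    then have "card {\<delta>\<in>Pos. inner \<delta> v < inner \<gamma> v} < card {\<delta>\<in>Pos. inner \<delta> v < inner \<beta> v}"
      using \<gamma> finite_Pos by (intro psubset_card_mono) auto
    from less.hyps[OF this \<gamma>] obtain xs \<alpha>' where "set xs \<subseteq> D" "\<alpha>' \<in> D" "\<gamma> = rprod xs \<alpha>'" by blast
    moreover have "\<beta> = reflection \<alpha> \<gamma>" by (simp add: \<gamma>_def)
    ultimately show ?thesis using \<alpha> by (intro exI[of _ "\<alpha> # xs"] exI[of _ \<alpha>']) auto
  qed
qed

text \<open>Each positive root is the image of a simple root under a word in simple reflections, so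
  its reflection is a conjugate of a simple one.\<close>

lemma weyl_simple_words: "W = rprod ` lists D"
proof
  show "rprod ` lists D \<subseteq> W" using simple_root by (auto intro!: weyl_rprod)
  have refl: "reflection \<beta> \<in> rprod ` lists D" if \<beta>: "\<beta> \<in> R" for \<beta>
  proof -
    have *: "reflection \<beta> \<in> rprod ` lists D" if pos: "\<beta> \<in> Pos" for \<beta>
    proof -
      obtain xs \<alpha> where xs: "set xs \<subseteq> D" "\<alpha> \<in> D" "\<beta> = rprod xs \<alpha>"
        using pos_conj_simple[OF pos] by blast
      have "reflection \<beta> \<circ> rprod xs = rprod xs \<circ> reflection \<alpha>"
        unfolding xs(3) using conj_reflection[OF linear_rprod inner_rprod, of xs \<alpha>] by (auto simp: fun_eq_iff)
      then have "reflection \<beta> = rprod xs \<circ> reflection \<alpha> \<circ> rprod (rev xs)"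
        by (metis comp_assoc comp_id rprod_rev(2))
      then have "reflection \<beta> = rprod (xs @ [\<alpha>] @ rev xs)" by (simp add: rprod_append comp_assoc)
      then show ?thesis using xs by (intro image_eqI[of _ _ "xs @ [\<alpha>] @ rev xs"]) auto
    qed
    show ?thesis using *[of \<beta>] *[of "- \<beta>"] neg_pos_iff[OF \<beta>] by (auto simp: reflection_minus)
  qed
  show "W \<subseteq> rprod ` lists D"
  proof
    fix w assume "w \<in> W"
    then obtain xs where "xs \<in> lists R" "w = rprod xs" by (auto simp: weyl_group_eq)
    then show "w \<in> rprod ` lists D"
    proof (induction xs arbitrary: w)
      case Nil
      then show ?case by (intro image_eqI[of _ _ "[]"]) auto
    next
      case (Cons \<alpha> xs)
      then obtain ys zs where "ys \<in> lists D" "zs \<in> lists D" "reflection \<alpha> = rprod ys" "rprod xs = rprod zs"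
        using refl[of \<alpha>] by auto
      then show ?case using Cons by (intro image_eqI[of _ _ "ys @ zs"]) (auto simp: rprod_append)
    qed
  qed
qed

lemma inversions_zero:
  assumes w: "w \<in> W" and z: "\<And>\<alpha>. \<alpha> \<in> Pos \<Longrightarrow> w \<alpha> \<in> Pos"
  shows "w = id"
proof -
  obtain xs where xs: "set xs \<subseteq> D" "w = rprod xs" using w by (auto simp: weyl_simple_words)
  have "{\<alpha> \<in> Pos. w \<alpha> \<notin> Pos} = {}" using z by auto
  then have "inversions w = 0" unfolding inversions_def by (simp only: card.empty)
  then show ?thesis using reduced_word[OF order.refl xs(1)] xs by auto
qed

section \<open>Longest elements of parabolic subgroups\<close>

definition longest :: "'a set \<Rightarrow> ('a \<Rightarrow> 'a) \<Rightarrow> bool" where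
  "longest J w \<longleftrightarrow> w \<in> rprod ` lists J \<and> (\<forall>\<alpha>\<in>J. w \<alpha> \<notin> Pos)"

lemma parabolic_weyl: "J \<subseteq> D \<Longrightarrow> w \<in> rprod ` lists J \<Longrightarrow> w \<in> W"
  using simple_root by (auto intro!: weyl_rprod)

lemma parabolic_weight:
  assumes "J \<subseteq> D" "w \<in> rprod ` lists J" "\<beta> \<in> D - J"
  shows "inner (\<omega> \<beta>) (w x) = inner (\<omega> \<beta>) x"
proof -
  have "inner (\<omega> \<beta>) (rprod xs x) = inner (\<omega> \<beta>) x" if "set xs \<subseteq> J" for xs
    using that
  proof (induction xs)
    case (Cons \<alpha> xs)
    then have "\<alpha> \<in> D" "\<alpha> \<noteq> \<beta>" using assms by auto
    then show ?case using Cons assms weight_refl[of \<alpha> \<beta>] by auto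
  qed simp
  then show ?thesis using assms(2) by auto
qed

text \<open>If some root of \<open>J\<close> stayed positive, composing with its reflection would
  add an inversion. The sign condition in \<open>longest\<close> is the form in which maximality is
  used.\<close>

lemma longest_if_max:
  assumes J: "J \<subseteq> D" and w: "w \<in> rprod ` lists J"
    and max: "\<And>u. u \<in> rprod ` lists J \<Longrightarrow> inversions u \<le> inversions w"
  shows "longest J w"
  unfolding longest_def
proof (intro conjI ballI notI w)
  fix \<alpha> assume \<alpha>: "\<alpha> \<in> J" "w \<alpha> \<in> Pos"
  obtain xs where xs: "set xs \<subseteq> J" "w = rprod xs" using w by auto
  have "w \<circ> reflection \<alpha> \<in> rprod ` lists J"
    using xs \<alpha> by (intro image_eqI[of _ _ "xs @ [\<alpha>]"]) (auto simp: rprod_append)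
  from max[OF this] show False
    using inversions_step[OF parabolic_weyl[OF J w] _ \<alpha>(2)] \<alpha>(1) J by auto
qed

text \<open>Inversions are subsets of \<open>Pos\<close>, so their number is bounded and a maximum
  is attained.\<close>

lemma longest_exists:
  assumes J: "J \<subseteq> D"
  obtains w where "longest J w" "\<And>u. u \<in> rprod ` lists J \<Longrightarrow> inversions u \<le> inversions w"
proof -
  have "inversions u < Suc (card Pos)" for u
    unfolding inversions_def using finite_Pos by (auto intro!: card_mono simp: less_Suc_eq_le)
  moreover have "id \<in> rprod ` lists J" by (intro image_eqI[of _ _ "[]"]) auto
  ultimately obtain w where "w \<in> rprod ` lists J"
    "\<forall>u. u \<in> rprod ` lists J \<longrightarrow> inversions u \<le> inversions w"
    using ex_has_greatest_nat[of "\<lambda>w. w \<in> rprod ` lists J" id inversions "Suc (card Pos)"] by (metis less_imp_le)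
  then show ?thesis using that longest_if_max[OF J] by blast
qed

text \<open>The coordinates outside \<open>J\<close> are preserved, and if one is positive the image
  is positive. If they all vanish, the root is a nonnegative combination of coroots from
  \<open>J\<close>, each of which is sent to a negative multiple of a positive root.\<close>

lemma longest_pos:
  assumes J: "J \<subseteq> D" and w: "longest J w" and \<alpha>: "\<alpha> \<in> Pos"
  shows "w \<alpha> \<in> Pos \<longleftrightarrow> (\<exists>\<beta>\<in>D - J. inner (\<omega> \<beta>) \<alpha> \<noteq> 0)"
proof
  have wW: "w \<in> W" "w \<in> rprod ` lists J" using w parabolic_weyl[OF J] by (auto simp: longest_def)
  assume "\<exists>\<beta>\<in>D - J. inner (\<omega> \<beta>) \<alpha> \<noteq> 0"
  then obtain \<beta> where \<beta>: "\<beta> \<in> D - J" "inner (\<omega> \<beta>) \<alpha> \<noteq> 0" by blast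
  then have "inner (\<omega> \<beta>) (w \<alpha>) > 0"
    using parabolic_weight[OF J wW(2) \<beta>(1)] weight_nonneg[OF \<alpha>, of \<beta>] by auto
  then show "w \<alpha> \<in> Pos" using pos_if_weight weyl_root[OF wW(1) pos_root[OF \<alpha>]] \<beta> by blast
next
  have wW: "w \<in> W" "w \<in> rprod ` lists J" using w parabolic_weyl[OF J] by (auto simp: longest_def)
  assume pos: "w \<alpha> \<in> Pos"
  show "\<exists>\<beta>\<in>D - J. inner (\<omega> \<beta>) \<alpha> \<noteq> 0"
  proof (rule ccontr)
    assume "\<not> ?thesis"
    then have z: "inner (\<omega> \<beta>) \<alpha> = 0" if "\<beta> \<in> D - J" for \<beta> using that by blast
    have "\<alpha> = (\<Sum>\<beta>\<in>J. inner (\<omega> \<beta>) \<alpha> *\<^sub>R coroot \<beta>)"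
    proof -
      have "(\<Sum>\<beta>\<in>D. inner (\<omega> \<beta>) \<alpha> *\<^sub>R coroot \<beta>) = (\<Sum>\<beta>\<in>J. inner (\<omega> \<beta>) \<alpha> *\<^sub>R coroot \<beta>)"
        using J finite_D z by (intro sum.mono_neutral_right) auto
      then show ?thesis using coroot_expansion[of \<alpha>] by simp
    qed
    then have "w \<alpha> = (\<Sum>\<beta>\<in>J. inner (\<omega> \<beta>) \<alpha> *\<^sub>R w (coroot \<beta>))"
      using weyl_linear[OF wW(1)] by (metis (no_types, lifting) linear_scale linear_sum sum.cong)
    then have "inner (w \<alpha>) v = (\<Sum>\<beta>\<in>J. inner (\<omega> \<beta>) \<alpha> * inner (w (coroot \<beta>)) v)"
      by (simp add: inner_sum_left)
    also have "\<dots> \<le> 0"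
    proof (intro sum_nonpos mult_nonneg_nonpos)
      fix \<beta> assume \<beta>: "\<beta> \<in> J"
      show "inner (\<omega> \<beta>) \<alpha> \<ge> 0" using weight_nonneg[OF \<alpha>] \<beta> J by blast
      have r: "w \<beta> \<in> R" using weyl_root[OF wW(1)] simple_root \<beta> J by blast
      have "w \<beta> \<notin> Pos" using w \<beta> by (auto simp: longest_def)
      then have "inner (w \<beta>) v \<le> 0" using pos_iff[OF r] by auto
      moreover obtain c where "c > 0" "coroot (w \<beta>) = c *\<^sub>R w \<beta>" using coroot_pos_scale[OF r] by blast
      ultimately show "inner (w (coroot \<beta>)) v \<le> 0"
        by (simp add: weyl_coroot[OF wW(1), symmetric] mult_nonneg_nonpos)
    qed
    finally show False using pos_v[OF pos] by simp
  qed
qed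

text \<open>Both elements reverse the sign of exactly those roots that have no coordinate outside
  \<open>J\<close>. The composition keeps all positive roots positive and is therefore the
  identity.\<close>

lemma longest_comp:
  assumes J: "J \<subseteq> D" and w: "longest J w" and u: "longest J u"
  shows "w \<circ> u = id"
proof (rule inversions_zero)
  have wW: "w \<in> W" "w \<in> rprod ` lists J" using w parabolic_weyl[OF J] by (auto simp: longest_def)
  have uW: "u \<in> W" "u \<in> rprod ` lists J" using u parabolic_weyl[OF J] by (auto simp: longest_def)
  show "w \<circ> u \<in> W" using wW uW by (intro weyl_comp)
  fix \<alpha> assume \<alpha>: "\<alpha> \<in> Pos"
  have r: "u \<alpha> \<in> R" using weyl_root[OF uW(1) pos_root[OF \<alpha>]] .
  show "(w \<circ> u) \<alpha> \<in> Pos"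
  proof (cases "u \<alpha> \<in> Pos")
    case True
    then show ?thesis
      using longest_pos[OF J u \<alpha>] longest_pos[OF J w True] parabolic_weight[OF J uW(2)] by auto
  next
    case False
    then have n: "- u \<alpha> \<in> Pos" using neg_pos_iff[OF r] by simp
    have "w (- u \<alpha>) \<notin> Pos"
      using longest_pos[OF J u \<alpha>] longest_pos[OF J w n] parabolic_weight[OF J uW(2)] False by auto
    then show ?thesis
      using neg_pos_iff[OF weyl_root[OF wW(1) r]] by (simp add: weyl_neg[OF wW(1)])
  qed
qed

lemma longest_unique:
  assumes J: "J \<subseteq> D" and w: "longest J w" and u: "longest J u"
  shows "w = u"
proof -
  have "u = w \<circ> w \<circ> u" by (simp add: longest_comp[OF J w w])
  also have "\<dots> = w" by (simp add: comp_assoc longest_comp[OF J w u])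
  finally show ?thesis by simp
qed

text \<open>If \<open>- w \<beta>\<close> were a sum of two positive roots, neither would have a
  coordinate outside \<open>J\<close>. Applying the involution \<open>w\<close> and changing signs
  would then split the simple root \<open>\<beta>\<close>.\<close>

lemma longest_simple:
  assumes J: "J \<subseteq> D" and w: "longest J w" and \<beta>: "\<beta> \<in> J"
  shows "- w \<beta> \<in> D"
proof -
  have wW: "w \<in> W" "w \<in> rprod ` lists J" using w parabolic_weyl[OF J] by (auto simp: longest_def)
  have ww: "w (w x) = x" for x using longest_comp[OF J w w] by (metis comp_apply id_apply)
  have \<beta>D: "\<beta> \<in> D" using \<beta> J by auto
  have r: "w \<beta> \<in> R" using weyl_root[OF wW(1) simple_root[OF \<beta>D]] .
  have "w \<beta> \<notin> Pos" using w \<beta> by (auto simp: longest_def)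
  then have n: "- w \<beta> \<in> Pos" using neg_pos_iff[OF r] by simp
  have False if bg: "\<gamma> \<in> Pos" "\<delta> \<in> Pos" "- w \<beta> = \<gamma> + \<delta>" for \<gamma> \<delta>
  proof -
    have neg: "- w \<gamma>' \<in> Pos" if "\<gamma>' \<in> Pos" "\<delta>' \<in> Pos" "- w \<beta> = \<gamma>' + \<delta>'" for \<gamma>' \<delta>'
    proof -
      have "inner (\<omega> \<epsilon>) \<gamma>' = 0" if \<epsilon>: "\<epsilon> \<in> D - J" for \<epsilon>
      proof -
        have "inner (\<omega> \<epsilon>) (w \<beta>) = 0"
          using parabolic_weight[OF J wW(2) \<epsilon>] weight_simple[OF \<beta>D, of \<epsilon>] \<epsilon> \<beta> by auto
        then have "inner (\<omega> \<epsilon>) \<gamma>' + inner (\<omega> \<epsilon>) \<delta>' = 0"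
          using arg_cong[OF \<open>- w \<beta> = \<gamma>' + \<delta>'\<close>, of "inner (\<omega> \<epsilon>)"] by (simp add: inner_add_right)
        then show ?thesis
          using weight_nonneg[OF \<open>\<gamma>' \<in> Pos\<close>, of \<epsilon>] weight_nonneg[OF \<open>\<delta>' \<in> Pos\<close>, of \<epsilon>] \<epsilon> by auto
      qed
      then have "w \<gamma>' \<notin> Pos" using longest_pos[OF J w \<open>\<gamma>' \<in> Pos\<close>] by blast
      then show ?thesis using neg_pos_iff[OF weyl_root[OF wW(1) pos_root[OF \<open>\<gamma>' \<in> Pos\<close>]]] by simp
    qed
    have "- w \<gamma> \<in> Pos" using neg[OF bg] .
    moreover have "- w \<delta> \<in> Pos" using neg[of \<delta> \<gamma>] bg by (simp add: add.commute)
    moreover have "\<beta> = - w \<gamma> + - w \<delta>"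
    proof -
      have "w (- w \<beta>) = w \<gamma> + w \<delta>" unfolding bg(3) by (rule linear_add[OF weyl_linear[OF wW(1)]])
      then have "- \<beta> = w \<gamma> + w \<delta>" by (simp add: weyl_neg[OF wW(1)] ww)
      then show ?thesis by (metis minus_add_distrib minus_minus)
    qed
    ultimately show False using \<beta>D unfolding simple_roots_def by blast
  qed
  then show ?thesis using n unfolding simple_roots_def by blast
qed

end

section \<open>Highest roots and lattices\<close>

locale irr_root_data = root_data +
  assumes irr: "irreducible_roots R"
begin

text \<open>Passing to coroots rescales vectors and preserves orthogonality, so a splitting of the
  coroots would split the roots.\<close>

lemma irr_dual: "irr_root_data (coroot ` R) (coroot ` Pos)"
proof (intro irr_root_data.intro dual irr_root_data_axioms.intro)
  show "irreducible_roots (coroot ` R)"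
    unfolding irreducible_roots_def
  proof (intro conjI notI)
    assume "coroot ` R = {}"
    then show False using irr by (auto simp: irreducible_roots_def)
  next
    assume "\<exists>A B. A \<noteq> {} \<and> B \<noteq> {} \<and> A \<inter> B = {} \<and> coroot ` R = A \<union> B \<and> (\<forall>\<alpha>\<in>A. \<forall>\<beta>\<in>B. inner \<alpha> \<beta> = 0)"
    then obtain A B where "A \<noteq> {} \<and> B \<noteq> {} \<and> A \<inter> B = {} \<and> coroot ` R = A \<union> B
      \<and> (\<forall>\<alpha>\<in>A. \<forall>\<beta>\<in>B. inner \<alpha> \<beta> = 0)"
      by (elim exE)
    then have AB: "A \<noteq> {}" "B \<noteq> {}" "A \<inter> B = {}" "coroot ` R = A \<union> B"
      "\<forall>\<alpha>\<in>A. \<forall>\<beta>\<in>B. inner \<alpha> \<beta> = 0"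
      by simp_all
    define A' where "A' = {\<alpha>\<in>R. coroot \<alpha> \<in> A}"
    define B' where "B' = {\<alpha>\<in>R. coroot \<alpha> \<in> B}"
    have "A \<subseteq> coroot ` R" "B \<subseteq> coroot ` R" using AB(4) by simp_all
    then have "A' \<noteq> {}" "B' \<noteq> {}" using AB(1,2) unfolding A'_def B'_def by blast+
    moreover have "A' \<inter> B' = {}" using AB(3) unfolding A'_def B'_def by blast
    moreover have "R = A' \<union> B'"
    proof -
      have "coroot \<alpha> \<in> A \<union> B" if "\<alpha> \<in> R" for \<alpha> using that unfolding AB(4)[symmetric] by simp
      then show ?thesis unfolding A'_def B'_def by blast
    qed
    moreover have "inner \<alpha> \<beta> = 0" if "\<alpha> \<in> A'" "\<beta> \<in> B'" for \<alpha> \<beta>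
    proof -
      have "inner (coroot \<alpha>) (coroot \<beta>) = 0" "\<alpha> \<noteq> 0" "\<beta> \<noteq> 0"
        using AB(5) that nonzero by (simp_all add: A'_def B'_def)
      then show ?thesis unfolding coroot_def by simp
    qed
    ultimately have "\<exists>A B. A \<noteq> {} \<and> B \<noteq> {} \<and> A \<inter> B = {} \<and> R = A \<union> B \<and> (\<forall>\<alpha>\<in>A. \<forall>\<beta>\<in>B. inner \<alpha> \<beta> = 0)"
      by (intro exI[of _ A'] exI[of _ B'] conjI ballI)
    then show False using irr unfolding irreducible_roots_def by simp
  qed
qed

text \<open>Connectedness of the Dynkin diagram. Every root is the image of a simple root under the
  Weyl group, so two orthogonal groups of simple roots would split all roots.\<close>

lemma simple_connected:
  assumes I: "I \<subseteq> D" "I \<noteq> {}" and orth: "\<And>i j. i \<in> I \<Longrightarrow> j \<in> D - I \<Longrightarrow> inner i j = 0"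
  shows "I = D"
proof (rule ccontr)
  assume "I \<noteq> D"
  define A where "A = R \<inter> span I"
  define B where "B = R \<inter> span (D - I)"
  have spans: "inner x y = 0" if x: "x \<in> span I" and y: "y \<in> span (D - I)" for x y
  proof (rule inner_span_zero[OF y])
    fix j assume "j \<in> D - I"
    then have "inner j x = 0" using inner_span_zero[OF x, of j] orth by (metis inner_commute)
    then show "inner x j = 0" by (simp add: inner_commute)
  qed
  obtain i0 j0 where "i0 \<in> I" "j0 \<in> D - I" using I \<open>I \<noteq> D\<close> by auto
  then have "i0 \<in> A" "j0 \<in> B"
    unfolding A_def B_def using I simple_root by (auto intro: span_base)
  then have ne: "A \<noteq> {}" "B \<noteq> {}" by auto
  have dis: "A \<inter> B = {}"
  proof -
    have "x = 0" if "x \<in> span I" "x \<in> span (D - I)" for x using spans[OF that] by simp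
    then have "x \<notin> B" if "x \<in> A" for x using that nonzero[of x] unfolding A_def B_def by auto
    then show ?thesis by auto
  qed
  \<comment> \<open>Both spans are stable under simple reflections: such a root lies in the span or
    is orthogonal to it.\<close>
  have inv: "rprod xs x \<in> S" if "set xs \<subseteq> D" "x \<in> S" "S = span I \<or> S = span (D - I)" for xs x S
    using that
  proof (induction xs)
    case (Cons j xs)
    let ?x = "rprod xs x"
    have x: "?x \<in> S" and j: "j \<in> D" using Cons by auto
    have sub: "subspace S" using Cons.prems by auto
    show ?case
    proof (cases "j \<in> S")
      case True
      then show ?thesis using x sub by (simp add: reflection_def subspace_diff subspace_scale)
    next
      case False
      have "inner ?x j = 0"
      proof (cases "j \<in> I")
        case True
        then have "j \<in> span I" by (rule span_base)
        then have "S = span (D - I)" using Cons.prems(3) False by auto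
        then show ?thesis using spans[OF \<open>j \<in> span I\<close>, of ?x] x by (metis inner_commute)
      next
        case jI: False
        then have "j \<in> span (D - I)" using j by (intro span_base) simp
        then have "S = span I" using Cons.prems(3) False by auto
        then show ?thesis using spans[OF _ \<open>j \<in> span (D - I)\<close>] x by simp
      qed
      then show ?thesis using x by (simp add: reflection_def inner_coroot)
    qed
  qed simp
  have "\<beta> \<in> span I \<union> span (D - I)" if p: "\<beta> \<in> Pos" for \<beta>
  proof -
    obtain xs \<alpha> where xs: "set xs \<subseteq> D" "\<alpha> \<in> D" "\<beta> = rprod xs \<alpha>" using pos_conj_simple[OF p] by blast
    then have "\<alpha> \<in> span I \<or> \<alpha> \<in> span (D - I)" by (cases "\<alpha> \<in> I") (auto intro: span_base)
    then show ?thesis using inv[OF xs(1), of \<alpha>] xs(3) by auto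
  qed
  then have "\<beta> \<in> span I \<union> span (D - I)" if "\<beta> \<in> R" for \<beta>
    using neg_pos_iff[OF that] \<open>\<And>\<beta>. \<beta> \<in> Pos \<Longrightarrow> \<beta> \<in> span I \<union> span (D - I)\<close>[of \<beta>]
      \<open>\<And>\<beta>. \<beta> \<in> Pos \<Longrightarrow> \<beta> \<in> span I \<union> span (D - I)\<close>[of "- \<beta>"] span_neg[of "- \<beta>"]
    by auto
  then have "R = A \<union> B" unfolding A_def B_def by auto
  moreover have "inner \<alpha> \<beta> = 0" if "\<alpha> \<in> A" "\<beta> \<in> B" for \<alpha> \<beta>
    using that spans by (simp add: A_def B_def)
  ultimately have "\<exists>A B. A \<noteq> {} \<and> B \<noteq> {} \<and> A \<inter> B = {} \<and> R = A \<union> B \<and> (\<forall>\<alpha>\<in>A. \<forall>\<beta>\<in>B. inner \<alpha> \<beta> = 0)"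
    using ne dis by (intro exI[of _ A] exI[of _ B] conjI ballI)
  then show False using irr unfolding irreducible_roots_def by simp
qed

section \<open>The highest root\<close>

definition maximal_root :: "'a \<Rightarrow> bool" where
  "maximal_root \<theta> \<longleftrightarrow> \<theta> \<in> Pos \<and> (\<forall>\<gamma>\<in>Pos. \<theta> + \<gamma> \<notin> R)"

text \<open>Adding positive roots as long as the sum is a root must stop, because each addition
  increases the pairing with \<open>v\<close>.\<close>

lemma maximal_above_pos:
  assumes "\<beta> \<in> Pos"
  shows "\<exists>\<theta>. maximal_root \<theta> \<and> (\<exists>m :: 'a \<Rightarrow> nat. \<theta> - \<beta> = (\<Sum>\<gamma>\<in>Pos. real (m \<gamma>) *\<^sub>R \<gamma>))"
  using assms
proof (induction "card {\<gamma>\<in>Pos. inner \<gamma> v > inner \<beta> v}" arbitrary: \<beta> rule: less_induct)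
  case (less \<beta>)
  show ?case
  proof (cases "maximal_root \<beta>")
    case True
    then show ?thesis by (intro exI[of _ \<beta>] conjI exI[of _ "\<lambda>_. 0"]) auto
  next
    case False
    then obtain \<gamma> where \<gamma>: "\<gamma> \<in> Pos" "\<beta> + \<gamma> \<in> R" using less.prems by (auto simp: maximal_root_def)
    have v: "inner (\<beta> + \<gamma>) v > inner \<beta> v" using pos_v[OF \<gamma>(1)] by (simp add: inner_add_left)
    then have p: "\<beta> + \<gamma> \<in> Pos" using pos_iff[OF \<gamma>(2)] pos_v[OF less.prems] by linarith
    have "card {\<delta>\<in>Pos. inner \<delta> v > inner (\<beta> + \<gamma>) v} < card {\<delta>\<in>Pos. inner \<delta> v > inner \<beta> v}"
      using v p finite_Pos by (intro psubset_card_mono) auto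
    from less.hyps[OF this p] obtain \<theta> and m :: "'a \<Rightarrow> nat" where \<theta>: "maximal_root \<theta>"
      and m: "\<theta> - (\<beta> + \<gamma>) = (\<Sum>\<delta>\<in>Pos. real (m \<delta>) *\<^sub>R \<delta>)" by blast
    have "(\<Sum>\<delta>\<in>Pos. real (m \<delta> + (if \<delta> = \<gamma> then 1 else 0)) *\<^sub>R \<delta>)
        = (\<Sum>\<delta>\<in>Pos. real (m \<delta>) *\<^sub>R \<delta>) + (\<Sum>\<delta>\<in>Pos. if \<delta> = \<gamma> then \<delta> else 0)"
      unfolding sum.distrib[symmetric] by (rule sum.cong) (auto simp: scaleR_left_distrib)
    also have "\<dots> = \<theta> - \<beta>" using \<gamma> finite_Pos by (simp add: m[symmetric])
    finally show ?thesis
      using \<theta> by (intro exI[of _ \<theta>] conjI exI[of _ "\<lambda>\<delta>. m \<delta> + (if \<delta> = \<gamma> then 1 else 0)"]) auto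
  qed
qed

lemma maximal_above:
  assumes "\<beta> \<in> R"
  shows "\<exists>\<theta>. maximal_root \<theta> \<and> (\<exists>m :: 'a \<Rightarrow> nat. \<theta> - \<beta> = (\<Sum>\<gamma>\<in>Pos. real (m \<gamma>) *\<^sub>R \<gamma>))"
proof (cases "\<beta> \<in> Pos")
  case False
  then have p: "- \<beta> \<in> Pos" using neg_pos_iff[OF assms] by simp
  then obtain \<theta> and m :: "'a \<Rightarrow> nat" where \<theta>: "maximal_root \<theta>"
    and m: "\<theta> - (- \<beta>) = (\<Sum>\<delta>\<in>Pos. real (m \<delta>) *\<^sub>R \<delta>)"
    using maximal_above_pos by blast
  \<comment> \<open>The 2 comes from passing from \<open>- \<beta>\<close> to
    \<open>\<beta>\<close>: the two differ by twice the positive root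
    \<open>- \<beta>\<close>.\<close>
  have "(\<Sum>\<delta>\<in>Pos. real (m \<delta> + (if \<delta> = - \<beta> then 2 else 0)) *\<^sub>R \<delta>)
      = (\<Sum>\<delta>\<in>Pos. real (m \<delta>) *\<^sub>R \<delta>) + (\<Sum>\<delta>\<in>Pos. if \<delta> = - \<beta> then 2 *\<^sub>R \<delta> else 0)"
    unfolding sum.distrib[symmetric] by (rule sum.cong) (auto simp: scaleR_left_distrib)
  also have "\<dots> = \<theta> - \<beta>" using p finite_Pos by (simp add: m[symmetric] scaleR_2)
  finally show ?thesis
    using \<theta> by (intro exI[of _ \<theta>] conjI exI[of _ "\<lambda>\<delta>. m \<delta> + (if \<delta> = - \<beta> then 2 else 0)"]) auto
qed (rule maximal_above_pos)

text \<open>A negative pairing with a positive root would make the sum of the two a root.\<close>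

lemma maximal_dominant:
  assumes "maximal_root \<theta>" "\<alpha> \<in> Pos"
  shows "inner \<theta> \<alpha> \<ge> 0"
proof (rule ccontr)
  assume "\<not> ?thesis"
  then have "inner \<theta> (- \<alpha>) > 0" by simp
  moreover have "\<theta> \<in> R" "\<theta> \<noteq> - \<alpha>" "- \<alpha> \<in> R"
    using assms pos_root pos_not_neg by (auto simp: maximal_root_def)
  ultimately have "\<theta> - (- \<alpha>) \<in> R" by (intro root_diff)
  then show False using assms by (auto simp: maximal_root_def)
qed

text \<open>For a simple root outside the support of \<open>\<theta>\<close> the pairing with
  \<open>\<theta>\<close> is nonnegative by dominance, yet it is a sum of nonpositive terms. All
  terms vanish, so the support is orthogonal to its complement and equals \<open>D\<close> by
  connectedness.\<close>

lemma maximal_full_support: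
  assumes \<theta>: "maximal_root \<theta>" and "\<beta> \<in> D"
  shows "inner (\<omega> \<beta>) \<theta> > 0"
proof -
  have \<theta>P: "\<theta> \<in> Pos" using \<theta> by (simp add: maximal_root_def)
  define I where "I = {\<alpha>\<in>D. inner (\<omega> \<alpha>) \<theta> > 0}"
  have z: "inner (\<omega> \<alpha>) \<theta> = 0" if "\<alpha> \<in> D - I" for \<alpha>
    using that weight_nonneg[OF \<theta>P, of \<alpha>] by (auto simp: I_def)
  have "I \<noteq> {}"
  proof
    assume "I = {}"
    then have "\<theta> = 0" using coroot_expansion[of \<theta>] z by simp
    then show False using nonzero[OF pos_root[OF \<theta>P]] by simp
  qed
  moreover have "inner i j = 0" if i: "i \<in> I" and j: "j \<in> D - I" for i j
  proof -
    have "\<theta> = (\<Sum>\<alpha>\<in>I. inner (\<omega> \<alpha>) \<theta> *\<^sub>R coroot \<alpha>)"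
    proof -
      have "(\<Sum>\<alpha>\<in>D. inner (\<omega> \<alpha>) \<theta> *\<^sub>R coroot \<alpha>) = (\<Sum>\<alpha>\<in>I. inner (\<omega> \<alpha>) \<theta> *\<^sub>R coroot \<alpha>)"
        using finite_D z by (intro sum.mono_neutral_right) (auto simp: I_def)
      then show ?thesis using coroot_expansion[of \<theta>] by simp
    qed
    then have "inner \<theta> j = (\<Sum>\<alpha>\<in>I. inner (\<omega> \<alpha>) \<theta> * inner (coroot \<alpha>) j)"
      by (metis (no_types, lifting) inner_scaleR_left inner_sum_left sum.cong)
    moreover have "inner \<theta> j \<ge> 0" using maximal_dominant[OF \<theta>] simple_pos j by blast
    ultimately have ge: "(\<Sum>\<alpha>\<in>I. - (inner (\<omega> \<alpha>) \<theta> * inner (coroot \<alpha>) j)) \<le> 0"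
      by (simp add: sum_negf)
    have le: "inner (coroot \<alpha>) j \<le> 0" if "\<alpha> \<in> I" for \<alpha>
    proof -
      have "inner \<alpha> j \<le> 0" using that j by (intro simple_nonpos) (auto simp: I_def)
      then show ?thesis unfolding coroot_def inner_scaleR_left by (intro mult_nonneg_nonpos) auto
    qed
    have nn: "- (inner (\<omega> \<alpha>) \<theta> * inner (coroot \<alpha>) j) \<ge> 0" if "\<alpha> \<in> I" for \<alpha>
      using le[OF that] that by (auto simp: I_def mult_nonneg_nonpos)
    have "finite I" using finite_D by (simp add: I_def)
    then have "- (inner (\<omega> i) \<theta> * inner (coroot i) j)
        \<le> (\<Sum>\<alpha>\<in>I. - (inner (\<omega> \<alpha>) \<theta> * inner (coroot \<alpha>) j))"
      using nn i by (intro member_le_sum[where f = "\<lambda>\<alpha>. - (inner (\<omega> \<alpha>) \<theta> * inner (coroot \<alpha>) j)"]) auto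
    then have "inner (\<omega> i) \<theta> * inner (coroot i) j = 0"
      using ge nn[OF i] by linarith
    then show ?thesis
      using i nonzero[OF simple_root, of i] by (auto simp: I_def coroot_def)
  qed
  moreover have "I \<subseteq> D" by (simp add: I_def)
  ultimately have "I = D" using simple_connected[of I] by metis
  then show ?thesis using assms(2) by (auto simp: I_def)
qed

text \<open>Dominance of one root and full support of the other make their pairing positive. Their
  difference would be a root, contradicting the maximality of the smaller one.\<close>

lemma maximal_unique:
  assumes \<theta>: "maximal_root \<theta>" and \<theta>': "maximal_root \<theta>'"
  shows "\<theta> = \<theta>'"
proof (rule ccontr)
  assume ne: "\<theta> \<noteq> \<theta>'"
  have R: "\<theta> \<in> R" "\<theta>' \<in> R" using assms pos_root by (auto simp: maximal_root_def)
  have eq: "inner \<theta> \<theta>' = (\<Sum>\<beta>\<in>D. inner \<theta> (coroot \<beta>) * inner (\<omega> \<beta>) \<theta>')"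
    by (rule inner_expansion)
  have nn: "inner \<theta> (coroot \<beta>) \<ge> 0" if "\<beta> \<in> D" for \<beta>
    using maximal_dominant[OF \<theta> simple_pos[OF that]] by (simp add: inner_coroot)
  obtain \<beta>0 where "\<beta>0 \<in> D" "inner \<theta> (coroot \<beta>0) \<noteq> 0"
    using eq_by_coroots[of \<theta> 0] nonzero[OF R(1)] by auto
  then have \<beta>0: "\<beta>0 \<in> D" "inner \<theta> (coroot \<beta>0) > 0" using nn[of \<beta>0] by simp_all
  have pos: "inner \<theta> \<theta>' > 0"
    unfolding eq
  proof (rule sum_pos2[OF finite_D \<beta>0(1)])
    show "0 < inner \<theta> (coroot \<beta>0) * inner (\<omega> \<beta>0) \<theta>'"
      using \<beta>0 maximal_full_support[OF \<theta>' \<beta>0(1)] by simp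
    fix \<beta> assume "\<beta> \<in> D"
    then show "0 \<le> inner \<theta> (coroot \<beta>) * inner (\<omega> \<beta>) \<theta>'"
      using nn[of \<beta>] maximal_full_support[OF \<theta>', of \<beta>] by simp
  qed
  have "\<theta> - \<theta>' \<in> R" using root_diff[OF R pos ne] .
  then have "\<theta> - \<theta>' \<in> Pos \<or> \<theta>' - \<theta> \<in> Pos" using neg_pos_iff[of "\<theta> - \<theta>'"] by auto
  moreover have "\<theta>' + (\<theta> - \<theta>') = \<theta>" "\<theta> + (\<theta>' - \<theta>) = \<theta>'" by auto
  ultimately show False using assms R unfolding maximal_root_def by metis
qed

text \<open>Every root lies below a maximal root, and there is only one. Two roots with the global
  property differ by nonnegative combinations of positive roots in both directions, and pairing with
  \<open>v\<close> makes these zero.\<close>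

lemma highest_root:
  "highest_root R Pos \<in> R \<and> (\<forall>\<beta>\<in>R. \<exists>m :: 'a \<Rightarrow> nat. highest_root R Pos - \<beta> = (\<Sum>\<gamma>\<in>Pos. real (m \<gamma>) *\<^sub>R \<gamma>))"
  "maximal_root (highest_root R Pos)"
proof -
  let ?P = "\<lambda>\<theta>. \<theta> \<in> R \<and> (\<forall>\<beta>\<in>R. \<exists>m :: 'a \<Rightarrow> nat. \<theta> - \<beta> = (\<Sum>\<gamma>\<in>Pos. real (m \<gamma>) *\<^sub>R \<gamma>))"
  obtain \<beta> where "\<beta> \<in> R" using irr by (auto simp: irreducible_roots_def)
  then obtain \<theta> where \<theta>: "maximal_root \<theta>" using maximal_above by blast
  have P\<theta>: "?P \<theta>"
    using \<theta> maximal_above maximal_unique[OF \<theta>] pos_root unfolding maximal_root_def by metis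
  have uniq: "\<theta>' = \<theta>" if P': "?P \<theta>'" for \<theta>'
  proof -
    obtain m m' :: "'a \<Rightarrow> nat" where m: "\<theta> - \<theta>' = (\<Sum>\<gamma>\<in>Pos. real (m \<gamma>) *\<^sub>R \<gamma>)"
      and m': "\<theta>' - \<theta> = (\<Sum>\<gamma>\<in>Pos. real (m' \<gamma>) *\<^sub>R \<gamma>)"
      using P' P\<theta> by blast
    have nn: "inner (\<Sum>\<gamma>\<in>Pos. real (k \<gamma>) *\<^sub>R \<gamma>) v \<ge> 0" for k :: "'a \<Rightarrow> nat"
      unfolding inner_sum_left by (intro sum_nonneg) (auto intro!: mult_nonneg_nonneg less_imp_le[OF pos_v])
    have "inner (\<theta> - \<theta>') v = 0"
      using nn[of m] nn[of m'] unfolding m[symmetric] m'[symmetric] by (simp add: inner_diff_left)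
    then have "(\<Sum>\<gamma>\<in>Pos. real (m \<gamma>) * inner \<gamma> v) = 0" unfolding m by (simp add: inner_sum_left)
    then have "\<forall>\<gamma>\<in>Pos. real (m \<gamma>) * inner \<gamma> v = 0"
      by (subst (asm) sum_nonneg_eq_0_iff) (auto intro!: mult_nonneg_nonneg less_imp_le[OF pos_v] finite_Pos)
    then have "\<forall>\<gamma>\<in>Pos. m \<gamma> = 0" using pos_v by fastforce
    then show ?thesis using m by simp
  qed
  have "highest_root R Pos = \<theta>"
    unfolding highest_root_def by (rule the_equality) (rule P\<theta>, rule uniq)
  then show "?P (highest_root R Pos)" "maximal_root (highest_root R Pos)" using P\<theta> \<theta> by auto
qed

abbreviation "\<phi> \<equiv> affine_root R Pos"

lemma affine_root: "\<phi> \<in> R" "coroot \<phi> = highest_root (coroot ` R) (coroot ` Pos)"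
proof -
  interpret dual: irr_root_data "coroot ` R" "coroot ` Pos" by (rule irr_dual)
  let ?\<theta> = "highest_root (coroot ` R) (coroot ` Pos)"
  obtain \<alpha> where \<alpha>: "\<alpha> \<in> R" "coroot \<alpha> = ?\<theta>" using dual.highest_root(1) by auto
  have "\<phi> = \<alpha>"
    unfolding affine_root_def
    by (rule the_equality) (use \<alpha> in simp, metis \<alpha> coroot_inj inj_onD)
  then show "\<phi> \<in> R" "coroot \<phi> = ?\<theta>" using \<alpha> by auto
qed

lemma affine_root_pos: "\<phi> \<in> Pos"
proof -
  interpret dual: irr_root_data "coroot ` R" "coroot ` Pos" by (rule irr_dual)
  have "coroot \<phi> \<in> coroot ` Pos"
    using dual.highest_root(2) by (simp add: affine_root dual.maximal_root_def)
  then show ?thesis using coroot_inj affine_root(1) pos_root by (auto dest: inj_onD)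
qed

lemma theta_ge:
  assumes "\<beta> \<in> D" "\<gamma> \<in> R"
  shows "inner (\<omega> \<beta>) (coroot \<gamma>) \<le> inner (\<omega> \<beta>) (coroot \<phi>)"
proof -
  interpret dual: irr_root_data "coroot ` R" "coroot ` Pos" by (rule irr_dual)
  obtain m :: "'a \<Rightarrow> nat" where m: "coroot \<phi> - coroot \<gamma> = (\<Sum>\<delta>\<in>coroot ` Pos. real (m \<delta>) *\<^sub>R \<delta>)"
    using dual.highest_root(1) assms(2) by (auto simp: affine_root)
  have "inner (\<omega> \<beta>) (coroot \<phi> - coroot \<gamma>) \<ge> 0"
    unfolding m inner_sum_right using assms(1)
    by (intro sum_nonneg) (auto intro!: mult_nonneg_nonneg weight_coroot_nonneg)
  then show ?thesis by (simp add: inner_diff_right)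
qed

text \<open>Full support of the highest root of the dual system makes the pairing positive, and
  integrality raises the bound to 1.\<close>

lemma theta_pos:
  assumes "\<beta> \<in> D" shows "inner (\<omega> \<beta>) (coroot \<phi>) \<ge> 1"
proof -
  interpret dual: irr_root_data "coroot ` R" "coroot ` Pos" by (rule irr_dual)
  let ?w = "fund_weight (coroot ` Pos)"
  \<comment> \<open>The dual system expands vectors along its own coroots, which are the simple
    roots; half their squared lengths convert this to an expansion along simple coroots.\<close>
  have "coroot \<phi> = (\<Sum>\<delta>\<in>coroot ` D. inner (?w \<delta>) (coroot \<phi>) *\<^sub>R coroot \<delta>)"
    using dual.coroot_expansion[of "coroot \<phi>"] by (simp add: simple_coroots)
  also have "\<dots> = (\<Sum>\<delta>\<in>D. inner (?w (coroot \<delta>)) (coroot \<phi>) *\<^sub>R \<delta>)"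
    by (simp add: sum.reindex[OF coroot_inj_D]) (intro sum.cong, auto simp: nonzero simple_root)
  also have "\<dots> = (\<Sum>\<delta>\<in>D. (inner (?w (coroot \<delta>)) (coroot \<phi>) * (inner \<delta> \<delta> / 2)) *\<^sub>R coroot \<delta>)"
  proof (rule sum.cong[OF HOL.refl])
    fix \<delta> assume "\<delta> \<in> D"
    then have "(inner \<delta> \<delta> / 2) *\<^sub>R coroot \<delta> = \<delta>"
      using nonzero[OF simple_root] by (simp add: coroot_def)
    then show "inner (?w (coroot \<delta>)) (coroot \<phi>) *\<^sub>R \<delta>
        = (inner (?w (coroot \<delta>)) (coroot \<phi>) * (inner \<delta> \<delta> / 2)) *\<^sub>R coroot \<delta>"
      by (metis scaleR_scaleR)
  qed
  finally have "inner (\<omega> \<beta>) (coroot \<phi>) = inner (\<omega> \<beta>)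
      (\<Sum>\<delta>\<in>D. (inner (?w (coroot \<delta>)) (coroot \<phi>) * (inner \<delta> \<delta> / 2)) *\<^sub>R coroot \<delta>)"
    by (rule arg_cong)
  also have "\<dots> = inner (?w (coroot \<beta>)) (coroot \<phi>) * (inner \<beta> \<beta> / 2)"
    by (rule inner_weight_comb[OF assms finite_D])
  finally have "inner (\<omega> \<beta>) (coroot \<phi>) = inner (?w (coroot \<beta>)) (coroot \<phi>) * (inner \<beta> \<beta> / 2)" .
  moreover have "inner (?w (coroot \<beta>)) (coroot \<phi>) * (inner \<beta> \<beta> / 2) > 0"
    using dual.maximal_full_support[OF dual.highest_root(2), of "coroot \<beta>"] assms
      nonzero[OF simple_root[OF assms]]
    by (intro mult_pos_pos) (simp_all add: simple_coroots affine_root)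
  ultimately have "inner (\<omega> \<beta>) (coroot \<phi>) > 0" by metis
  moreover obtain k where "inner (\<omega> \<beta>) (coroot \<phi>) = real k"
    using weight_coroot_nat[OF affine_root_pos assms] by (auto elim: Nats_cases)
  ultimately show ?thesis by simp
qed

end

section \<open>Weight lattice and root lattice\<close>

context root_data
begin

lemma weight_lattice_iff: "x \<in> weight_lattice Pos \<longleftrightarrow> (\<forall>\<beta>\<in>D. inner x (coroot \<beta>) \<in> \<int>)"
proof
  assume "x \<in> weight_lattice Pos"
  then obtain c :: "'a \<Rightarrow> int" where x: "x = (\<Sum>\<alpha>\<in>D. real_of_int (c \<alpha>) *\<^sub>R \<omega> \<alpha>)"
    by (auto simp: weight_lattice_def)
  show "\<forall>\<beta>\<in>D. inner x (coroot \<beta>) \<in> \<int>"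
  proof
    fix \<beta> assume "\<beta> \<in> D"
    then show "inner x (coroot \<beta>) \<in> \<int>"
      unfolding x inner_sum_left by (intro Ints_sum) (auto simp: fund_weight)
  qed
next
  assume "\<forall>\<beta>\<in>D. inner x (coroot \<beta>) \<in> \<int>"
  then have "x = (\<Sum>\<beta>\<in>D. real_of_int \<lfloor>inner x (coroot \<beta>)\<rfloor> *\<^sub>R \<omega> \<beta>)"
    by (subst weight_expansion[of x]) (intro sum.cong, auto elim!: Ints_cases)
  then show "x \<in> weight_lattice Pos"
    unfolding weight_lattice_def by (intro CollectI exI[of _ "\<lambda>\<beta>. \<lfloor>inner x (coroot \<beta>)\<rfloor>"]) simp
qed

lemma weight_lattice_int: "x \<in> weight_lattice Pos \<Longrightarrow> \<alpha> \<in> R \<Longrightarrow> inner x (coroot \<alpha>) \<in> \<int>"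
  by (subst inner_expansion) (auto intro!: Ints_sum Ints_mult weight_coroot_int simp: weight_lattice_iff)

lemma weight_lattice_closed:
  "0 \<in> weight_lattice Pos"
  "x \<in> weight_lattice Pos \<Longrightarrow> y \<in> weight_lattice Pos \<Longrightarrow> x + y \<in> weight_lattice Pos"
  "x \<in> weight_lattice Pos \<Longrightarrow> y \<in> weight_lattice Pos \<Longrightarrow> x - y \<in> weight_lattice Pos"
  "x \<in> weight_lattice Pos \<Longrightarrow> - x \<in> weight_lattice Pos"
  by (auto simp: weight_lattice_iff inner_add_left inner_diff_left)

lemma fund_weight_in_lattice: "\<alpha> \<in> D \<Longrightarrow> \<omega> \<alpha> \<in> weight_lattice Pos"
  by (simp add: weight_lattice_iff fund_weight)

abbreviation "Q \<equiv> root_lattice Pos"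

lemma root_latticeI: "x = (\<Sum>\<alpha>\<in>D. real_of_int (c \<alpha>) *\<^sub>R \<alpha>) \<Longrightarrow> x \<in> Q"
  unfolding root_lattice_def by (intro CollectI exI[of _ c]) simp

lemma root_lattice_diff: "x \<in> Q \<Longrightarrow> y \<in> Q \<Longrightarrow> x - y \<in> Q"
proof -
  assume "x \<in> Q" "y \<in> Q"
  then obtain c d :: "'a \<Rightarrow> int" where "x = (\<Sum>\<alpha>\<in>D. real_of_int (c \<alpha>) *\<^sub>R \<alpha>)"
    "y = (\<Sum>\<alpha>\<in>D. real_of_int (d \<alpha>) *\<^sub>R \<alpha>)" by (auto simp: root_lattice_def)
  then have "x - y = (\<Sum>\<alpha>\<in>D. real_of_int (c \<alpha> - d \<alpha>) *\<^sub>R \<alpha>)"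
    by (simp add: sum_subtractf scaleR_left_diff_distrib)
  then show ?thesis by (rule root_latticeI)
qed

lemma root_lattice_zero: "0 \<in> Q"
proof -
  show ?thesis by (rule root_latticeI[of _ "\<lambda>_. 0"]) simp
qed

lemma root_lattice_neg: "x \<in> Q \<Longrightarrow> - x \<in> Q"
  using root_lattice_diff[OF root_lattice_zero] by force

lemma root_lattice_add: "x \<in> Q \<Longrightarrow> y \<in> Q \<Longrightarrow> x + y \<in> Q"
  using root_lattice_diff[OF _ root_lattice_neg] by force

lemma root_lattice_scale: "x \<in> Q \<Longrightarrow> real_of_int k *\<^sub>R x \<in> Q"
proof -
  assume "x \<in> Q"
  then obtain c :: "'a \<Rightarrow> int" where "x = (\<Sum>\<alpha>\<in>D. real_of_int (c \<alpha>) *\<^sub>R \<alpha>)"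
    by (auto simp: root_lattice_def)
  then have "real_of_int k *\<^sub>R x = (\<Sum>\<alpha>\<in>D. real_of_int (k * c \<alpha>) *\<^sub>R \<alpha>)"
    by (simp add: scaleR_sum_right)
  then show ?thesis by (rule root_latticeI)
qed

lemma root_in_lattice: "\<alpha> \<in> R \<Longrightarrow> \<alpha> \<in> Q"
proof -
  have *: "\<alpha> \<in> Q" if p: "\<alpha> \<in> Pos" for \<alpha>
  proof -
    obtain n :: "'a \<Rightarrow> nat" where n: "\<alpha> = (\<Sum>\<beta>\<in>D. real (n \<beta>) *\<^sub>R \<beta>)" using pos_comb[OF p] by blast
    then have "\<alpha> = (\<Sum>\<beta>\<in>D. real_of_int (int (n \<beta>)) *\<^sub>R \<beta>)" by simp
    then show ?thesis by (rule root_latticeI)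
  qed
  show "\<alpha> \<in> R \<Longrightarrow> \<alpha> \<in> Q"
    using *[of \<alpha>] *[of "- \<alpha>"] neg_pos_iff[of \<alpha>] root_lattice_neg[of "- \<alpha>"] by auto
qed

lemma root_lattice_subset: "x \<in> Q \<Longrightarrow> x \<in> weight_lattice Pos"
proof -
  assume "x \<in> Q"
  then obtain c :: "'a \<Rightarrow> int" where x: "x = (\<Sum>\<alpha>\<in>D. real_of_int (c \<alpha>) *\<^sub>R \<alpha>)"
    by (auto simp: root_lattice_def)
  show ?thesis
    unfolding weight_lattice_iff x inner_sum_left
    by (auto intro!: Ints_sum Ints_mult integral simple_root)
qed

text \<open>A reflection changes a weight by an integral multiple of a root, so the class modulo
  \<open>Q\<close> is preserved letter by letter.\<close>

lemma weyl_lattice: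
  assumes "w \<in> W" "x \<in> weight_lattice Pos"
  shows "w x - x \<in> Q" "w x \<in> weight_lattice Pos"
proof -
  have *: "rprod xs x - x \<in> Q" if "xs \<in> lists R" for xs
    using that
  proof (induction xs)
    case (Cons \<alpha> xs)
    then have IH: "rprod xs x - x \<in> Q" and \<alpha>: "\<alpha> \<in> R" by auto
    have "(rprod xs x - x) + x \<in> weight_lattice Pos"
      by (intro weight_lattice_closed root_lattice_subset IH assms)
    then have "rprod xs x \<in> weight_lattice Pos" by simp
    then obtain k where k: "inner (rprod xs x) (coroot \<alpha>) = real_of_int k"
      using weight_lattice_int \<alpha> by (auto elim!: Ints_cases)
    have "rprod (\<alpha> # xs) x - x = (rprod xs x - x) - real_of_int k *\<^sub>R \<alpha>"
      by (simp add: reflection_def k)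
    then show ?case using root_lattice_diff[OF IH root_lattice_scale[OF root_in_lattice[OF \<alpha>]]] by metis
  qed (simp add: root_lattice_zero)
  then show "w x - x \<in> Q" using assms(1) by (auto simp: weyl_group_eq)
  then have "(w x - x) + x \<in> weight_lattice Pos"
    by (intro weight_lattice_closed(2) root_lattice_subset assms(2))
  then show "w x \<in> weight_lattice Pos" by simp
qed

lemma root_lattice_sum_list: "x \<in> Q \<Longrightarrow> \<exists>xs. set xs \<subseteq> R \<and> x = sum_list xs"
proof -
  assume "x \<in> Q"
  then obtain c :: "'a \<Rightarrow> int" where x: "x = (\<Sum>\<alpha>\<in>D. real_of_int (c \<alpha>) *\<^sub>R \<alpha>)"
    by (auto simp: root_lattice_def)
  have rep: "sum_list (replicate n y) = real n *\<^sub>R y" for n and y :: 'a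
    by (induction n) (auto simp: scaleR_left_distrib)
  have single: "\<exists>xs. set xs \<subseteq> R \<and> real_of_int k *\<^sub>R \<alpha> = sum_list xs" if "\<alpha> \<in> R" for k \<alpha>
  proof (cases "k \<ge> 0")
    case True
    then show ?thesis using that by (intro exI[of _ "replicate (nat k) \<alpha>"]) (auto simp: rep)
  next
    case False
    then show ?thesis using that by (intro exI[of _ "replicate (nat (- k)) (- \<alpha>)"]) (auto simp: rep)
  qed
  have "\<exists>xs. set xs \<subseteq> R \<and> (\<Sum>\<alpha>\<in>A. real_of_int (c \<alpha>) *\<^sub>R \<alpha>) = sum_list xs" if "finite A" "A \<subseteq> R" for A
    using that
  proof (induction A)
    case empty
    then show ?case by (intro exI[of _ "[]"]) simp
  next
    case (insert \<alpha> A)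
    then obtain xs ys where "set xs \<subseteq> R" "(\<Sum>\<alpha>\<in>A. real_of_int (c \<alpha>) *\<^sub>R \<alpha>) = sum_list xs"
      "set ys \<subseteq> R" "real_of_int (c \<alpha>) *\<^sub>R \<alpha> = sum_list ys" using single[of \<alpha> "c \<alpha>"] by auto
    then show ?case using insert.hyps by (intro exI[of _ "ys @ xs"]) auto
  qed
  then show ?thesis using x finite_D simple_root by blast
qed

text \<open>In a shortest expression as a sum of roots no two summands form an obtuse angle.\<close>

lemma root_lattice_large_coordinate:
  assumes \<nu>: "\<nu> \<in> Q" "\<nu> \<noteq> 0"
  shows "\<exists>\<beta>\<in>R. inner \<nu> (coroot \<beta>) \<ge> 2"
proof -
  obtain xs where xs: "set xs \<subseteq> R \<and> \<nu> = sum_list xs"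
    and min: "\<And>ys. set ys \<subseteq> R \<and> \<nu> = sum_list ys \<Longrightarrow> length xs \<le> length ys"
    using ex_has_least_nat[of "\<lambda>xs. set xs \<subseteq> R \<and> \<nu> = sum_list xs" _ length] root_lattice_sum_list[OF \<nu>(1)]
    by metis
  then obtain \<beta> ys where ys: "xs = \<beta> # ys" using \<nu>(2) by (cases xs) auto
  have \<beta>: "\<beta> \<in> R" using xs ys by auto
  have nn: "inner x \<beta> \<ge> 0" if x: "x \<in> set ys" for x
  proof (rule ccontr)
    assume neg: "\<not> inner x \<beta> \<ge> 0"
    obtain as bs where ab: "ys = as @ x # bs" using x by (auto dest: split_list)
    have xR: "x \<in> R" using x xs ys by auto
    show False
    proof (cases "x = - \<beta>")
      case True
      then have "set (as @ bs) \<subseteq> R \<and> \<nu> = sum_list (as @ bs)" using xs ys ab by auto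
      from min[OF this] show False using ys ab by simp
    next
      case False
      then have "x - (- \<beta>) \<in> R" using neg xR \<beta> by (intro root_diff) auto
      then have "set ((x + \<beta>) # as @ bs) \<subseteq> R \<and> \<nu> = sum_list ((x + \<beta>) # as @ bs)"
        using xs ys ab by (auto simp: algebra_simps)
      from min[OF this] show False using ys ab by simp
    qed
  qed
  have "inner (sum_list zs) \<beta> \<ge> 0" if "\<And>x. x \<in> set zs \<Longrightarrow> inner x \<beta> \<ge> 0" for zs
    using that by (induction zs) (auto simp: inner_add_left)
  then have "inner (sum_list ys) \<beta> \<ge> 0" using nn by blast
  then have "inner (sum_list ys) (coroot \<beta>) \<ge> 0" by (simp add: inner_coroot)
  \<comment> \<open>The summand \<open>\<beta>\<close> pairs to 2 with its own coroot, and the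
    remaining summands contribute a nonnegative amount.\<close>
  then have "inner \<nu> (coroot \<beta>) \<ge> 2"
    using xs ys nonzero[OF \<beta>] by (simp add: inner_add_left)
  then show ?thesis using \<beta> by blast
qed

text \<open>A positive form invariant under the Weyl group. It takes integral values on the weight
  lattice, so shortest representatives of cosets can be chosen.\<close>

definition root_form :: "'a \<Rightarrow> 'a \<Rightarrow> real" where
  "root_form x y = (\<Sum>\<gamma>\<in>R. inner x (coroot \<gamma>) * inner y (coroot \<gamma>))"

lemma inner_refl_coroot: "inner (reflection \<alpha> x) (coroot \<gamma>) = inner x (coroot (reflection \<alpha> \<gamma>))"
  by (simp add: inner_reflection_left coroot_isometry[OF linear_reflection])

lemma root_form_reflection:
  assumes "\<alpha> \<in> R" shows "root_form (reflection \<alpha> x) (reflection \<alpha> y) = root_form x y"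
proof -
  have "bij_betw (reflection \<alpha>) R R"
    using refl_image[OF assms] unfolding bij_betw_def by (auto intro: inj_on_inverseI[of _ "reflection \<alpha>"])
  from sum.reindex_bij_betw[OF this, of "\<lambda>\<gamma>. inner x (coroot \<gamma>) * inner y (coroot \<gamma>)"]
  show ?thesis unfolding root_form_def inner_refl_coroot .
qed

text \<open>The form of \<open>\<alpha>\<close> with the reflection of \<open>x\<close> is computed
  twice, once by invariance and once from the formula of the reflection.\<close>

lemma root_form_root:
  assumes "\<alpha> \<in> R" shows "2 * root_form x \<alpha> = inner x (coroot \<alpha>) * root_form \<alpha> \<alpha>"
proof -
  have "root_form (reflection \<alpha> x) \<alpha> = - root_form x \<alpha>"
    using root_form_reflection[OF assms, of x "- \<alpha>"] reflection_self[of \<alpha>] linear_neg[OF linear_reflection, of \<alpha> \<alpha>]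
    by (simp add: root_form_def sum_negf)
  moreover have "root_form (reflection \<alpha> x) \<alpha> = root_form x \<alpha> - inner x (coroot \<alpha>) * root_form \<alpha> \<alpha>"
    by (simp add: root_form_def reflection_def inner_diff_left sum_subtractf sum_distrib_left algebra_simps)
  ultimately show ?thesis by simp
qed

end

section \<open>Minuscule representatives modulo the root lattice\<close>

context irr_root_data
begin

text \<open>A representative \<open>y\<close> of smallest norm in its coset is taken. If it paired
  to more than 1 with the coroot of \<open>\<alpha>\<close>, then \<open>y - \<alpha>\<close> would
  be shorter, by \<open>root_form_root\<close>.\<close>

lemma small_representative:
  assumes x: "x \<in> weight_lattice Pos"
  shows "\<exists>y. x - y \<in> Q \<and> (\<forall>\<alpha>\<in>R. inner y (coroot \<alpha>) \<le> 1)"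
proof -
  let ?m = "\<lambda>y. nat \<lfloor>root_form y y\<rfloor>"
  obtain y where y: "x - y \<in> Q" and min: "\<And>z. x - z \<in> Q \<Longrightarrow> ?m y \<le> ?m z"
    using ex_has_least_nat[of "\<lambda>y. x - y \<in> Q" x ?m] root_lattice_zero by auto
  have P: "z \<in> weight_lattice Pos" if "x - z \<in> Q" for z
    using weight_lattice_closed(3)[OF x root_lattice_subset[OF that]] by simp
  have m: "real (?m z) = root_form z z" if "z \<in> weight_lattice Pos" for z
  proof -
    have "root_form z z \<in> \<int>" unfolding root_form_def
      by (intro Ints_sum Ints_mult weight_lattice_int that)
    moreover have "root_form z z \<ge> 0" unfolding root_form_def by (intro sum_nonneg) auto
    ultimately show ?thesis by (auto elim!: Ints_cases)
  qed
  have "inner y (coroot \<alpha>) \<le> 1" if \<alpha>: "\<alpha> \<in> R" for \<alpha>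
  proof (rule ccontr)
    assume "\<not> ?thesis"
    then have gt: "inner y (coroot \<alpha>) > 1" by simp
    have "x - (y - \<alpha>) = (x - y) + \<alpha>" by simp
    then have z: "x - (y - \<alpha>) \<in> Q" using root_lattice_add[OF y root_in_lattice[OF \<alpha>]] by metis
    have "root_form (y - \<alpha>) (y - \<alpha>) = root_form y y - 2 * root_form y \<alpha> + root_form \<alpha> \<alpha>"
      by (simp add: root_form_def inner_diff_left sum_subtractf sum.distrib sum_distrib_left algebra_simps)
    also have "\<dots> = root_form y y - (inner y (coroot \<alpha>) - 1) * root_form \<alpha> \<alpha>"
      unfolding root_form_root[OF \<alpha>] by (simp add: algebra_simps)
    also have "\<dots> < root_form y y"
    proof -
      have "root_form \<alpha> \<alpha> > 0" unfolding root_form_def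
        using \<alpha> nonzero by (intro sum_pos2[OF finite_R \<alpha>]) auto
      then show ?thesis using gt by simp
    qed
    finally have "real (?m (y - \<alpha>)) < real (?m y)" using m[OF P[OF z]] m[OF P[OF y]] by linarith
    then have "?m (y - \<alpha>) < ?m y" by (simp only: of_nat_less_iff)
    then show False using min[OF z] by linarith
  qed
  then show ?thesis using y by blast
qed

text \<open>Among the small representatives the one with largest pairing with \<open>v\<close> is
  taken. If it paired to -1 with the coroot of a positive root, the reflection would add that root,
  giving a small representative with larger pairing.\<close>

lemma dominant_small_representative:
  assumes x: "x \<in> weight_lattice Pos"
  shows "\<exists>y. x - y \<in> Q \<and> (\<forall>\<alpha>\<in>Pos. inner y (coroot \<alpha>) \<in> {0, 1})"
proof -
  have P: "z \<in> weight_lattice Pos" if "x - z \<in> Q" for z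
    using weight_lattice_closed(3)[OF x root_lattice_subset[OF that]] by simp
  define M where "M = {y. x - y \<in> Q \<and> (\<forall>\<alpha>\<in>R. inner y (coroot \<alpha>) \<le> 1)}"
  have vals: "inner y (coroot \<alpha>) \<in> {-1, 0, 1}" if "y \<in> M" "\<alpha> \<in> R" for y \<alpha>
  proof -
    obtain k where k: "inner y (coroot \<alpha>) = real_of_int k"
      using weight_lattice_int[OF P[of y] \<open>\<alpha> \<in> R\<close>] \<open>y \<in> M\<close> unfolding M_def by (auto elim: Ints_cases)
    have "inner y (coroot \<alpha>) \<le> 1" "inner y (coroot (- \<alpha>)) \<le> 1"
      using that neg_root[OF that(2)] unfolding M_def by blast+
    then have "k \<le> 1" "k \<ge> -1" using k by auto
    then have "k = -1 \<or> k = 0 \<or> k = 1" by auto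
    then show ?thesis using k by auto
  qed
  \<comment> \<open>The set of small representatives is finite because their coordinates along the
    fundamental weights are -1, 0 or 1; so a maximum exists.\<close>
  have "M \<subseteq> (\<lambda>c. \<Sum>\<beta>\<in>D. c \<beta> *\<^sub>R \<omega> \<beta>) ` (D \<rightarrow>\<^sub>E {-1, 0, 1})"
  proof
    fix y assume y: "y \<in> M"
    have "y = (\<Sum>\<beta>\<in>D. restrict (\<lambda>\<beta>. inner y (coroot \<beta>)) D \<beta> *\<^sub>R \<omega> \<beta>)"
      using weight_expansion[of y] by simp
    moreover have "restrict (\<lambda>\<beta>. inner y (coroot \<beta>)) D \<in> D \<rightarrow>\<^sub>E {-1, 0, 1}"
      using vals[OF y] simple_root by (intro restrict_PiE_iff[THEN iffD2] ballI) blast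
    ultimately show "y \<in> (\<lambda>c. \<Sum>\<beta>\<in>D. c \<beta> *\<^sub>R \<omega> \<beta>) ` (D \<rightarrow>\<^sub>E {-1, 0, 1})" by (rule image_eqI)
  qed
  then have fin: "finite M" by (rule finite_subset) (intro finite_imageI finite_PiE finite_D, simp)
  have "M \<noteq> {}" using small_representative[OF x] by (auto simp: M_def)
  then have "Max ((\<lambda>y. inner y v) ` M) \<in> (\<lambda>y. inner y v) ` M" using fin by (intro Max_in) auto
  then obtain y where y: "y \<in> M" and ymax: "inner y v = Max ((\<lambda>y. inner y v) ` M)" by auto
  have le: "inner z v \<le> inner y v" if "z \<in> M" for z
    unfolding ymax using that fin by (intro Max_ge) auto
  have "inner y (coroot \<alpha>) \<noteq> -1" if \<alpha>: "\<alpha> \<in> Pos" for \<alpha>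
  proof
    assume m1: "inner y (coroot \<alpha>) = -1"
    have \<alpha>R: "\<alpha> \<in> R" using pos_root[OF \<alpha>] .
    have r: "reflection \<alpha> y = y + \<alpha>" by (simp add: reflection_def m1)
    have "x - y \<in> Q" using y by (simp add: M_def)
    then have "x - y - \<alpha> \<in> Q" using root_in_lattice[OF \<alpha>R] by (rule root_lattice_diff)
    then have "x - (y + \<alpha>) \<in> Q" by (simp only: diff_diff_eq)
    moreover have "inner (y + \<alpha>) (coroot \<gamma>) \<le> 1" if "\<gamma> \<in> R" for \<gamma>
      unfolding r[symmetric] inner_refl_coroot using refl_root[OF \<alpha>R that] y by (simp add: M_def)
    ultimately have "y + \<alpha> \<in> M" by (simp add: M_def)
    from le[OF this] show False using pos_v[OF \<alpha>] by (simp add: inner_add_left)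
  qed
  then have "\<forall>\<alpha>\<in>Pos. inner y (coroot \<alpha>) \<in> {0, 1}" using vals[OF y] pos_root by blast
  then show ?thesis using y by (auto simp: M_def)
qed

text \<open>The highest coroot contains every simple coroot with coefficient at least 1, and the
  representative pairs with it to at most 1. Hence at most one coordinate along the fundamental
  weights is nonzero.\<close>

lemma minuscule_representative:
  assumes x: "x \<in> weight_lattice Pos"
  shows "x \<in> Q \<or> (\<exists>\<beta>\<in>D. minuscule Pos (\<omega> \<beta>) \<and> x - \<omega> \<beta> \<in> Q)"
proof -
  obtain y where y: "x - y \<in> Q" "\<And>\<alpha>. \<alpha> \<in> Pos \<Longrightarrow> inner y (coroot \<alpha>) = 0 \<or> inner y (coroot \<alpha>) = 1"
    using dominant_small_representative[OF x] by blast
  show ?thesis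
  proof (cases "\<exists>\<beta>\<in>D. inner y (coroot \<beta>) = 1")
    case False
    then have "y = 0" using y(2) simple_pos by (intro eq_by_coroots) auto
    then show ?thesis using y by simp
  next
    case True
    then obtain \<beta> where \<beta>: "\<beta> \<in> D" "inner y (coroot \<beta>) = 1" by blast
    have "inner y (coroot \<delta>) = 0" if \<delta>: "\<delta> \<in> D" "\<delta> \<noteq> \<beta>" for \<delta>
    proof (rule ccontr)
      assume "inner y (coroot \<delta>) \<noteq> 0"
      then have \<delta>1: "inner y (coroot \<delta>) = 1" using y(2)[OF simple_pos[OF \<delta>(1)]] by simp
      have "(\<Sum>\<gamma>\<in>{\<beta>, \<delta>}. inner y (coroot \<gamma>) * inner (\<omega> \<gamma>) (coroot \<phi>))
          \<le> (\<Sum>\<gamma>\<in>D. inner y (coroot \<gamma>) * inner (\<omega> \<gamma>) (coroot \<phi>))"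
      proof (rule sum_mono2)
        fix \<gamma> assume "\<gamma> \<in> D - {\<beta>, \<delta>}"
        then have "\<gamma> \<in> D" "inner y (coroot \<gamma>) \<ge> 0" using y(2)[OF simple_pos, of \<gamma>] by auto
        then show "0 \<le> inner y (coroot \<gamma>) * inner (\<omega> \<gamma>) (coroot \<phi>)"
          using theta_pos[of \<gamma>] by (intro mult_nonneg_nonneg) auto
      qed (use \<beta> \<delta> finite_D in auto)
      then have "inner y (coroot \<phi>) \<ge> inner (\<omega> \<beta>) (coroot \<phi>) + inner (\<omega> \<delta>) (coroot \<phi>)"
        using \<delta>(2) \<delta>1 \<beta>(2) inner_expansion[of y "coroot \<phi>"] by simp
      then show False
        using theta_pos[OF \<beta>(1)] theta_pos[OF \<delta>(1)] y(2)[OF affine_root_pos] by linarith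
    qed
    then have "y = \<omega> \<beta>" using \<beta> by (intro eq_by_coroots) (auto simp: fund_weight)
    moreover have "minuscule Pos y" using y(2) by (auto simp: minuscule_def)
    ultimately show ?thesis using y \<beta> by blast
  qed
qed

end

section \<open>The stabilizer of an alcove point\<close>

lemma ext_affine_simps [simp]:
  "carrier (ext_affine R L) = L \<times> weyl_group R"
  "\<one>\<^bsub>ext_affine R L\<^esub> = (0, id)"
  "x \<otimes>\<^bsub>ext_affine R L\<^esub> y = (fst x + snd x (fst y), snd x \<circ> snd y)"
  by (auto simp: ext_affine_def split: prod.splits)

section \<open>Extended affine groups over stable lattices\<close>

context root_data
begin

definition stable_lattice :: "'a set \<Rightarrow> bool" where
  "stable_lattice L \<longleftrightarrow> add_subgroup L \<and> (\<forall>w\<in>W. \<forall>x\<in>L. w x \<in> L)"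

lemma add_subgroup_closed:
  assumes "add_subgroup L"
  shows "0 \<in> L" "x \<in> L \<Longrightarrow> y \<in> L \<Longrightarrow> x - y \<in> L" "x \<in> L \<Longrightarrow> - x \<in> L"
    "x \<in> L \<Longrightarrow> y \<in> L \<Longrightarrow> x + y \<in> L"
proof -
  show *: "0 \<in> L" "\<And>x y. x \<in> L \<Longrightarrow> y \<in> L \<Longrightarrow> x - y \<in> L" using assms by (auto simp: add_subgroup_def)
  then show neg: "- x \<in> L" if "x \<in> L" for x using *(2)[OF *(1) that] by simp
  show "x \<in> L \<Longrightarrow> y \<in> L \<Longrightarrow> x + y \<in> L" using *(2)[of x "- y"] neg[of y] by simp
qed

lemma stable_between:
  assumes "add_subgroup L" "Q \<subseteq> L" "L \<subseteq> weight_lattice Pos"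
  shows "stable_lattice L"
proof -
  have "w x \<in> L" if "w \<in> W" "x \<in> L" for w x
  proof -
    have "(w x - x) + x \<in> L"
      using add_subgroup_closed(4)[OF assms(1)] weyl_lattice(1)[OF that(1), of x] assms that by blast
    then show ?thesis by simp
  qed
  then show ?thesis using assms(1) by (simp add: stable_lattice_def)
qed

lemma stable_weight_lattice: "stable_lattice (weight_lattice Pos)"
  by (rule stable_between)
    (auto simp: add_subgroup_def weight_lattice_closed root_lattice_subset)

lemma stable_root_lattice: "stable_lattice Q"
  by (rule stable_between)
    (auto simp: add_subgroup_def root_lattice_zero root_lattice_diff root_lattice_subset)

lemma group_ext_affine:
  assumes L: "stable_lattice L" shows "group (ext_affine R L)"
proof (rule groupI)
  note cl = add_subgroup_closed[OF conjunct1[OF L[unfolded stable_lattice_def]]]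
  have st: "\<And>w x. w \<in> W \<Longrightarrow> x \<in> L \<Longrightarrow> w x \<in> L" using L by (auto simp: stable_lattice_def)
  show "\<one>\<^bsub>ext_affine R L\<^esub> \<in> carrier (ext_affine R L)" using cl weyl_id by auto
  fix x y z assume x: "x \<in> carrier (ext_affine R L)" and y: "y \<in> carrier (ext_affine R L)"
    and z: "z \<in> carrier (ext_affine R L)"
  show "x \<otimes>\<^bsub>ext_affine R L\<^esub> y \<in> carrier (ext_affine R L)"
    using x y st cl weyl_comp by auto
  have "linear (snd x)" using x weyl_linear by auto
  then show "x \<otimes>\<^bsub>ext_affine R L\<^esub> y \<otimes>\<^bsub>ext_affine R L\<^esub> z = x \<otimes>\<^bsub>ext_affine R L\<^esub> (y \<otimes>\<^bsub>ext_affine R L\<^esub> z)"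
    by (simp add: linear_add comp_assoc)
next
  note cl = add_subgroup_closed[OF conjunct1[OF L[unfolded stable_lattice_def]]]
  have st: "\<And>w x. w \<in> W \<Longrightarrow> x \<in> L \<Longrightarrow> w x \<in> L" using L by (auto simp: stable_lattice_def)
  fix x assume x: "x \<in> carrier (ext_affine R L)"
  show "\<one>\<^bsub>ext_affine R L\<^esub> \<otimes>\<^bsub>ext_affine R L\<^esub> x = x" by (simp add: o_def id_def)
  obtain l w where lw: "x = (l, w)" "l \<in> L" "w \<in> W" using x by auto
  obtain w' where w': "w' \<in> W" "w \<circ> w' = id" "w' \<circ> w = id" using weyl_inverse[OF lw(3)] by blast
  have "(- w' l, w') \<in> carrier (ext_affine R L)" using w' lw st cl by auto
  moreover have "(- w' l, w') \<otimes>\<^bsub>ext_affine R L\<^esub> x = \<one>\<^bsub>ext_affine R L\<^esub>"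
    using w' lw by (simp only: ext_affine_simps fst_conv snd_conv) simp
  ultimately show "\<exists>y\<in>carrier (ext_affine R L). y \<otimes>\<^bsub>ext_affine R L\<^esub> x = \<one>\<^bsub>ext_affine R L\<^esub>" by blast
qed

abbreviation "G \<equiv> ext_weyl R Pos"
abbreviation "N \<equiv> affine_weyl R Pos"

lemma group_G: "group G"
  by (rule group_ext_affine[OF stable_weight_lattice])

lemma ext_affine_restrict: "ext_affine R L = G\<lparr>carrier := L \<times> W\<rparr>"
  by (simp add: ext_affine_def)

lemma subgroup_lattice:
  assumes "stable_lattice L" "L \<subseteq> weight_lattice Pos"
  shows "subgroup (L \<times> W) G"
proof -
  interpret G: group G by (rule group_G)
  interpret L: group "ext_affine R L" by (rule group_ext_affine[OF assms(1)])
  show ?thesis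
  proof (rule G.subgroupI)
    show "L \<times> W \<subseteq> carrier G" using assms(2) by auto
    show "L \<times> W \<noteq> {}" using L.one_closed by auto
    show "x \<otimes>\<^bsub>G\<^esub> y \<in> L \<times> W" if "x \<in> L \<times> W" "y \<in> L \<times> W" for x y
      using L.m_closed[of x y] that by simp
    show "inv\<^bsub>G\<^esub> x \<in> L \<times> W" if x: "x \<in> L \<times> W" for x
    proof -
      have "inv\<^bsub>G\<^esub> x = inv\<^bsub>ext_affine R L\<^esub> x"
        using L.l_inv[of x] L.inv_closed[of x] x assms(2)
        by (intro G.inv_equality) auto
      then show ?thesis using L.inv_closed[of x] x by simp
    qed
  qed
qed

lemma lin_closed: "w \<in> W \<Longrightarrow> (0, w) \<in> carrier G"
  using weight_lattice_closed(1) by simp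

lemma inv_lin_reflection: "\<alpha> \<in> R \<Longrightarrow> inv\<^bsub>G\<^esub> (lin_reflection \<alpha>) = lin_reflection \<alpha>"
  by (rule group.inv_equality[OF group_G])
    (use lin_closed[OF weyl_refl] linear_0[OF linear_reflection] in auto)

lemma foldr_lin:
  assumes "set xs \<subseteq> R"
  shows "foldr (\<otimes>\<^bsub>G\<^esub>) (map lin_reflection xs) \<one>\<^bsub>G\<^esub> = (0, rprod xs)"
  by (induction xs) (simp_all add: fun_eq_iff linear_0[OF linear_reflection])

lemma generate_lin:
  assumes J: "J \<subseteq> D"
  shows "generate G (lin_reflection ` J) = Pair 0 ` rprod ` lists J"
proof
  have JR: "\<alpha> \<in> R" if "\<alpha> \<in> J" for \<alpha> using that J simple_root by blast
  show "generate G (lin_reflection ` J) \<subseteq> Pair 0 ` rprod ` lists J"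
  proof
    fix x assume "x \<in> generate G (lin_reflection ` J)"
    then have "\<exists>xs. set xs \<subseteq> J \<and> x = (0, rprod xs)"
    proof (induction rule: generate.induct)
      case one
      show ?case by (intro exI[of _ "[]"]) (simp add: fun_eq_iff)
    next
      case (incl h)
      then obtain \<alpha> where "\<alpha> \<in> J" "h = lin_reflection \<alpha>" by auto
      then show ?case by (intro exI[of _ "[\<alpha>]"]) simp
    next
      case (inv h)
      then obtain \<alpha> where "\<alpha> \<in> J" "h = lin_reflection \<alpha>" by auto
      then show ?case using inv_lin_reflection[OF JR] by (intro exI[of _ "[\<alpha>]"]) simp
    next
      case (eng h1 h2)
      then obtain xs ys where "set xs \<subseteq> J" "set ys \<subseteq> J" "h1 = (0, rprod xs)" "h2 = (0, rprod ys)" by blast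
      then show ?case
        by (intro exI[of _ "xs @ ys"]) (simp add: rprod_append fun_eq_iff linear_0[OF linear_rprod])
    qed
    then show "x \<in> Pair 0 ` rprod ` lists J" by auto
  qed
  have "(0, rprod xs) \<in> generate G (lin_reflection ` J)" if "set xs \<subseteq> J" for xs
    using that
  proof (induction xs)
    case Nil
    have "\<one>\<^bsub>G\<^esub> \<in> generate G (lin_reflection ` J)" by (rule generate.one)
    then show ?case unfolding ext_affine_simps(2) rprod_simps .
  next
    case (Cons \<alpha> xs)
    then have "lin_reflection \<alpha> \<otimes>\<^bsub>G\<^esub> (0, rprod xs) \<in> generate G (lin_reflection ` J)"
      by (intro generate.eng[OF generate.incl]) auto
    then show ?case
      unfolding ext_affine_simps(3) rprod_simps fst_conv snd_conv linear_0[OF linear_reflection] add_0 .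
  qed
  then show "Pair 0 ` rprod ` lists J \<subseteq> generate G (lin_reflection ` J)" by auto
qed

text \<open>Products of linear reflections have zero translation part, so the words to be compared
  are words in reflections from \<open>J\<close>, to which \<open>least_length\<close>
  applies.\<close>

lemma word_length_lin:
  assumes J: "J \<subseteq> D" and w: "w \<in> rprod ` lists J"
  shows "word_length G (lin_reflection ` J) (0, w) = inversions w"
proof -
  obtain ys where ys: "set ys \<subseteq> J" "w = rprod ys" using w by auto
  have JR: "J \<subseteq> R" using J simple_root by blast
  have "(\<exists>xs. set xs \<subseteq> lin_reflection ` J \<and> length xs = k \<and> foldr (\<otimes>\<^bsub>G\<^esub>) xs \<one>\<^bsub>G\<^esub> = (0, w))
     \<longleftrightarrow> (\<exists>ys. set ys \<subseteq> J \<and> length ys = k \<and> rprod ys = w)" (is "?A \<longleftrightarrow> ?B") for k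
  proof
    assume ?A
    then obtain xs where xs: "set xs \<subseteq> lin_reflection ` J" "length xs = k" "foldr (\<otimes>\<^bsub>G\<^esub>) xs \<one>\<^bsub>G\<^esub> = (0, w)"
      by blast
    have "xs \<in> lists (lin_reflection ` J)" using xs(1) by (simp add: lists_eq_set)
    then have "xs \<in> map lin_reflection ` lists J" unfolding lists_image .
    then obtain zs where zs: "set zs \<subseteq> J" "xs = map lin_reflection zs" by auto
    then have "set zs \<subseteq> R" using JR by blast
    from foldr_lin[OF this] have "rprod zs = w" using xs(3) unfolding zs(2) by simp
    then show ?B using zs xs(2) by (intro exI[of _ zs]) simp
  next
    assume ?B
    then obtain zs where zs: "set zs \<subseteq> J" "length zs = k" "rprod zs = w" by blast
    then have "set zs \<subseteq> R" using JR by blast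
    from foldr_lin[OF this] show ?A
      using zs by (intro exI[of _ "map lin_reflection zs"]) auto
  qed
  then show ?thesis
    unfolding word_length_def using least_length[OF J ys(1)] ys(2) by simp
qed

text \<open>Maximal length gives the sign condition, and the sign condition determines the element;
  so the definite description picks out \<open>w\<close>.\<close>

lemma longest_element_lin:
  assumes J: "J \<subseteq> D" and w: "longest J w"
  shows "longest_element G (lin_reflection ` J) = (0, w)"
proof -
  obtain u where u: "longest J u" "\<And>z. z \<in> rprod ` lists J \<Longrightarrow> inversions z \<le> inversions u"
    using longest_exists[OF J] by blast
  have uw: "u = w" by (rule longest_unique[OF J u(1) w])
  have wJ: "w \<in> rprod ` lists J" using w by (simp add: longest_def)
  show ?thesis
    unfolding longest_element_def generate_lin[OF J]
  proof (rule the_equality)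
    show "(0, w) \<in> Pair 0 ` rprod ` lists J \<and>
        (\<forall>v\<in>Pair 0 ` rprod ` lists J. word_length G (lin_reflection ` J) v \<le> word_length G (lin_reflection ` J) (0, w))"
      using wJ u(2) uw by (auto simp: word_length_lin[OF J])
  next
    fix x assume x: "x \<in> Pair 0 ` rprod ` lists J \<and>
        (\<forall>v\<in>Pair 0 ` rprod ` lists J. word_length G (lin_reflection ` J) v \<le> word_length G (lin_reflection ` J) x)"
    then obtain z where z: "z \<in> rprod ` lists J" "x = (0, z)" by blast
    have "inversions y \<le> inversions z" if "y \<in> rprod ` lists J" for y
    proof -
      have "word_length G (lin_reflection ` J) (0, y) \<le> word_length G (lin_reflection ` J) (0, z)"
        using x that z by blast
      then show ?thesis unfolding word_length_lin[OF J that] word_length_lin[OF J z(1)] .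
    qed
    then have "longest J z" by (rule longest_if_max[OF J z(1)])
    then show "x = (0, w)" using longest_unique[OF J _ w] z by simp
  qed
qed

section \<open>Heights of coroots\<close>

definition rho :: 'a where "rho = (\<Sum>\<beta>\<in>D. \<omega> \<beta>)"

definition ht :: "'a \<Rightarrow> real" where "ht \<alpha> = inner rho (coroot \<alpha>)"

lemma ht_sum: "ht \<alpha> = (\<Sum>\<beta>\<in>D. inner (\<omega> \<beta>) (coroot \<alpha>))"
  by (simp add: ht_def rho_def inner_sum_left)

lemma ht_minus: "ht (- \<alpha>) = - ht \<alpha>"
  by (simp add: ht_def)

lemma ht_simple: "\<alpha> \<in> D \<Longrightarrow> ht \<alpha> = 1"
  by (simp add: ht_sum fund_weight finite_D)

lemma ht_nat:
  assumes "\<alpha> \<in> Pos"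
  obtains n :: "'a \<Rightarrow> nat" where "\<And>\<beta>. \<beta> \<in> D \<Longrightarrow> inner (\<omega> \<beta>) (coroot \<alpha>) = real (n \<beta>)"
    "ht \<alpha> = real (\<Sum>\<beta>\<in>D. n \<beta>)" "(\<Sum>\<beta>\<in>D. n \<beta>) \<ge> 1"
proof -
  obtain n :: "'a \<Rightarrow> nat" where n: "coroot \<alpha> = (\<Sum>\<beta>\<in>D. real (n \<beta>) *\<^sub>R coroot \<beta>)"
    using coroot_comb[OF assms] by blast
  have w: "inner (\<omega> \<beta>) (coroot \<alpha>) = real (n \<beta>)" if "\<beta> \<in> D" for \<beta>
    unfolding n by (rule inner_weight_comb[OF that finite_D])
  then have h: "ht \<alpha> = real (\<Sum>\<beta>\<in>D. n \<beta>)" by (simp add: ht_sum)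
  have "(\<Sum>\<beta>\<in>D. n \<beta>) \<noteq> 0"
  proof
    assume "(\<Sum>\<beta>\<in>D. n \<beta>) = 0"
    then have "coroot \<alpha> = 0" unfolding n using finite_D by simp
    then show False using nonzero[OF pos_root[OF assms]] by simp
  qed
  then show ?thesis using that[of n] w h by simp
qed

lemma ht_ge_1: "\<alpha> \<in> Pos \<Longrightarrow> ht \<alpha> \<ge> 1"
proof -
  assume "\<alpha> \<in> Pos"
  then obtain n :: "'a \<Rightarrow> nat" where n: "ht \<alpha> = real (\<Sum>\<beta>\<in>D. n \<beta>)" "(\<Sum>\<beta>\<in>D. n \<beta>) \<ge> 1"
    using ht_nat by blast
  show ?thesis using n(2) of_nat_le_iff[of 1 "\<Sum>\<beta>\<in>D. n \<beta>", where 'a = real] unfolding n(1) by (simp only: of_nat_1)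
qed

text \<open>The height is a sum of natural coordinates, so exactly one of them is nonzero and the
  root is simple.\<close>

lemma ht_eq_1:
  assumes "\<alpha> \<in> Pos" "ht \<alpha> = 1" shows "\<alpha> \<in> D"
proof -
  obtain n :: "'a \<Rightarrow> nat" where n: "\<And>\<beta>. \<beta> \<in> D \<Longrightarrow> inner (\<omega> \<beta>) (coroot \<alpha>) = real (n \<beta>)"
    "ht \<alpha> = real (\<Sum>\<beta>\<in>D. n \<beta>)"
    using ht_nat[OF assms(1)] by blast
  then have "real (\<Sum>\<beta>\<in>D. n \<beta>) = real 1" using assms(2) by simp
  then have "(\<Sum>\<beta>\<in>D. n \<beta>) = 1" by (simp only: of_nat_eq_iff)
  then obtain \<beta> where \<beta>: "\<beta> \<in> D" "n \<beta> = 1" "\<forall>\<gamma>\<in>D. \<beta> \<noteq> \<gamma> \<longrightarrow> n \<gamma> = 0"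
    using sum_eq_1_iff[OF finite_D, of n] by blast
  have "\<alpha> = \<beta>"
  proof (rule simple_if_weights[OF \<beta>(1) assms(1)])
    fix \<delta> assume "\<delta> \<in> D" "\<delta> \<noteq> \<beta>"
    then have "inner (\<omega> \<delta>) (coroot \<alpha>) = 0" using n \<beta> by auto
    then show "inner (\<omega> \<delta>) \<alpha> = 0" using nonzero[OF pos_root[OF assms(1)]] by (simp add: inner_coroot)
  qed
  then show ?thesis using \<beta> by simp
qed

end

context irr_root_data
begin

text \<open>This is the Coxeter number, computed from the coroot system.\<close>

definition cox :: real where "cox = 1 + ht \<phi>"

lemma cox_ge: "cox \<ge> 2"
  using ht_ge_1[OF affine_root_pos] by (simp add: cox_def)

lemma ht_le: "\<alpha> \<in> R \<Longrightarrow> ht \<alpha> \<le> cox - 1"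
  unfolding ht_sum[of \<alpha>] cox_def ht_sum[of \<phi>] using theta_ge by (auto intro: sum_mono)

lemma ht_ge: "\<alpha> \<in> R \<Longrightarrow> ht \<alpha> \<ge> - (cox - 1)"
  using ht_le[of "- \<alpha>"] by (simp add: ht_minus)

text \<open>Each coordinate is at most that of the highest coroot, so equal sums force equal
  coordinates.\<close>

lemma ht_max:
  assumes "\<alpha> \<in> R" "ht \<alpha> = cox - 1" shows "\<alpha> = \<phi>"
proof -
  have "(\<Sum>\<beta>\<in>D. inner (\<omega> \<beta>) (coroot \<phi>) - inner (\<omega> \<beta>) (coroot \<alpha>)) = 0"
    using assms(2) by (simp add: cox_def ht_sum sum_subtractf)
  then have "\<forall>\<beta>\<in>D. inner (\<omega> \<beta>) (coroot \<phi>) - inner (\<omega> \<beta>) (coroot \<alpha>) = 0"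
    using theta_ge[OF _ assms(1)] by (subst (asm) sum_nonneg_eq_0_iff) (auto simp: finite_D)
  then have "coroot \<phi> = coroot \<alpha>"
    using coroot_expansion[of "coroot \<phi>"] coroot_expansion[of "coroot \<alpha>"] by simp
  then show ?thesis using coroot_inj assms affine_root(1) by (metis inj_onD)
qed

text \<open>The map \<open>x \<mapsto> x - (inner x (coroot \<alpha>) + k) \<alpha>\<close>, the
  reflection in the zero set of the affine root with constant term \<open>k\<close>. With this sign
  \<open>refl0\<close> belongs to the constant term -1.\<close>

definition affine_reflection :: "'a \<Rightarrow> int \<Rightarrow> 'a \<times> ('a \<Rightarrow> 'a)" where
  "affine_reflection \<alpha> k = (- (real_of_int k *\<^sub>R \<alpha>), reflection \<alpha>)"

lemma refl0_eq: "refl0 R Pos = affine_reflection \<phi> (-1)"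
  unfolding refl0_def reflection_coroot inv_lin_reflection[OF affine_root(1)]
  by (simp add: affine_reflection_def)

text \<open>With \<open>h = cox\<close>, the affine root \<open>\<alpha>\<^sup>\<or> + k\<close> takes the value \<open>(ht \<alpha> + k h) / h\<close> at \<open>rho / h\<close>. Its
  absolute value is minimal exactly for the walls of the fundamental alcove.\<close>

lemma affine_gens_eq:
  "affine_gens R Pos = {affine_reflection \<alpha> k | \<alpha> k. \<alpha> \<in> R \<and> \<bar>ht \<alpha> + real_of_int k * cox\<bar> = 1}"
proof (intro equalityI subsetI)
  fix s assume "s \<in> affine_gens R Pos"
  then consider "s = affine_reflection \<phi> (-1)" | \<alpha> where "\<alpha> \<in> D" "s = lin_reflection \<alpha>"
    unfolding affine_gens_def refl0_eq by auto
  then show "s \<in> {affine_reflection \<alpha> k | \<alpha> k. \<alpha> \<in> R \<and> \<bar>ht \<alpha> + real_of_int k * cox\<bar> = 1}"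
  proof cases
    case 1
    moreover have "\<bar>ht \<phi> + real_of_int (-1) * cox\<bar> = 1" by (simp add: cox_def)
    ultimately show ?thesis using affine_root(1) by blast
  next
    case 2
    then have "s = affine_reflection \<alpha> 0" "\<alpha> \<in> R" "\<bar>ht \<alpha> + real_of_int 0 * cox\<bar> = 1"
      using simple_root ht_simple by (auto simp: affine_reflection_def)
    then show ?thesis by blast
  qed
next
  fix s assume "s \<in> {affine_reflection \<alpha> k | \<alpha> k. \<alpha> \<in> R \<and> \<bar>ht \<alpha> + real_of_int k * cox\<bar> = 1}"
  then obtain \<alpha>0 k0 where s0: "s = affine_reflection \<alpha>0 k0" "\<alpha>0 \<in> R" "\<bar>ht \<alpha>0 + real_of_int k0 * cox\<bar> = 1"
    by blast
  obtain \<alpha> k where s: "s = affine_reflection \<alpha> k" "\<alpha> \<in> Pos" "\<bar>ht \<alpha> + real_of_int k * cox\<bar> = 1"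
  proof (cases "\<alpha>0 \<in> Pos")
    case True
    then show ?thesis using that s0 by blast
  next
    case False
    have "s = affine_reflection (- \<alpha>0) (- k0)"
      using s0(1) by (simp add: affine_reflection_def reflection_minus)
    moreover have "- \<alpha>0 \<in> Pos" using False neg_pos_iff s0 by blast
    moreover have "\<bar>ht (- \<alpha>0) + real_of_int (- k0) * cox\<bar> = 1" using s0(3) by (simp add: ht_minus)
    ultimately show ?thesis by (rule that)
  qed
  \<comment> \<open>The height of a positive root lies between 1 and \<open>cox - 1\<close>, so only
    the constant terms 0 and -1 can bring the value to 1 or -1.\<close>
  have t: "ht \<alpha> \<ge> 1" "ht \<alpha> \<le> cox - 1" using ht_ge_1[OF s(2)] ht_le[OF pos_root[OF s(2)]] .
  have "\<not> k \<ge> 1"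
  proof
    assume "k \<ge> 1"
    then have "1 * cox \<le> real_of_int k * cox" using cox_ge by (intro mult_right_mono) auto
    then show False using t cox_ge s(3) by linarith
  qed
  moreover have "\<not> k \<le> -2"
  proof
    assume "k \<le> -2"
    then have "real_of_int k * cox \<le> (-2) * cox" using cox_ge by (intro mult_right_mono) auto
    then show False using t cox_ge s(3) by linarith
  qed
  ultimately consider "k = 0" | "k = -1" by linarith
  then show "s \<in> affine_gens R Pos"
  proof cases
    case 1
    then have "ht \<alpha> = 1" using s(3) t by simp
    then have "\<alpha> \<in> D" using ht_eq_1 s(2) by blast
    moreover have "s = lin_reflection \<alpha>" using s(1) 1 by (simp add: affine_reflection_def)
    ultimately show ?thesis by (simp add: affine_gens_def)
  next
    case 2
    then have "ht \<alpha> = cox - 1" using s(3) t by simp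
    then have "\<alpha> = \<phi>" using ht_max pos_root s(2) by blast
    then show ?thesis using s(1) 2 by (simp add: affine_gens_def refl0_eq)
  qed
qed

lemma affine_gens_closed: "affine_gens R Pos \<subseteq> Q \<times> W"
proof
  fix s assume "s \<in> affine_gens R Pos"
  then obtain \<alpha> k where s: "s = affine_reflection \<alpha> k" "\<alpha> \<in> R" unfolding affine_gens_eq by blast
  then show "s \<in> Q \<times> W"
    using root_lattice_neg[OF root_lattice_scale[OF root_in_lattice]] weyl_refl
    by (simp add: affine_reflection_def)
qed

definition alcove_point :: 'a where "alcove_point = (1 / cox) *\<^sub>R rho"

definition Stab :: "('a \<times> ('a \<Rightarrow> 'a)) set" where
  "Stab = {g \<in> carrier G. fst g + snd g alcove_point = alcove_point}"

lemma inner_alcove_point: "cox * inner alcove_point (coroot \<alpha>) = ht \<alpha>"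
  using cox_ge by (simp add: alcove_point_def ht_def)

lemma subgroup_Stab: "subgroup Stab G"
proof -
  interpret G: group G by (rule group_G)
  show ?thesis
  proof (rule G.subgroupI)
    show "Stab \<subseteq> carrier G" by (auto simp: Stab_def)
    have "\<one>\<^bsub>G\<^esub> \<in> Stab" using G.one_closed by (auto simp: Stab_def)
    then show "Stab \<noteq> {}" by blast
    show "x \<otimes>\<^bsub>G\<^esub> y \<in> Stab" if xy: "x \<in> Stab" "y \<in> Stab" for x y
    proof -
      have "linear (snd x)" using xy weyl_linear by (auto simp: Stab_def)
      then have "fst (x \<otimes>\<^bsub>G\<^esub> y) + snd (x \<otimes>\<^bsub>G\<^esub> y) alcove_point = fst x + snd x (fst y + snd y alcove_point)"
        by (simp add: linear_add)
      then show ?thesis using xy G.m_closed[of x y] by (simp add: Stab_def del: ext_affine_simps)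
    qed
    show "inv\<^bsub>G\<^esub> x \<in> Stab" if x: "x \<in> Stab" for x
    proof -
      have xc: "x \<in> carrier G" and fx: "fst x + snd x alcove_point = alcove_point"
        using x by (auto simp: Stab_def)
      let ?y = "inv\<^bsub>G\<^esub> x"
      have y: "?y \<in> carrier G" using xc by (rule G.inv_closed)
      have "linear (snd ?y)" using y weyl_linear by auto
      then have "fst ?y + snd ?y (fst x + snd x alcove_point)
          = fst (?y \<otimes>\<^bsub>G\<^esub> x) + snd (?y \<otimes>\<^bsub>G\<^esub> x) alcove_point"
        by (simp add: linear_add)
      also have "\<dots> = alcove_point" unfolding G.l_inv[OF xc] by simp
      finally show ?thesis using y fx by (simp add: Stab_def del: ext_affine_simps)
    qed
  qed
qed

text \<open>Conjugation carries the reflection in an affine root to the reflection in the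
  transported affine root. At a point fixed by \<open>g\<close> both affine roots have the same
  value, and by \<open>affine_gens_eq\<close> this value decides whether the reflection is a
  generator.\<close>

lemma Stab_conj:
  assumes g: "g \<in> Stab" and s: "s \<in> affine_gens R Pos"
  shows "g \<otimes>\<^bsub>G\<^esub> s \<otimes>\<^bsub>G\<^esub> inv\<^bsub>G\<^esub> g \<in> affine_gens R Pos"
proof -
  interpret G: group G by (rule group_G)
  obtain \<alpha> k where \<alpha>: "s = affine_reflection \<alpha> k" "\<alpha> \<in> R" "\<bar>ht \<alpha> + real_of_int k * cox\<bar> = 1"
    using s unfolding affine_gens_eq by blast
  obtain l w where lw: "g = (l, w)" "l \<in> weight_lattice Pos" "w \<in> W" and fix_p: "l + w alcove_point = alcove_point"
    using g by (auto simp: Stab_def)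
  define \<beta> where "\<beta> = w \<alpha>"
  have \<beta>: "\<beta> \<in> R" unfolding \<beta>_def by (rule weyl_root[OF lw(3) \<alpha>(2)])
  obtain m where m: "inner l (coroot \<beta>) = real_of_int m"
    using weight_lattice_int[OF lw(2) \<beta>] by (auto elim: Ints_cases)
  \<comment> \<open>Transporting the affine root along a translation by \<open>l\<close> lowers its
    constant term by the pairing \<open>m\<close> of \<open>l\<close> with the new coroot.\<close>
  define s' where "s' = affine_reflection \<beta> (k - m)"
  have lin: "linear w" by (rule weyl_linear[OF lw(3)])
  have "g \<otimes>\<^bsub>G\<^esub> s = s' \<otimes>\<^bsub>G\<^esub> g"
  proof -
    have "w \<circ> reflection \<alpha> = reflection \<beta> \<circ> w"
      unfolding \<beta>_def using conj_reflection[OF lin weyl_inner[OF lw(3)]] by (simp add: fun_eq_iff)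
    moreover have "l + w (- (real_of_int k *\<^sub>R \<alpha>)) = - (real_of_int (k - m) *\<^sub>R \<beta>) + reflection \<beta> l"
      by (simp add: linear_neg[OF lin] linear_scale[OF lin] \<beta>_def[symmetric] reflection_def m scaleR_left_diff_distrib)
    ultimately show ?thesis
      unfolding lw(1) \<alpha>(1) s'_def affine_reflection_def ext_affine_simps fst_conv snd_conv by simp
  qed
  moreover have s'S: "s' \<in> affine_gens R Pos"
  proof -
    have "inner l (coroot \<beta>) + inner (w alcove_point) (coroot \<beta>) = inner alcove_point (coroot \<beta>)"
      using arg_cong[OF fix_p, of "\<lambda>z. inner z (coroot \<beta>)"] by (simp add: inner_add_left)
    moreover have "inner (w alcove_point) (coroot \<beta>) = inner alcove_point (coroot \<alpha>)"
      unfolding \<beta>_def weyl_coroot[OF lw(3)] by (rule weyl_inner[OF lw(3)])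
    ultimately have "real_of_int m + inner alcove_point (coroot \<alpha>) = inner alcove_point (coroot \<beta>)"
      using m by simp
    then have "cox * real_of_int m + ht \<alpha> = ht \<beta>"
      unfolding inner_alcove_point[symmetric] by (simp add: distrib_left[symmetric])
    then have "ht \<beta> + real_of_int (k - m) * cox = ht \<alpha> + real_of_int k * cox"
      by (simp add: algebra_simps)
    then show ?thesis using \<alpha>(3) \<beta> unfolding affine_gens_eq s'_def by fastforce
  qed
  moreover have "s' \<in> carrier G"
    using s'S affine_gens_closed root_lattice_subset by auto
  moreover have "g \<in> carrier G" using lw by auto
  ultimately have "g \<otimes>\<^bsub>G\<^esub> s \<otimes>\<^bsub>G\<^esub> inv\<^bsub>G\<^esub> g = s'"
    by (simp only: G.m_assoc G.r_inv G.inv_closed G.r_one)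
  then show ?thesis using s'S by simp
qed

text \<open>The alcove point pairs with all coroots to less than 1 in absolute value. The
  translation part is the difference of the point and its image under \<open>w\<close>, so it pairs
  to less than 2 and vanishes. Then \<open>w\<close> preserves heights, hence positive
  roots.\<close>

lemma Stab_affine_trivial:
  assumes "g \<in> Stab" "fst g \<in> Q"
  shows "g = \<one>\<^bsub>G\<^esub>"
proof -
  obtain l w where lw: "g = (l, w)" "l \<in> Q" "w \<in> W" and fix_p: "l + w alcove_point = alcove_point"
    using assms by (auto simp: Stab_def)
  obtain w' where w': "w' \<in> W" "w \<circ> w' = id" using weyl_inverse[OF lw(3)] by blast
  have ww': "w (w' x) = x" for x using w'(2) by (metis comp_apply id_apply)
  have bound: "\<bar>inner alcove_point (coroot \<gamma>)\<bar> < 1" if "\<gamma> \<in> R" for \<gamma>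
  proof -
    have "\<bar>cox * inner alcove_point (coroot \<gamma>)\<bar> < cox * 1"
      unfolding inner_alcove_point using ht_le[OF that] ht_ge[OF that] by (simp add: abs_less_iff)
    then show ?thesis using cox_ge by (simp add: abs_mult)
  qed
  have w'p: "inner (w alcove_point) (coroot \<gamma>) = inner alcove_point (coroot (w' \<gamma>))" for \<gamma>
    using weyl_inner[OF lw(3), of alcove_point "w' (coroot \<gamma>)"] by (simp add: ww' weyl_coroot[OF w'(1)])
  have l: "l = alcove_point - w alcove_point" using fix_p by (simp add: eq_diff_eq)
  have "l = 0"
  proof (rule ccontr)
    assume "l \<noteq> 0"
    then obtain \<beta> where \<beta>: "\<beta> \<in> R" "inner l (coroot \<beta>) \<ge> 2"
      using root_lattice_large_coordinate[OF lw(2)] by blast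
    have "inner l (coroot \<beta>) = inner alcove_point (coroot \<beta>) - inner alcove_point (coroot (w' \<beta>))"
      unfolding l by (simp add: inner_diff_left w'p)
    then show False using \<beta>(2) bound[OF \<beta>(1)] bound[OF weyl_root[OF w'(1) \<beta>(1)]] by linarith
  qed
  moreover have "w = id"
  proof (rule inversions_zero[OF lw(3)])
    fix \<alpha> assume \<alpha>: "\<alpha> \<in> Pos"
    have "w alcove_point = alcove_point" using l \<open>l = 0\<close> by simp
    then have "inner alcove_point (coroot (w \<alpha>)) = inner alcove_point (coroot \<alpha>)"
      using weyl_inner[OF lw(3), of alcove_point "coroot \<alpha>"] by (simp add: weyl_coroot[OF lw(3)])
    then have "ht (w \<alpha>) = ht \<alpha>" unfolding inner_alcove_point[symmetric] by simp
    then have "ht (- w \<alpha>) < 1" using ht_ge_1[OF \<alpha>] by (simp add: ht_minus)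
    then have "- w \<alpha> \<notin> Pos" using ht_ge_1[of "- w \<alpha>"] by auto
    then show "w \<alpha> \<in> Pos" using neg_pos_iff[OF weyl_root[OF lw(3) pos_root[OF \<alpha>]]] by simp
  qed
  ultimately show ?thesis using lw(1) by simp
qed

text \<open>An omega element \<open>t\<^bsub>\<omega>\<^esub> b a\<close>, with \<open>a\<close> and \<open>b\<close> the longest elements, fixes \<open>rho / h\<close> because
  \<open>a rho = - rho\<close> and \<open>b \<alpha>\<close> is the root of maximal height.\<close>

lemma ht_longest:
  assumes "J \<subseteq> D" "longest J w" "\<beta> \<in> J"
  shows "ht (w \<beta>) = -1"
  using ht_simple[OF longest_simple[OF assms]] by (simp add: ht_minus)

lemma omega_elt_Stab:
  assumes \<alpha>: "\<alpha> \<in> D" and min: "minuscule Pos (\<omega> \<alpha>)"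
  shows "omega_elt R Pos \<alpha> \<in> Stab" "fst (omega_elt R Pos \<alpha>) = \<omega> \<alpha>"
proof -
  interpret G: group G by (rule group_G)
  define J where "J = D - {\<alpha>}"
  have J: "J \<subseteq> D" by (auto simp: J_def)
  obtain a where a: "longest D a" using longest_exists[OF order.refl] by blast
  obtain b where b: "longest J b" using longest_exists[OF J] by blast
  have aW: "a \<in> W" and bW: "b \<in> W" and bJ: "b \<in> rprod ` lists J"
    using a b parabolic_weyl[OF order.refl] parabolic_weyl[OF J] by (auto simp: longest_def)
  have aa: "a (a x) = x" for x using longest_comp[OF order.refl a a] by (metis comp_apply id_apply)
  have bb: "b (b x) = x" for x using longest_comp[OF J b b] by (metis comp_apply id_apply)
  have lina: "linear a" and linb: "linear b" using weyl_linear aW bW by auto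
  have "longest_element G (lin_reflection ` D) \<otimes>\<^bsub>G\<^esub> longest_element G (lin_reflection ` J) = (0, a \<circ> b)"
    using longest_element_lin[OF order.refl a] longest_element_lin[OF J b] by (simp add: linear_0[OF lina])
  moreover have "inv\<^bsub>G\<^esub> (0, a \<circ> b) = (0, b \<circ> a)"
  proof (rule G.inv_equality)
    show "(0, b \<circ> a) \<otimes>\<^bsub>G\<^esub> (0, a \<circ> b) = \<one>\<^bsub>G\<^esub>"
      by (simp add: fun_eq_iff aa bb linear_0[OF lina] linear_0[OF linb])
  qed (intro lin_closed weyl_comp aW bW)+
  ultimately have elt: "omega_elt R Pos \<alpha> = (\<omega> \<alpha>, b \<circ> a)"
    unfolding omega_elt_def Let_def J_def[symmetric] by simp
  then show "fst (omega_elt R Pos \<alpha>) = \<omega> \<alpha>" by simp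
  have a_rho: "inner (a rho) (coroot \<beta>) = ht (a \<beta>)" for \<beta>
    using weyl_inner[OF aW, of rho "a (coroot \<beta>)"] by (simp add: aa ht_def weyl_coroot[OF aW])
  have a_rho': "a rho = - rho"
    by (rule eq_by_coroots) (simp add: a_rho ht_longest[OF order.refl a] ht_def[symmetric] ht_simple)
  have b_rho: "inner (b rho) (coroot \<beta>) = ht (b \<beta>)" for \<beta>
    using weyl_inner[OF bW, of rho "b (coroot \<beta>)"] by (simp add: bb ht_def weyl_coroot[OF bW])
  have b_omega: "inner (\<omega> \<alpha>) (b x) = inner (\<omega> \<alpha>) x" for x
    using parabolic_weight[OF J bJ] \<alpha> by (simp add: J_def)
  have one: "inner (\<omega> \<alpha>) (coroot \<phi>) = 1"
    using min affine_root_pos theta_pos[OF \<alpha>] by (auto simp: minuscule_def)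
  \<comment> \<open>The highest coroot exceeds the coroot of \<open>b \<alpha>\<close> by
    nonnegative coordinates \<open>c\<close>, with none at \<open>\<alpha>\<close> because both have
    coordinate 1 there. Applying \<open>b\<close> negates the height of the difference; as
    \<open>b \<phi>\<close> is positive, its height is at least that of \<open>\<alpha>\<close>, so
    all of \<open>c\<close> must vanish.\<close>
  have ht_b: "ht (b \<alpha>) = cox - 1"
  proof -
    define c where "c = (\<lambda>\<beta>. inner (\<omega> \<beta>) (coroot \<phi> - coroot (b \<alpha>)))"
    have c0: "c \<beta> \<ge> 0" if "\<beta> \<in> D" for \<beta>
      using theta_ge[OF that weyl_root[OF bW simple_root[OF \<alpha>]]] by (simp add: c_def inner_diff_right)
    have c\<alpha>: "c \<alpha> = 0"
      using one fund_weight[OF \<alpha> \<alpha>] by (simp add: c_def inner_diff_right weyl_coroot[OF bW] b_omega)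
    have "coroot \<phi> - coroot (b \<alpha>) = (\<Sum>\<beta>\<in>D. c \<beta> *\<^sub>R coroot \<beta>)"
      unfolding c_def by (rule coroot_expansion)
    also have "\<dots> = (\<Sum>\<beta>\<in>J. c \<beta> *\<^sub>R coroot \<beta>)"
      using finite_D c\<alpha> by (intro sum.mono_neutral_right) (auto simp: J_def)
    finally have e: "coroot \<phi> - coroot (b \<alpha>) = (\<Sum>\<beta>\<in>J. c \<beta> *\<^sub>R coroot \<beta>)" .
    have "inner (b rho) (coroot \<phi> - coroot (b \<alpha>)) = (\<Sum>\<beta>\<in>J. c \<beta> * ht (b \<beta>))"
      unfolding e by (simp add: inner_sum_right b_rho)
    also have "\<dots> = (\<Sum>\<beta>\<in>J. - c \<beta>)"
      by (intro sum.cong) (auto simp: ht_longest[OF J b])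
    finally have "ht (b \<phi>) - ht \<alpha> = - (\<Sum>\<beta>\<in>J. c \<beta>)"
      by (simp add: inner_diff_right b_rho bb sum_negf)
    moreover have "ht (b \<phi>) \<ge> 1"
    proof -
      have "inner (\<omega> \<alpha>) \<phi> \<noteq> 0" using one by (auto simp: inner_coroot)
      then have "b \<phi> \<in> Pos" using longest_pos[OF J b affine_root_pos] \<alpha> by (auto simp: J_def)
      then show ?thesis by (rule ht_ge_1)
    qed
    ultimately have "(\<Sum>\<beta>\<in>J. c \<beta>) \<le> 0" using ht_simple[OF \<alpha>] by simp
    moreover have "(\<Sum>\<beta>\<in>J. c \<beta>) \<ge> 0" using c0 J by (intro sum_nonneg) auto
    ultimately have s0: "(\<Sum>\<beta>\<in>J. c \<beta>) = 0" by simp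
    have "ht \<phi> - ht (b \<alpha>) = (\<Sum>\<beta>\<in>J. c \<beta> * ht \<beta>)"
      using arg_cong[OF e, of "inner rho"] by (simp add: inner_diff_right inner_sum_right ht_def)
    also have "\<dots> = (\<Sum>\<beta>\<in>J. c \<beta>)" using J by (intro sum.cong) (auto simp: ht_simple)
    finally show ?thesis using s0 by (simp add: cox_def)
  qed
  \<comment> \<open>On the coroot of \<open>\<alpha>\<close> the value is h - (h - 1), on every
    other simple coroot it is 0 - (-1); both are 1, the value of \<open>rho\<close>.\<close>
  have "cox *\<^sub>R \<omega> \<alpha> + b (a rho) = rho"
  proof (rule eq_by_coroots)
    fix \<beta> assume \<beta>: "\<beta> \<in> D"
    have e: "inner (cox *\<^sub>R \<omega> \<alpha> + b (a rho)) (coroot \<beta>) = (if \<beta> = \<alpha> then cox else 0) - ht (b \<beta>)"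
      unfolding a_rho' using fund_weight[OF \<alpha> \<beta>] by (simp add: inner_add_left inner_diff_left linear_neg[OF linb] b_rho)
    have "\<dots> = 1"
      using ht_b ht_longest[OF J b, of \<beta>] \<beta> by (cases "\<beta> = \<alpha>") (auto simp: J_def)
    then show "inner (cox *\<^sub>R \<omega> \<alpha> + b (a rho)) (coroot \<beta>) = inner rho (coroot \<beta>)"
      using e ht_simple[OF \<beta>] by (simp add: ht_def)
  qed
  then have "(1 / cox) *\<^sub>R (cox *\<^sub>R \<omega> \<alpha> + b (a rho)) = alcove_point" by (simp add: alcove_point_def)
  then have "\<omega> \<alpha> + b (a alcove_point) = alcove_point"
    using cox_ge by (simp add: scaleR_right_distrib alcove_point_def linear_scale[OF lina] linear_scale[OF linb])
  then show "omega_elt R Pos \<alpha> \<in> Stab"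
    unfolding Stab_def elt using fund_weight_in_lattice[OF \<alpha>] weyl_comp[OF bW aW] by simp
qed

lemma Omega_representative:
  assumes "x \<in> weight_lattice Pos"
  shows "\<exists>g\<in>Omega R Pos. g \<in> Stab \<and> x - fst g \<in> Q"
  using minuscule_representative[OF assms]
proof (elim disjE bexE conjE)
  assume "x \<in> Q"
  then show ?thesis
    using subgroup.one_closed[OF subgroup_Stab] by (intro bexI[of _ "\<one>\<^bsub>G\<^esub>"]) (auto simp: Omega_def)
next
  fix \<beta> assume "\<beta> \<in> D" "minuscule Pos (\<omega> \<beta>)" "x - \<omega> \<beta> \<in> Q"
  then show ?thesis
    using omega_elt_Stab[of \<beta>] by (intro bexI[of _ "omega_elt R Pos \<beta>"]) (auto simp: Omega_def)
qed

text \<open>The Weyl group acts trivially modulo \<open>Q\<close>, so the translation part of a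
  product has the sum of the classes of the factors.\<close>

lemma class_difference:
  assumes x: "x \<in> carrier G" and g: "g \<in> carrier G" and d: "fst x - fst g \<in> Q"
  shows "x \<otimes>\<^bsub>G\<^esub> inv\<^bsub>G\<^esub> g \<in> Q \<times> W"
proof -
  interpret G: group G by (rule group_G)
  define u where "u = x \<otimes>\<^bsub>G\<^esub> inv\<^bsub>G\<^esub> g"
  have u: "u \<in> carrier G" unfolding u_def using x g by (intro G.m_closed G.inv_closed)
  have "u \<otimes>\<^bsub>G\<^esub> g = x" unfolding u_def using x g by (simp only: G.m_assoc G.inv_closed G.l_inv G.r_one)
  then have e: "fst x = fst u + snd u (fst g)" by (metis ext_affine_simps(3) fst_conv)
  have d': "snd u (fst g) - fst g \<in> Q"
    using u g weyl_lattice(1)[of "snd u" "fst g"] unfolding ext_affine_simps(1) by (simp add: mem_Times_iff)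
  have "fst u = (fst x - fst g) - (snd u (fst g) - fst g)" unfolding e by simp
  then have "fst u \<in> Q" using root_lattice_diff[OF d d'] by simp
  then show ?thesis using u unfolding u_def[symmetric] ext_affine_simps(1) by (simp add: mem_Times_iff)
qed

text \<open>An element of the stabilizer and the element of \<open>Omega\<close> in its class differ
  by an element of the stabilizer over \<open>Q\<close>, which is trivial. In particular
  \<open>Omega\<close> is a group.\<close>

lemma Omega_eq_Stab: "Omega R Pos = Stab"
proof
  show "Omega R Pos \<subseteq> Stab"
    using omega_elt_Stab(1) subgroup.one_closed[OF subgroup_Stab] by (auto simp: Omega_def)
  show "Stab \<subseteq> Omega R Pos"
  proof
    interpret G: group G by (rule group_G)
    interpret S: subgroup Stab G by (rule subgroup_Stab)
    fix x assume x: "x \<in> Stab"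
    then have "x \<in> carrier G" by (rule S.mem_carrier)
    then have "fst x \<in> weight_lattice Pos" by auto
    then obtain g where g: "g \<in> Omega R Pos" "g \<in> Stab" "fst x - fst g \<in> Q"
      using Omega_representative by blast
    have gx: "g \<in> carrier G" using g(2) by (rule S.mem_carrier)
    have "x \<otimes>\<^bsub>G\<^esub> inv\<^bsub>G\<^esub> g \<in> Q \<times> W" using \<open>x \<in> carrier G\<close> gx g(3) by (rule class_difference)
    then have "fst (x \<otimes>\<^bsub>G\<^esub> inv\<^bsub>G\<^esub> g) \<in> Q" by (metis SigmaE fst_conv)
    moreover have "x \<otimes>\<^bsub>G\<^esub> inv\<^bsub>G\<^esub> g \<in> Stab" using x g by (intro S.m_closed S.m_inv_closed)
    ultimately have "x \<otimes>\<^bsub>G\<^esub> inv\<^bsub>G\<^esub> g = \<one>\<^bsub>G\<^esub>" by (intro Stab_affine_trivial)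
    then have "x = g" using \<open>x \<in> carrier G\<close> gx by (metis G.inv_closed G.inv_equality G.inv_inv)
    then show "x \<in> Omega R Pos" using g by simp
  qed
qed

end

section \<open>Lengths in the extended affine Weyl group and characters\<close>

context irr_root_data
begin

lemma affine_weyl_mult: "monoid.mult N = monoid.mult G" "\<one>\<^bsub>N\<^esub> = \<one>\<^bsub>G\<^esub>"
  by (simp_all add: ext_affine_def)

lemma Stab_carrier: "g \<in> Stab \<Longrightarrow> g \<in> carrier G"
  by (simp add: Stab_def)

lemma affine_gens_carrier: "s \<in> affine_gens R Pos \<Longrightarrow> s \<in> carrier G"
  using affine_gens_closed root_lattice_subset by auto

lemma affine_carrier: "u \<in> Q \<times> W \<Longrightarrow> u \<in> carrier G"
  using root_lattice_subset by auto

lemma Stab_conj_word: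
  assumes g: "g \<in> Stab"
    and w: "\<exists>xs. set xs \<subseteq> affine_gens R Pos \<and> length xs = k \<and> foldr (\<otimes>\<^bsub>G\<^esub>) xs \<one>\<^bsub>G\<^esub> = w"
  shows "\<exists>xs. set xs \<subseteq> affine_gens R Pos \<and> length xs = k
    \<and> foldr (\<otimes>\<^bsub>G\<^esub>) xs \<one>\<^bsub>G\<^esub> = g \<otimes>\<^bsub>G\<^esub> w \<otimes>\<^bsub>G\<^esub> inv\<^bsub>G\<^esub> g"
proof -
  interpret G: group G by (rule group_G)
  define c where "c = (\<lambda>x. g \<otimes>\<^bsub>G\<^esub> x \<otimes>\<^bsub>G\<^esub> inv\<^bsub>G\<^esub> g)"
  have gc: "g \<in> carrier G" using g by (rule Stab_carrier)
  have c_mult: "c (x \<otimes>\<^bsub>G\<^esub> y) = c x \<otimes>\<^bsub>G\<^esub> c y" if xy: "x \<in> carrier G" "y \<in> carrier G" for x y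
  proof -
    have "inv\<^bsub>G\<^esub> g \<otimes>\<^bsub>G\<^esub> (g \<otimes>\<^bsub>G\<^esub> (y \<otimes>\<^bsub>G\<^esub> inv\<^bsub>G\<^esub> g)) = y \<otimes>\<^bsub>G\<^esub> inv\<^bsub>G\<^esub> g"
      using gc xy by (simp only: G.m_assoc[symmetric] G.l_inv G.l_one G.inv_closed G.m_closed)
    then show ?thesis unfolding c_def using gc xy by (simp only: G.m_assoc G.inv_closed G.m_closed)
  qed
  have c_one: "c \<one>\<^bsub>G\<^esub> = \<one>\<^bsub>G\<^esub>" unfolding c_def using gc by (simp only: G.r_one G.r_inv)
  have fold: "foldr (\<otimes>\<^bsub>G\<^esub>) xs \<one>\<^bsub>G\<^esub> \<in> carrier G \<and>
      foldr (\<otimes>\<^bsub>G\<^esub>) (map c xs) \<one>\<^bsub>G\<^esub> = c (foldr (\<otimes>\<^bsub>G\<^esub>) xs \<one>\<^bsub>G\<^esub>) \<and> set (map c xs) \<subseteq> affine_gens R Pos"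
    if "set xs \<subseteq> affine_gens R Pos" for xs
    using that
  proof (induction xs)
    case Nil
    then show ?case using c_one G.one_closed by (simp del: ext_affine_simps)
  next
    case (Cons s xs)
    have s: "s \<in> affine_gens R Pos" "s \<in> carrier G" using Cons.prems affine_gens_carrier by auto
    have "c s \<in> affine_gens R Pos" unfolding c_def using g s(1) by (rule Stab_conj)
    then show ?case using Cons s c_mult by (simp del: ext_affine_simps add: G.m_closed)
  qed
  obtain xs where xs: "set xs \<subseteq> affine_gens R Pos" "length xs = k" "foldr (\<otimes>\<^bsub>G\<^esub>) xs \<one>\<^bsub>G\<^esub> = w"
    using w by blast
  then show ?thesis
    using fold[OF xs(1)] by (intro exI[of _ "map c xs"]) (simp add: c_def del: ext_affine_simps)
qed

text \<open>Conjugation by \<open>g\<close> turns words in the generators into words of the same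
  number of letters, and conjugation by the inverse turns them back.\<close>

lemma word_length_conj:
  assumes g: "g \<in> Stab" and w: "w \<in> carrier G"
  shows "word_length N (affine_gens R Pos) (g \<otimes>\<^bsub>G\<^esub> w \<otimes>\<^bsub>G\<^esub> inv\<^bsub>G\<^esub> g) = word_length N (affine_gens R Pos) w"
proof -
  interpret G: group G by (rule group_G)
  have gc: "g \<in> carrier G" using g by (rule Stab_carrier)
  have gi: "inv\<^bsub>G\<^esub> g \<in> Stab" using subgroup.m_inv_closed[OF subgroup_Stab g] .
  have "inv\<^bsub>G\<^esub> g \<otimes>\<^bsub>G\<^esub> (g \<otimes>\<^bsub>G\<^esub> w \<otimes>\<^bsub>G\<^esub> inv\<^bsub>G\<^esub> g) \<otimes>\<^bsub>G\<^esub> inv\<^bsub>G\<^esub> (inv\<^bsub>G\<^esub> g) = w"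
  proof -
    have "inv\<^bsub>G\<^esub> g \<otimes>\<^bsub>G\<^esub> (g \<otimes>\<^bsub>G\<^esub> w \<otimes>\<^bsub>G\<^esub> inv\<^bsub>G\<^esub> g) = w \<otimes>\<^bsub>G\<^esub> inv\<^bsub>G\<^esub> g"
      using gc w by (simp only: G.m_assoc[symmetric] G.l_inv G.l_one G.inv_closed G.m_closed)
    then show ?thesis using gc w by (simp only: G.inv_inv G.m_assoc G.inv_closed G.l_inv G.r_one)
  qed
  then have "(\<exists>xs. set xs \<subseteq> affine_gens R Pos \<and> length xs = k
        \<and> foldr (\<otimes>\<^bsub>G\<^esub>) xs \<one>\<^bsub>G\<^esub> = g \<otimes>\<^bsub>G\<^esub> w \<otimes>\<^bsub>G\<^esub> inv\<^bsub>G\<^esub> g)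
      \<longleftrightarrow> (\<exists>xs. set xs \<subseteq> affine_gens R Pos \<and> length xs = k \<and> foldr (\<otimes>\<^bsub>G\<^esub>) xs \<one>\<^bsub>G\<^esub> = w)" for k
    using Stab_conj_word[OF g, of k w] Stab_conj_word[OF gi, of k "g \<otimes>\<^bsub>G\<^esub> w \<otimes>\<^bsub>G\<^esub> inv\<^bsub>G\<^esub> g"] by metis
  then show ?thesis unfolding word_length_def affine_weyl_mult by simp
qed

text \<open>The stabilizer meets the affine Weyl group trivially, so the factor in the affine Weyl
  group is unique and the definite description returns it.\<close>

lemma ext_length_eq:
  assumes u: "u \<in> Q \<times> W" and g: "g \<in> Stab"
  shows "ext_length R Pos (u \<otimes>\<^bsub>G\<^esub> g) = word_length N (affine_gens R Pos) u"
proof -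
  interpret G: group G by (rule group_G)
  interpret S: subgroup Stab G by (rule subgroup_Stab)
  interpret A: subgroup "Q \<times> W" G
    by (rule subgroup_lattice[OF stable_root_lattice]) (auto simp: root_lattice_subset)
  have "(THE w. w \<in> carrier N \<and> (\<exists>h\<in>Omega R Pos. u \<otimes>\<^bsub>G\<^esub> g = w \<otimes>\<^bsub>G\<^esub> h)) = u"
  proof (rule the_equality)
    show "u \<in> carrier N \<and> (\<exists>h\<in>Omega R Pos. u \<otimes>\<^bsub>G\<^esub> g = u \<otimes>\<^bsub>G\<^esub> h)"
      using u g by (auto simp: Omega_eq_Stab)
  next
    fix w assume "w \<in> carrier N \<and> (\<exists>h\<in>Omega R Pos. u \<otimes>\<^bsub>G\<^esub> g = w \<otimes>\<^bsub>G\<^esub> h)"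
    then obtain h where w: "w \<in> Q \<times> W" and h: "h \<in> Stab" and e: "u \<otimes>\<^bsub>G\<^esub> g = w \<otimes>\<^bsub>G\<^esub> h"
      by (auto simp: Omega_eq_Stab simp del: ext_affine_simps(3))
    note cl = A.mem_carrier[OF u] A.mem_carrier[OF w] S.mem_carrier[OF g] S.mem_carrier[OF h]
    have "inv\<^bsub>G\<^esub> w \<otimes>\<^bsub>G\<^esub> u = h \<otimes>\<^bsub>G\<^esub> inv\<^bsub>G\<^esub> g"
    proof -
      have "inv\<^bsub>G\<^esub> w \<otimes>\<^bsub>G\<^esub> u = inv\<^bsub>G\<^esub> w \<otimes>\<^bsub>G\<^esub> (u \<otimes>\<^bsub>G\<^esub> g) \<otimes>\<^bsub>G\<^esub> inv\<^bsub>G\<^esub> g"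
        using cl by (simp only: G.m_assoc G.inv_closed G.m_closed G.r_inv G.r_one)
      also have "\<dots> = h \<otimes>\<^bsub>G\<^esub> inv\<^bsub>G\<^esub> g"
        unfolding e using cl by (simp only: G.m_assoc[symmetric] G.inv_closed G.m_closed G.l_inv G.l_one)
      finally show ?thesis .
    qed
    moreover have "inv\<^bsub>G\<^esub> w \<otimes>\<^bsub>G\<^esub> u \<in> Q \<times> W" using u w by (intro A.m_closed A.m_inv_closed)
    moreover have "h \<otimes>\<^bsub>G\<^esub> inv\<^bsub>G\<^esub> g \<in> Stab" using g h by (intro S.m_closed S.m_inv_closed)
    ultimately have "inv\<^bsub>G\<^esub> w \<otimes>\<^bsub>G\<^esub> u = \<one>\<^bsub>G\<^esub>"
      using Stab_affine_trivial[of "inv\<^bsub>G\<^esub> w \<otimes>\<^bsub>G\<^esub> u"] by (metis mem_Times_iff)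
    then show "w = u" using cl by (metis G.inv_closed G.inv_equality G.inv_inv)
  qed
  then show ?thesis by (simp only: ext_length_def)
qed

lemma decomposition:
  assumes "x \<in> carrier G"
  obtains u g where "u \<in> Q \<times> W" "g \<in> Stab" "x = u \<otimes>\<^bsub>G\<^esub> g"
proof -
  interpret G: group G by (rule group_G)
  obtain g where g: "g \<in> Stab" "fst x - fst g \<in> Q"
    using Omega_representative[of "fst x"] assms by auto
  have gc: "g \<in> carrier G" using g(1) by (rule Stab_carrier)
  have "x = x \<otimes>\<^bsub>G\<^esub> inv\<^bsub>G\<^esub> g \<otimes>\<^bsub>G\<^esub> g"
    using assms gc by (simp only: G.m_assoc G.inv_closed G.l_inv G.r_one)
  then show ?thesis by (rule that[OF class_difference[OF assms gc g(2)] g(1)])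
qed

lemma ext_length_right:
  assumes g: "g \<in> Stab" and x: "x \<in> carrier G"
  shows "ext_length R Pos (x \<otimes>\<^bsub>G\<^esub> g) = ext_length R Pos x"
proof -
  interpret G: group G by (rule group_G)
  obtain u h where u: "u \<in> Q \<times> W" "h \<in> Stab" "x = u \<otimes>\<^bsub>G\<^esub> h" using decomposition[OF x] .
  have "x \<otimes>\<^bsub>G\<^esub> g = u \<otimes>\<^bsub>G\<^esub> (h \<otimes>\<^bsub>G\<^esub> g)"
    unfolding u(3) by (rule G.m_assoc[OF affine_carrier[OF u(1)] Stab_carrier[OF u(2)] Stab_carrier[OF g]])
  then show ?thesis
    using ext_length_eq[OF u(1) subgroup.m_closed[OF subgroup_Stab u(2) g]] ext_length_eq[OF u(1,2)]
    unfolding u(3) by metis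
qed

text \<open>With \<open>x = u h\<close> the product is \<open>(g u g^(-1)) (g h)\<close>: the first
  factor stays over \<open>Q\<close> and keeps its length under conjugation, and the second lies in
  the stabilizer.\<close>

lemma ext_length_left:
  assumes g: "g \<in> Stab" and x: "x \<in> carrier G"
  shows "ext_length R Pos (g \<otimes>\<^bsub>G\<^esub> x) = ext_length R Pos x"
proof -
  interpret G: group G by (rule group_G)
  obtain u h where u: "u \<in> Q \<times> W" "h \<in> Stab" "x = u \<otimes>\<^bsub>G\<^esub> h" using decomposition[OF x] .
  note cl = affine_carrier[OF u(1)] Stab_carrier[OF u(2)] Stab_carrier[OF g]
  let ?u = "g \<otimes>\<^bsub>G\<^esub> u \<otimes>\<^bsub>G\<^esub> inv\<^bsub>G\<^esub> g"
  have "inv\<^bsub>G\<^esub> g \<otimes>\<^bsub>G\<^esub> (g \<otimes>\<^bsub>G\<^esub> h) = h"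
    using cl by (simp only: G.m_assoc[symmetric] G.l_inv G.l_one G.inv_closed)
  then have e: "g \<otimes>\<^bsub>G\<^esub> x = ?u \<otimes>\<^bsub>G\<^esub> (g \<otimes>\<^bsub>G\<^esub> h)"
    unfolding u(3) using cl by (simp only: G.m_assoc G.inv_closed G.m_closed)
  have "snd g (fst u) \<in> Q"
    using stable_root_lattice u(1) cl(3) by (auto simp: stable_lattice_def mem_Times_iff)
  then have "fst (g \<otimes>\<^bsub>G\<^esub> u) - fst g \<in> Q" by simp
  then have "?u \<in> Q \<times> W" using cl by (intro class_difference G.m_closed)
  then have "ext_length R Pos (?u \<otimes>\<^bsub>G\<^esub> (g \<otimes>\<^bsub>G\<^esub> h)) = word_length N (affine_gens R Pos) ?u"
    by (rule ext_length_eq[OF _ subgroup.m_closed[OF subgroup_Stab g u(2)]])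
  also have "\<dots> = word_length N (affine_gens R Pos) u" by (rule word_length_conj[OF g cl(1)])
  finally show ?thesis unfolding e using ext_length_eq[OF u(1,2)] u(3) by simp
qed

lemma ext_length_one: "ext_length R Pos \<one>\<^bsub>G\<^esub> = 0"
proof -
  interpret G: group G by (rule group_G)
  have "\<one>\<^bsub>G\<^esub> \<in> Q \<times> W" using root_lattice_zero weyl_id by simp
  from ext_length_eq[OF this subgroup.one_closed[OF subgroup_Stab]]
  have "ext_length R Pos \<one>\<^bsub>G\<^esub> = word_length N (affine_gens R Pos) \<one>\<^bsub>N\<^esub>"
    unfolding G.r_one[OF G.one_closed] affine_weyl_mult .
  also have "\<dots> = 0" unfolding word_length_def by (rule Least_eq_0) (rule exI[of _ "[]"], simp)
  finally show ?thesis .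
qed

lemma finite_Omega: "finite (Omega R Pos)"
  using finite_D by (simp add: Omega_def)

end

section \<open>Extension of characters of lattices\<close>

definition lattice_char :: "'a::euclidean_space set \<Rightarrow> ('a \<Rightarrow> complex) \<Rightarrow> bool" where
  "lattice_char H \<eta> \<longleftrightarrow> (\<forall>x\<in>H. \<forall>y\<in>H. \<eta> (x + y) = \<eta> x * \<eta> y) \<and> (\<forall>x\<in>H. \<eta> x \<noteq> 0)"

lemma add_subgroup_scale:
  assumes "add_subgroup H" "x \<in> H" shows "real_of_int k *\<^sub>R x \<in> H"
proof -
  have z: "0 \<in> H" and d: "\<And>x y. x \<in> H \<Longrightarrow> y \<in> H \<Longrightarrow> x - y \<in> H"
    using assms(1) by (auto simp: add_subgroup_def)
  have neg: "- y \<in> H" if "y \<in> H" for y using d[OF z that] by simp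
  have add: "y + y' \<in> H" if "y \<in> H" "y' \<in> H" for y y' using d[OF that(1) neg[OF that(2)]] by simp
  have nat: "real n *\<^sub>R x \<in> H" for n
    by (induction n) (use z add assms(2) in \<open>auto simp: scaleR_left_distrib\<close>)
  show ?thesis
    using nat[of "nat k"] neg[OF nat[of "nat (- k)"]] by (cases "k \<ge> 0") auto
qed

lemma lattice_char_power:
  assumes H: "add_subgroup H" and \<eta>: "lattice_char H \<eta>" and x: "x \<in> H"
  shows "\<eta> (real_of_int k *\<^sub>R x) = \<eta> x powi k"
proof -
  have z: "0 \<in> H" using H by (simp add: add_subgroup_def)
  have mult: "\<And>x y. x \<in> H \<Longrightarrow> y \<in> H \<Longrightarrow> \<eta> (x + y) = \<eta> x * \<eta> y" and nz: "\<And>x. x \<in> H \<Longrightarrow> \<eta> x \<noteq> 0"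
    using \<eta> by (auto simp: lattice_char_def)
  have one: "\<eta> 0 = 1" using mult[OF z z] nz[OF z] by simp
  have nat: "\<eta> (real n *\<^sub>R x) = \<eta> x ^ n" for n
  proof (induction n)
    case (Suc n)
    have "real n *\<^sub>R x \<in> H" using add_subgroup_scale[OF H x, of "int n"] by simp
    then show ?case using mult[OF x, of "real n *\<^sub>R x"] Suc by (simp add: scaleR_left_distrib)
  qed (simp add: one)
  show ?thesis
  proof (cases "k \<ge> 0")
    case True
    then show ?thesis using nat[of "nat k"] by (simp add: power_int_def)
  next
    case False
    then have k: "real_of_int k = - real (nat (- k))" by simp
    have h: "real (nat (- k)) *\<^sub>R x \<in> H" "- (real (nat (- k)) *\<^sub>R x) \<in> H"
      using add_subgroup_scale[OF H x, of "- k"] add_subgroup_scale[OF H x, of k] False by auto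
    have "\<eta> (- (real (nat (- k)) *\<^sub>R x)) * \<eta> (real (nat (- k)) *\<^sub>R x) = 1"
      using mult[OF h(2,1)] one by simp
    then have "\<eta> (- (real (nat (- k)) *\<^sub>R x)) = inverse (\<eta> x ^ nat (- k))"
      unfolding nat by (metis inverse_unique mult.commute)
    then show ?thesis using False unfolding k by (simp add: power_int_def power_inverse)
  qed
qed

text \<open>The value at \<open>h + k x\<close> is forced to be that of \<open>h\<close> times
  \<open>z\<close> to the power \<open>k\<close>. The hypothesis \<open>compat\<close> makes it
  independent of the expression.\<close>

lemma extend_char:
  assumes H: "add_subgroup H" and \<eta>: "lattice_char H \<eta>" and z: "z \<noteq> 0"
    and compat: "\<And>k. real_of_int k *\<^sub>R x \<in> H \<Longrightarrow> \<eta> (real_of_int k *\<^sub>R x) = z powi k"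
  shows "\<exists>H' \<eta>'. add_subgroup H' \<and> H \<subseteq> H' \<and> x \<in> H' \<and> lattice_char H' \<eta>' \<and> (\<forall>h\<in>H. \<eta>' h = \<eta> h) \<and> \<eta>' x = z"
proof -
  have H0: "0 \<in> H" and Hd: "\<And>x y. x \<in> H \<Longrightarrow> y \<in> H \<Longrightarrow> x - y \<in> H"
    using H by (auto simp: add_subgroup_def)
  have Ha: "a + b \<in> H" if "a \<in> H" "b \<in> H" for a b
    using Hd[OF that(1) Hd[OF H0 that(2)]] by simp
  have mult: "\<And>x y. x \<in> H \<Longrightarrow> y \<in> H \<Longrightarrow> \<eta> (x + y) = \<eta> x * \<eta> y" and nz: "\<And>x. x \<in> H \<Longrightarrow> \<eta> x \<noteq> 0"
    using \<eta> by (auto simp: lattice_char_def)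
  have one: "\<eta> 0 = 1" using mult[OF H0 H0] nz[OF H0] by simp
  define H' where "H' = {h + real_of_int k *\<^sub>R x | h k. h \<in> H}"
  define \<eta>' where "\<eta>' = (\<lambda>y. THE c. \<exists>h k. h \<in> H \<and> y = h + real_of_int k *\<^sub>R x \<and> c = \<eta> h * z powi k)"
  have val: "\<eta>' (h + real_of_int k *\<^sub>R x) = \<eta> h * z powi k" if h: "h \<in> H" for h k
    unfolding \<eta>'_def
  proof (rule the_equality)
    show "\<exists>h' k'. h' \<in> H \<and> h + real_of_int k *\<^sub>R x = h' + real_of_int k' *\<^sub>R x \<and> \<eta> h * z powi k = \<eta> h' * z powi k'"
      using h by blast
  next
    fix c assume "\<exists>h' k'. h' \<in> H \<and> h + real_of_int k *\<^sub>R x = h' + real_of_int k' *\<^sub>R x \<and> c = \<eta> h' * z powi k'"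
    then obtain h' k' where h': "h' \<in> H" "h + real_of_int k *\<^sub>R x = h' + real_of_int k' *\<^sub>R x" "c = \<eta> h' * z powi k'"
      by blast
    \<comment> \<open>Two expressions of the same vector differ by a multiple of \<open>x\<close> in
      \<open>H\<close>, which is where \<open>compat\<close> applies.\<close>
    have e: "h' - h = real_of_int (k - k') *\<^sub>R x"
      using h'(2) by (simp add: scaleR_left_diff_distrib algebra_simps)
    have d: "h' - h \<in> H" using Hd h' h by blast
    have "\<eta> (h' - h) = z powi (k - k')" unfolding e by (rule compat) (use d e in simp)
    moreover have "\<eta> h' = \<eta> h * \<eta> (h' - h)" using mult[OF h d] by simp
    ultimately have "c = \<eta> h * (z powi (k - k') * z powi k')" using h'(3) by simp
    also have "z powi (k - k') * z powi k' = z powi k"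
      using z by (simp add: power_int_add[symmetric])
    finally show "c = \<eta> h * z powi k" .
  qed
  have cases: "\<exists>h k. h \<in> H \<and> y = h + real_of_int k *\<^sub>R x" if "y \<in> H'" for y
    using that unfolding H'_def by blast
  have memI: "h + real_of_int k *\<^sub>R x \<in> H'" if "h \<in> H" for h k
    using that unfolding H'_def by blast
  have sub: "add_subgroup H'"
    unfolding add_subgroup_def
  proof (intro conjI ballI)
    show "0 \<in> H'" using memI[OF H0, of 0] by simp
    fix a b assume "a \<in> H'" "b \<in> H'"
    then obtain h k h' k' where hk: "h \<in> H" "h' \<in> H" "a = h + real_of_int k *\<^sub>R x" "b = h' + real_of_int k' *\<^sub>R x"
      using cases by meson
    have "a - b = (h - h') + real_of_int (k - k') *\<^sub>R x"
      unfolding hk(3,4) by (simp add: scaleR_left_diff_distrib)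
    then show "a - b \<in> H'" using memI[OF Hd[OF hk(1,2)], of "k - k'"] by simp
  qed
  have char: "lattice_char H' \<eta>'"
    unfolding lattice_char_def
  proof (intro conjI ballI)
    fix a b assume "a \<in> H'" "b \<in> H'"
    then obtain h k h' k' where hk: "h \<in> H" "h' \<in> H" "a = h + real_of_int k *\<^sub>R x" "b = h' + real_of_int k' *\<^sub>R x"
      using cases by meson
    have ab: "a + b = (h + h') + real_of_int (k + k') *\<^sub>R x"
      unfolding hk(3,4) by (simp add: scaleR_left_distrib)
    have "\<eta>' (a + b) = \<eta> (h + h') * z powi (k + k')"
      unfolding ab by (rule val[OF Ha[OF hk(1,2)]])
    moreover have "\<eta>' a = \<eta> h * z powi k" unfolding hk(3) by (rule val[OF hk(1)])
    moreover have "\<eta>' b = \<eta> h' * z powi k'" unfolding hk(4) by (rule val[OF hk(2)])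
    ultimately show "\<eta>' (a + b) = \<eta>' a * \<eta>' b"
      using z mult[OF hk(1,2)] by (simp add: power_int_add)
  next
    fix a assume "a \<in> H'"
    then obtain h k where "h \<in> H" "a = h + real_of_int k *\<^sub>R x" using cases by blast
    then show "\<eta>' a \<noteq> 0" using val nz z by simp
  qed
  have "H \<subseteq> H'" using memI[where k = 0] by auto
  moreover have "x \<in> H'" using memI[OF H0, of 1] by simp
  moreover have "\<forall>h\<in>H. \<eta>' h = \<eta> h" using val[where k = 0] by auto
  moreover have "\<eta>' x = z" using val[OF H0, of 1] one by simp
  ultimately show ?thesis using sub char by blast
qed

text \<open>The multiples of \<open>x\<close> in \<open>H\<close> are those of the least positive
  one, by division with remainder. It is therefore enough that \<open>z\<close> is correct at this
  least multiple.\<close>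

lemma compatible_root:
  assumes H: "add_subgroup H" and \<eta>: "lattice_char H \<eta>"
    and n: "n > 0" "real_of_int n *\<^sub>R x \<in> H" "\<And>m. 0 < m \<Longrightarrow> real_of_int m *\<^sub>R x \<in> H \<Longrightarrow> n \<le> m"
    and z: "z powi n = \<eta> (real_of_int n *\<^sub>R x)"
    and k: "real_of_int k *\<^sub>R x \<in> H"
  shows "\<eta> (real_of_int k *\<^sub>R x) = z powi k"
proof -
  have "real_of_int (k mod n) *\<^sub>R x = real_of_int k *\<^sub>R x - real_of_int (k div n) *\<^sub>R (real_of_int n *\<^sub>R x)"
  proof -
    have "real_of_int (k mod n) = real_of_int k - real_of_int (k div n) * real_of_int n"
      by (simp add: minus_div_mult_eq_mod[symmetric])
    then show ?thesis by (simp add: scaleR_left_diff_distrib)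
  qed
  also have "\<dots> \<in> H" using H k add_subgroup_scale[OF H n(2)] by (auto simp: add_subgroup_def)
  finally have "k mod n = 0"
    using n(3)[of "k mod n"] n(1) pos_mod_sign[OF n(1), of k] pos_mod_bound[OF n(1), of k] by linarith
  then obtain m where m: "k = n * m" by auto
  have "real_of_int k *\<^sub>R x = real_of_int m *\<^sub>R (real_of_int n *\<^sub>R x)" by (simp add: m mult.commute)
  then have "\<eta> (real_of_int k *\<^sub>R x) = \<eta> (real_of_int m *\<^sub>R (real_of_int n *\<^sub>R x))"
    by (rule arg_cong)
  also have "\<dots> = \<eta> (real_of_int n *\<^sub>R x) powi m" by (rule lattice_char_power[OF H \<eta> n(2)])
  finally show ?thesis by (simp add: z[symmetric] m power_int_mult)
qed

lemma least_multiple: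
  assumes "k \<noteq> 0" "real_of_int k *\<^sub>R x \<in> H" "add_subgroup H"
  obtains n where "n > 0" "real_of_int n *\<^sub>R x \<in> H" "\<And>m. 0 < m \<Longrightarrow> real_of_int m *\<^sub>R x \<in> H \<Longrightarrow> n \<le> m"
proof -
  let ?P = "\<lambda>i::nat. i > 0 \<and> real_of_int (int i) *\<^sub>R x \<in> H"
  have "real_of_int (- k) *\<^sub>R x \<in> H"
    using add_subgroup_scale[OF assms(3,2), of "-1"] by simp
  then have "?P (nat \<bar>k\<bar>)" using assms by (cases "k \<ge> 0") auto
  then have P: "?P (LEAST i. ?P i)" by (rule LeastI)
  show ?thesis
  proof (rule that[of "int (LEAST i. ?P i)"])
    show "int (LEAST i. ?P i) > 0" "real_of_int (int (LEAST i. ?P i)) *\<^sub>R x \<in> H" using P by auto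
    fix m :: int assume "0 < m" "real_of_int m *\<^sub>R x \<in> H"
    then have "?P (nat m)" by simp
    then have "(LEAST i. ?P i) \<le> nat m" by (rule Least_le)
    then show "int (LEAST i. ?P i) \<le> m" using \<open>0 < m\<close> by linarith
  qed
qed

text \<open>Nonzero complex numbers have roots of every order. An n-th root of the value at the
  least multiple of \<open>x\<close> in \<open>H\<close> is a compatible value for
  \<open>x\<close>.\<close>

lemma extend_char_any:
  assumes H: "add_subgroup H" and \<eta>: "lattice_char H \<eta>"
  shows "\<exists>H' \<eta>'. add_subgroup H' \<and> H \<subseteq> H' \<and> x \<in> H' \<and> lattice_char H' \<eta>' \<and> (\<forall>h\<in>H. \<eta>' h = \<eta> h)"
proof -
  have nz: "\<And>x. x \<in> H \<Longrightarrow> \<eta> x \<noteq> 0" using \<eta> by (auto simp: lattice_char_def)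
  have "\<exists>z. z \<noteq> 0 \<and> (\<forall>k. real_of_int k *\<^sub>R x \<in> H \<longrightarrow> \<eta> (real_of_int k *\<^sub>R x) = z powi k)"
  proof (cases "\<exists>k. k \<noteq> 0 \<and> real_of_int k *\<^sub>R x \<in> H")
    case True
    then obtain n where n: "n > 0" "real_of_int n *\<^sub>R x \<in> H"
      "\<And>m. 0 < m \<Longrightarrow> real_of_int m *\<^sub>R x \<in> H \<Longrightarrow> n \<le> m"
      using least_multiple[OF _ _ H] by blast
    \<comment> \<open>Dividing a logarithm by \<open>n\<close> gives an n-th root; the value under
      the logarithm is nonzero by the definition of a character.\<close>
    define z where "z = exp (Ln (\<eta> (real_of_int n *\<^sub>R x)) / of_int n)"
    have "z powi n = z ^ nat n" using n(1) by (simp add: power_int_def)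
    also have "\<dots> = exp (of_nat (nat n) * (Ln (\<eta> (real_of_int n *\<^sub>R x)) / of_int n))"
      unfolding z_def by (rule exp_of_nat_mult[symmetric])
    also have "\<dots> = \<eta> (real_of_int n *\<^sub>R x)"
      using n(1) nz[OF n(2)] by (simp add: of_nat_nat)
    finally have "z powi n = \<eta> (real_of_int n *\<^sub>R x)" .
    then show ?thesis using compatible_root[OF H \<eta> n] by (intro exI[of _ z]) (auto simp: z_def)
  next
    \<comment> \<open>Only the zero multiple of \<open>x\<close> lies in \<open>H\<close>, so the
      choice of \<open>z\<close> is free; it is set to 1.\<close>
    case False
    have H0: "0 \<in> H" using H by (simp add: add_subgroup_def)
    have "\<eta> (0 + 0) = \<eta> 0 * \<eta> 0" using \<eta> H0 unfolding lattice_char_def by blast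
    then have "\<eta> 0 = 1" using nz[OF H0] by simp
    then have "\<eta> (real_of_int k *\<^sub>R x) = 1 powi k" if "real_of_int k *\<^sub>R x \<in> H" for k
      using False that by (cases "k = 0") auto
    then show ?thesis by (intro exI[of _ 1]) simp
  qed
  then obtain z where "z \<noteq> 0" "\<And>k. real_of_int k *\<^sub>R x \<in> H \<Longrightarrow> \<eta> (real_of_int k *\<^sub>R x) = z powi k" by blast
  from extend_char[OF H \<eta> this] show ?thesis by blast
qed

lemma extend_char_list:
  assumes "add_subgroup H" "lattice_char H \<eta>"
  shows "\<exists>H' \<eta>'. add_subgroup H' \<and> H \<subseteq> H' \<and> set xs \<subseteq> H' \<and> lattice_char H' \<eta>' \<and> (\<forall>h\<in>H. \<eta>' h = \<eta> h)"
proof (induction xs)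
  case Nil
  then show ?case using assms by (intro exI[of _ H] exI[of _ \<eta>]) simp
next
  case (Cons x xs)
  then obtain H1 \<eta>1 where 1: "add_subgroup H1" "H \<subseteq> H1" "set xs \<subseteq> H1" "lattice_char H1 \<eta>1" "\<forall>h\<in>H. \<eta>1 h = \<eta> h"
    by blast
  obtain H2 \<eta>2 where 2: "add_subgroup H2" "H1 \<subseteq> H2" "x \<in> H2" "lattice_char H2 \<eta>2" "\<forall>h\<in>H1. \<eta>2 h = \<eta>1 h"
    using extend_char_any[OF 1(1,4), of x] by blast
  show ?case using 1 2 by (intro exI[of _ H2] exI[of _ \<eta>2]) auto
qed

text \<open>The trivial character of \<open>L\<close> is extended to \<open>x\<close> by a root of
  unity of exact order n, the order of \<open>x\<close> modulo \<open>L\<close>. If that order is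
  infinite, every nonzero value is compatible and 2 is taken.\<close>

lemma nontrivial_char:
  assumes L: "add_subgroup L" and x: "x \<notin> L"
  shows "\<exists>H' \<eta>'. add_subgroup H' \<and> L \<subseteq> H' \<and> x \<in> H' \<and> lattice_char H' \<eta>' \<and> (\<forall>h\<in>L. \<eta>' h = 1) \<and> \<eta>' x \<noteq> 1"
proof -
  let ?\<eta> = "\<lambda>_::'a. 1 :: complex"
  have \<eta>: "lattice_char L ?\<eta>" by (simp add: lattice_char_def)
  have "\<exists>z::complex. z \<noteq> 0 \<and> z \<noteq> 1 \<and> (\<forall>k. real_of_int k *\<^sub>R x \<in> L \<longrightarrow> 1 = z powi k)"
  proof (cases "\<exists>k. k \<noteq> 0 \<and> real_of_int k *\<^sub>R x \<in> L")
    case True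
    then obtain n where n: "n > 0" "real_of_int n *\<^sub>R x \<in> L"
      "\<And>m. 0 < m \<Longrightarrow> real_of_int m *\<^sub>R x \<in> L \<Longrightarrow> n \<le> m"
      using least_multiple[OF _ _ L] by blast
    \<comment> \<open>The order of \<open>x\<close> modulo \<open>L\<close> exceeds 1 because
      \<open>x\<close> lies outside \<open>L\<close>; this is what makes the root of unity different
      from 1.\<close>
    have "n \<noteq> 1" using n(2) x by auto
    then have n2: "nat n \<ge> 2" using n(1) by linarith
    define z where "z = exp (2 * of_real pi * \<i> * of_nat 1 / of_nat (nat n))"
    have zn: "z ^ nat n = 1" unfolding z_def by (rule complex_root_unity) (use n2 in simp)
    have "z \<noteq> 1"
      unfolding z_def by (subst complex_root_unity_eq_1) (use n2 in auto)
    moreover have "z powi n = ?\<eta> (real_of_int n *\<^sub>R x)" using zn n(1) by (simp add: power_int_def)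
    ultimately show ?thesis
      using compatible_root[OF L \<eta> n, of z] by (intro exI[of _ z]) (auto simp: z_def)
  next
    case False
    then have "1 = (2::complex) powi k" if "real_of_int k *\<^sub>R x \<in> L" for k
      using that by (cases "k = 0") auto
    then show ?thesis by (intro exI[of _ 2]) simp
  qed
  then obtain z :: complex where "z \<noteq> 0" "z \<noteq> 1" "\<And>k. real_of_int k *\<^sub>R x \<in> L \<Longrightarrow> 1 = z powi k" by blast
  then show ?thesis using extend_char[OF L \<eta> \<open>z \<noteq> 0\<close>, of x] by force
qed

context root_data
begin

text \<open>A character of the group generated by \<open>L\<close> and \<open>x\<close> that differs
  from 1 at \<open>x\<close> is extended over the finitely many fundamental weights, one at a time,
  until it is defined on the whole weight lattice.\<close>

lemma separating_char:
  assumes L: "add_subgroup L" and x: "x \<notin> L"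
  shows "\<exists>\<eta>. lattice_char (weight_lattice Pos) \<eta> \<and> (\<forall>h\<in>L \<inter> weight_lattice Pos. \<eta> h = 1) \<and> (x \<in> weight_lattice Pos \<longrightarrow> \<eta> x \<noteq> 1)"
proof -
  obtain H \<eta> where H: "add_subgroup H" "L \<subseteq> H" "x \<in> H" "lattice_char H \<eta>" "\<forall>h\<in>L. \<eta> h = 1" "\<eta> x \<noteq> 1"
    using nontrivial_char[OF L x] by blast
  obtain ds where ds: "set ds = \<omega> ` D" using finite_list[of "\<omega> ` D"] finite_D by auto
  obtain H' \<eta>' where H': "add_subgroup H'" "H \<subseteq> H'" "set ds \<subseteq> H'" "lattice_char H' \<eta>'" "\<forall>h\<in>H. \<eta>' h = \<eta> h"
    using extend_char_list[OF H(1,4)] by blast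
  have "weight_lattice Pos \<subseteq> H'"
  proof
    fix y assume "y \<in> weight_lattice Pos"
    then obtain c :: "'a \<Rightarrow> int" where y: "y = (\<Sum>\<alpha>\<in>D. real_of_int (c \<alpha>) *\<^sub>R \<omega> \<alpha>)"
      by (auto simp: weight_lattice_def)
    have "(\<Sum>\<alpha>\<in>A. real_of_int (c \<alpha>) *\<^sub>R \<omega> \<alpha>) \<in> H'" if "A \<subseteq> D" for A
      using finite_subset[OF that finite_D] that
    proof (induction A)
      case empty
      then show ?case using H'(1) by (simp add: add_subgroup_def)
    next
      case (insert \<alpha> A)
      have "\<omega> \<alpha> \<in> H'" using ds H'(3) insert.prems by auto
      then show ?case
        using insert add_subgroup_scale[OF H'(1)] add_subgroup_closed(4)[OF H'(1)] by simp
    qed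
    then show "y \<in> H'" using y by blast
  qed
  then have "lattice_char (weight_lattice Pos) \<eta>'" using H'(4) unfolding lattice_char_def by blast
  then show ?thesis using H H' by (intro exI[of _ \<eta>']) auto
qed

end

section \<open>Application to the affine Hecke algebras\<close>

lemma hecke_algebra_len:
  "hecke_algebra q R Pos L = len_hecke q (ext_affine R L) (ext_length R Pos) (affine_gens R Pos)"
  "hecke_T q R Pos L w = len_hecke_T q (ext_affine R L) (ext_length R Pos) (affine_gens R Pos) w"
  by (simp_all add: hecke_algebra_def hecke_T_def hecke_ideal_def hecke_relators_def braid_group_def
      braid_T_def braid_relations_def len_hecke_def len_hecke_T_def len_ideal_def len_relators_def
      len_braid_group_def len_class_def len_braid_relations_def del: ext_affine_simps)

lemma (in irr_root_data) hecke_pair_lattice: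
  assumes L: "add_subgroup L" "Q \<subseteq> L" "L \<subseteq> weight_lattice Pos"
  shows "hecke_pair_chars G (L \<times> W) (Omega R Pos) (affine_gens R Pos) (ext_length R Pos)"
proof (intro hecke_pair_chars.intro hecke_pair.intro hecke_pair_axioms.intro hecke_pair_chars_axioms.intro)
  show "group G" by (rule group_G)
  show "subgroup (L \<times> W) G" by (rule subgroup_lattice[OF stable_between[OF L] L(3)])
  show "subgroup (Omega R Pos) G" unfolding Omega_eq_Stab by (rule subgroup_Stab)
  show "finite (Omega R Pos)" by (rule finite_Omega)
  show "affine_gens R Pos \<subseteq> L \<times> W" using affine_gens_closed L(2) by auto
  show "\<exists>h\<in>L \<times> W. \<exists>g\<in>Omega R Pos. x = h \<otimes>\<^bsub>G\<^esub> g" if x: "x \<in> carrier G" for x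
  proof -
    obtain u g where u: "u \<in> Q \<times> W" "g \<in> Stab" "x = u \<otimes>\<^bsub>G\<^esub> g" using decomposition[OF x] .
    have "u \<in> L \<times> W" using u(1) L(2) by (auto simp: mem_Times_iff)
    then show ?thesis using u(2,3) unfolding Omega_eq_Stab by blast
  qed
  show "g \<otimes>\<^bsub>G\<^esub> s \<otimes>\<^bsub>G\<^esub> inv\<^bsub>G\<^esub> g \<in> affine_gens R Pos" if "g \<in> Omega R Pos" "s \<in> affine_gens R Pos" for g s
    using that unfolding Omega_eq_Stab by (rule Stab_conj)
  show "ext_length R Pos (g \<otimes>\<^bsub>G\<^esub> x) = ext_length R Pos x" if "g \<in> Omega R Pos" "x \<in> carrier G" for g x
    using that unfolding Omega_eq_Stab by (rule ext_length_left)
  show "ext_length R Pos (x \<otimes>\<^bsub>G\<^esub> g) = ext_length R Pos x" if "g \<in> Omega R Pos" "x \<in> carrier G" for g x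
    using that unfolding Omega_eq_Stab by (rule ext_length_right)
  show "ext_length R Pos \<one>\<^bsub>G\<^esub> = 0" by (rule ext_length_one)
  show "\<exists>\<eta>. (\<forall>y\<in>carrier G. \<forall>z\<in>carrier G. \<eta> (y \<otimes>\<^bsub>G\<^esub> z) = \<eta> y * \<eta> z) \<and> (\<forall>h\<in>L \<times> W. \<eta> h = 1) \<and> \<eta> x \<noteq> (1::complex)"
    if x: "x \<in> carrier G" "x \<notin> L \<times> W" for x
  proof -
    have fx: "fst x \<in> weight_lattice Pos" "fst x \<notin> L" using x by (auto simp: mem_Times_iff)
    obtain \<eta> where \<eta>: "lattice_char (weight_lattice Pos) \<eta>" "\<forall>h\<in>L \<inter> weight_lattice Pos. \<eta> h = 1" "\<eta> (fst x) \<noteq> 1"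
      using separating_char[OF L(1) fx(2)] fx(1) by blast
    \<comment> \<open>The product twists the second translation by a Weyl group element, which
      changes it by a vector of \<open>Q\<close>. The character is trivial on \<open>L\<close>,
      hence on \<open>Q\<close>, and does not see the twist.\<close>
    have "\<eta> (fst (y \<otimes>\<^bsub>G\<^esub> z)) = \<eta> (fst y) * \<eta> (fst z)" if yz: "y \<in> carrier G" "z \<in> carrier G" for y z
    proof -
      have P: "fst y \<in> weight_lattice Pos" "snd y \<in> W" "fst z \<in> weight_lattice Pos"
        using yz by (auto simp: mem_Times_iff)
      have d: "snd y (fst z) - fst z \<in> Q" and P': "snd y (fst z) \<in> weight_lattice Pos"
        using weyl_lattice[OF P(2,3)] .
      have dP: "snd y (fst z) - fst z \<in> weight_lattice Pos" using d by (rule root_lattice_subset)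
      have "\<eta> (snd y (fst z)) = \<eta> (snd y (fst z) - fst z) * \<eta> (fst z)"
        using \<eta>(1) dP P(3) unfolding lattice_char_def by (metis diff_add_cancel)
      moreover have "\<eta> (snd y (fst z) - fst z) = 1" using \<eta>(2) d dP L(2) by blast
      moreover have "\<eta> (fst y + snd y (fst z)) = \<eta> (fst y) * \<eta> (snd y (fst z))"
        using \<eta>(1) P(1) P' unfolding lattice_char_def by blast
      ultimately show ?thesis by simp
    qed
    moreover have "\<forall>h\<in>L \<times> W. \<eta> (fst h) = 1" using \<eta>(2) L(3) by auto
    ultimately show ?thesis using \<eta>(3) by (intro exI[of _ "\<lambda>x. \<eta> (fst x)"] conjI ballI) auto
  qed
qed

theorem theorem4p14:
  fixes R Pos L P :: "'a::euclidean_space set" and q :: complex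
  assumes "root_system R" and "reduced_roots R" and "irreducible_roots R"
    and "positive_system R Pos"
    and "P = weight_lattice Pos"
    and "add_subgroup L" and "root_lattice Pos \<subseteq> L" and "L \<subseteq> P"
    and "q \<noteq> 0"
  shows "\<exists>\<iota>. hecke_inclusion q R Pos L P \<iota> \<and>
           (\<exists>(K :: nat monoid) act.
              group K \<and> finite (carrier K) \<and>
              group_action K (carrier (hecke_algebra q R Pos P)) act \<and>
              (\<forall>k\<in>carrier K.
                 act k \<in> algebra_hom (hecke_algebra q R Pos P) (hecke_algebra q R Pos P)) \<and>
              \<iota> ` carrier (hecke_algebra q R Pos L) =
                {x \<in> carrier (hecke_algebra q R Pos P). \<forall>k\<in>carrier K. act k x = x})"
proof -
  interpret irr_root_data R Pos
    using assms(1-4) by unfold_locales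
  interpret hp: hecke_pair_chars G "L \<times> W" "Omega R Pos" "affine_gens R Pos" "ext_length R Pos" q
    by (rule hecke_pair_lattice) (use assms in auto)
  \<comment> \<open>The extended group with carrier restricted to \<open>L \<times> W\<close> is the
    group of \<open>L\<close> itself, so the abstract conclusion can be read as one about the
    algebras of the statement.\<close>
  note fixed = hp.hecke_fixed_points[folded ext_affine_restrict, folded hecke_algebra_len]
  show ?thesis
    using fixed by (simp only: hecke_inclusion_def assms(5) conj_assoc ext_affine_simps(1))
qed

end
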